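(* For $N\in\mathbb{N}_0$, $$R(-1,-2N)=\begin{cases}0 & (N\geq 1),\\ \tfrac12 & (N=0).\end{cases}$$ Hence the reverse value $\Phi_2^{\rm Rev}(-1,-2N;1,\Lambda)$ is convergent for $N\geq1$, and $\Phi_2^{\rm Rev}(-1,0;1,\Lambda)$ is not convergent.
   Context: For $m,n\in\mathbb{N}_0$ with $m+n$ odd, $R(-m,-n):=(-1)^n\frac{m!\,n!}{(m+n+1)!}+\sum_{k=1,\ k\ \text{even}}^{n}\binom{n}{k}\zeta(k-m-n)$, where $\zeta$ is the Riemann zeta function. $\Lambda$ is the von Mangoldt function, and $\Phi_2(s_1,s_2;1,\Lambda)$ is the meromorphic continuation to $\mathbb{C}^2$ of $\sum_{m_1=1}^\infty\sum_{m_2=1}^\infty \frac{\Lambda(m_2)}{m_1^{s_1}(m_1+m_2)^{s_2}}$ (absolutely convergent for $\Re s_2>1$, $\Re(s_1+s_2)>2$). The reverse value is $\Phi_2^{\rm Rev}(u_1,u_2;1,\Lambda)=\lim_{s_2\to u_2}\lim_{s_1\to u_1}\Phi_2(s_1,s_2;1,\Lambda)$. *)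

theory Defs
  imports
    "HOL-Complex_Analysis.Complex_Analysis"
    "HOL-Number_Theory.Prime_Powers"
begin

text \<open>
  The Riemann zeta function, as the analytic continuation of its Dirichlet series.
  The value at the pole is fixed to be 0 only to make the description unique.
\<close>

definition zeta :: "complex \<Rightarrow> complex" where
  "zeta = (THE f. f holomorphic_on (- {1}) \<and> f 1 = 0 \<and>
     (\<forall>s. Re s > 1 \<longrightarrow> f s = (\<Sum>\<^sub>\<infinity>n\<in>{1..}. 1 / of_nat (n::nat) powr s)))"

text \<open>
  \<open>R_neg m n\<close> is the number $R(-m,-n)$; it is only meaningful for \<open>m + n\<close> odd.
  The subtraction in the argument of \<open>zeta\<close> takes place in the complex numbers.
\<close>

definition R_neg :: "nat \<Rightarrow> nat \<Rightarrow> complex" where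
  "R_neg m n = (- 1) ^ n * (fact m * fact n / fact (m + n + 1)) +
     (\<Sum>k | k \<in> {1..n} \<and> even k.
        of_nat (n choose k) * zeta (of_nat k - of_nat m - of_nat n))"

text \<open>
  Holomorphy in two variables is complex differentiability: the Frechet derivative
  exists at every point and is complex linear.
\<close>

definition holomorphic2_on ::
    "(complex \<times> complex \<Rightarrow> complex) \<Rightarrow> (complex \<times> complex) set \<Rightarrow> bool" where
  "holomorphic2_on f U \<longleftrightarrow>
     (\<forall>p\<in>U. \<exists>a b. (f has_derivative (\<lambda>(h1, h2). a * h1 + b * h2)) (at p))"

text \<open>
  A meromorphic function on $\mathbf{C}^2$ is locally a quotient of holomorphic functions with
  denominator not identically zero. Being a total function, it also takes values where the
  denominator vanishes; these are unconstrained.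
\<close>

definition meromorphic2 :: "(complex \<times> complex \<Rightarrow> complex) \<Rightarrow> bool" where
  "meromorphic2 f \<longleftrightarrow>
     (\<forall>p. \<exists>U g h. open U \<and> connected U \<and> p \<in> U \<and>
        holomorphic2_on g U \<and> holomorphic2_on h U \<and> (\<exists>q\<in>U. h q \<noteq> 0) \<and>
        (\<forall>q\<in>U. h q \<noteq> 0 \<longrightarrow> f q = g q / h q))"

definition Phi2_series :: "complex \<Rightarrow> complex \<Rightarrow> complex" where
  "Phi2_series s1 s2 =
     (\<Sum>\<^sub>\<infinity>m1\<in>{1..}. \<Sum>\<^sub>\<infinity>m2\<in>{1..}.
        mangoldt m2 / (of_nat (m1::nat) powr s1 * of_nat (m1 + m2) powr s2))"

text \<open>
  \<open>Phi\<close> is the meromorphic continuation $\Phi_2(\cdot,\cdot;1,\Lambda)$. It is unique up to its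
  values on a nowhere dense analytic set.
\<close>

definition is_Phi2 :: "(complex \<times> complex \<Rightarrow> complex) \<Rightarrow> bool" where
  "is_Phi2 Phi \<longleftrightarrow> meromorphic2 Phi \<and>
     (\<forall>s1 s2. Re s2 > 1 \<and> Re (s1 + s2) > 2 \<longrightarrow> Phi (s1, s2) = Phi2_series s1 s2)"

text \<open>
  The iterated limit, first in \<open>s1\<close> and then in \<open>s2\<close>. The inner limit \<open>G s2\<close> is required
  to exist only for \<open>s2 \<noteq> u2\<close> close to \<open>u2\<close>. Limits are finite.
\<close>

definition has_reverse_value ::
    "(complex \<times> complex \<Rightarrow> complex) \<Rightarrow> complex \<Rightarrow> complex \<Rightarrow> complex \<Rightarrow> bool" where
  "has_reverse_value Phi u1 u2 L \<longleftrightarrow>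
     (\<exists>G. (\<forall>\<^sub>F s2 in at u2. ((\<lambda>s1. Phi (s1, s2)) \<longlongrightarrow> G s2) (at u1)) \<and>
          (G \<longlongrightarrow> L) (at u2))"

definition reverse_value_convergent ::
    "(complex \<times> complex \<Rightarrow> complex) \<Rightarrow> complex \<Rightarrow> complex \<Rightarrow> bool" where
  "reverse_value_convergent Phi u1 u2 \<longleftrightarrow> (\<exists>L. has_reverse_value Phi u1 u2 L)"

end

theory Submission
  imports Defs
begin

text \<open>
  The whole question takes place on the line \<open>s1 = - 1\<close>. A meromorphic function of two variables
  has, along this line, either a finite limit for all \<open>s2\<close> outside a discrete set or an infinite
  one, and connectedness of the \<open>s2\<close>-plane together with absolute convergence for large \<open>Re s2\<close>
  excludes the latter. So the inner limit is a meromorphic function of \<open>s2\<close>, namely the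
  continuation of $\sum_m \Lambda(m) \sum_n n (n+m)^{-s}$.

  Euler--Maclaurin summation expands the inner sum in powers of \<open>m\<close>, which gives, with
  $M = -\zeta'/\zeta$,
  $$\frac{M(s-2)}{(s-1)(s-2)} - \sum_{j=2}^{J} (j-1) \frac{B_j}{j!} (s)_{j-2} M(s+j-2) + h(s)$$
  where \<open>h\<close> is holomorphic for $\Re s > 6 - J$. As the trivial zeros of $\zeta$ are simple, \<open>M\<close> has
  residue $-1$ at each of them, and the residue at $s = -2N$ is $-R(-1,-2N)$. That number is a sum
  of Bernoulli numbers which is evaluated by $n B_n(x) - x B_n'(x)$ at $x = 1$.
\<close>

section \<open>Bernoulli polynomials\<close>

text \<open>\<open>is_Phi2\<close> leaves the values of \<open>Phi\<close> free wherever a local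
  denominator vanishes, and this may happen on the whole line \<open>s1 = - 1\<close>; hence every
  step there speaks of limits along slices. The simplicity of the trivial zeros is drawn from the
  signs of the Bernoulli polynomials: for even \<open>J > 0\<close>, \<open>B_J(t) - B_J\<close>
  keeps one sign on \<open>(0, 1)\<close>, which makes the Euler-Maclaurin expression for the
  derivative of \<open>zeta\<close> at \<open>- 2 n\<close> visibly nonzero. The weight
  \<open>j - 1\<close> comes from writing \<open>n = (n + m) - m\<close>: the inner sum is a
  difference of two Hurwitz tails, and their expansions differ by
  \<open>(s - 1)_{j-1} - (s)_{j-1}\<close>. As Bernoulli numbers of odd index above 1 vanish, at
  \<open>s = - 2 N\<close> only the values of \<open>M\<close> at even integers matter. These avoid
  both the pole of \<open>zeta\<close> at 1 and the critical strip. The exception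
  \<open>N = 0\<close> has one source: the Bernoulli identity for \<open>n = 2 N + 2\<close> ends in
  \<open>B_{n-1}(1)\<close>, which is 0 for odd \<open>n - 1 \<ge> 3\<close> but \<open>1/2\<close>
  for \<open>n = 2\<close>.\<close>

declare sum.cong [fundef_cong]

text \<open>The normalisation is \<open>bern n = B_n / n!\<close> and \<open>bernp n x = B_n(x) / n!\<close>, so that differentiation
  lowers the index without a factor.\<close>

fun bern :: "nat \<Rightarrow> real" where
  "bern n = (if n = 0 then 1 else - (\<Sum>j<n. bern j / fact (n + 1 - j)))"

declare bern.simps [simp del]

definition bernp :: "nat \<Rightarrow> real \<Rightarrow> real" where
  "bernp n x = (\<Sum>j\<le>n. bern j * (x ^ (n - j) / fact (n - j)))"

lemma bern_0 [simp]: "bern 0 = 1"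
  by (simp add: bern.simps)

lemma bern_1 [simp]: "bern (Suc 0) = - 1 / 2"
  by (simp add: bern.simps [of "Suc 0"])

text \<open>The coefficient of \<open>t^(n+1)\<close> in
  \<open>t / (e^t - 1) * (e^t - 1) = t\<close>; the numbers \<open>bern j\<close> are the Taylor
  coefficients of the first factor.\<close>

lemma sum_bern_fact:
  assumes "n > 0"
  shows "(\<Sum>j\<le>n. bern j / fact (n + 1 - j)) = 0"
proof -
  have "(\<Sum>j\<le>n. bern j / fact (n + 1 - j)) = (\<Sum>j<n. bern j / fact (n + 1 - j)) + bern n"
    by (simp add: lessThan_Suc_atMost [symmetric])
  also have "bern n = - (\<Sum>j<n. bern j / fact (n + 1 - j))"
    using assms by (subst bern.simps) simp
  finally show ?thesis by simp
qed

lemma bernp_0 [simp]: "bernp 0 x = 1"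
  by (simp add: bernp_def)

lemma bernp_Suc_0: "bernp (Suc 0) x = x - 1 / 2"
  by (simp add: bernp_def)

lemma bernp_at_0: "bernp n 0 = bern n"
proof -
  have "bernp n 0 = (\<Sum>j\<le>n. if j = n then bern j else 0)"
    unfolding bernp_def by (intro sum.cong) auto
  then show ?thesis by simp
qed

lemma bernp_at_1:
  assumes "n \<ge> 2"
  shows "bernp n 1 = bern n"
proof -
  obtain k where k: "n = Suc k" "k > 0"
    using assms by (cases n) auto
  have "bernp n 1 = (\<Sum>j\<le>k. bern j / fact (k + 1 - j)) + bern n"
    by (simp add: bernp_def k)
  then show ?thesis using sum_bern_fact [OF k(2)] by simp
qed

lemma has_derivative_bernp:
  "(bernp (Suc n) has_real_derivative bernp n x) (at x within S)"
proof -
  have **: "((\<lambda>x. c * (x ^ Suc m / fact (Suc m))) has_real_derivative c * (x ^ m / fact m)) (at x within S)"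
    for m and c :: real
  proof -
    have "((\<lambda>x. c * (x ^ Suc m / fact (Suc m))) has_real_derivative
        c * (real (Suc m) * x ^ (Suc m - Suc 0) / fact (Suc m))) (at x within S)"
      by (intro DERIV_cmult DERIV_cdivide DERIV_pow)
    then show ?thesis by (simp del: of_nat_Suc)
  qed
  have *: "((\<lambda>x. bern j * (x ^ (Suc n - j) / fact (Suc n - j))) has_real_derivative
      bern j * (x ^ (n - j) / fact (n - j))) (at x within S)" if "j \<le> n" for j
    using ** [of "bern j" "n - j"] that by (simp add: Suc_diff_le)
  have "((\<lambda>x. (\<Sum>j\<le>n. bern j * (x ^ (Suc n - j) / fact (Suc n - j))) + bern (Suc n)) has_real_derivative
      (\<Sum>j\<le>n. bern j * (x ^ (n - j) / fact (n - j))) + 0) (at x within S)"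
    by (intro DERIV_add DERIV_sum * DERIV_const) auto
  then show ?thesis
    by (simp add: bernp_def [abs_def])
qed

lemma has_derivative_bernp' [derivative_intros]:
  assumes "(f has_real_derivative f') (at x within S)"
  shows "((\<lambda>x. bernp (Suc n) (f x)) has_real_derivative bernp n (f x) * f') (at x within S)"
  using DERIV_chain2 [OF has_derivative_bernp assms] .

lemma continuous_on_bernp: "continuous_on S (bernp n)"
  unfolding bernp_def [abs_def] by (intro continuous_intros) auto

text \<open>The induction hypothesis makes the difference of both sides a constant \<open>c\<close>,
  which the same level cannot determine. One level higher, an antiderivative of the difference minus
  \<open>c * x\<close> is constant. Comparing it at 0 and 1, where
  \<open>bernp (Suc (Suc n))\<close> takes equal values, gives \<open>c = 0\<close>.\<close>

lemma bernp_reflect: "bernp n (1 - x) = (- 1) ^ n * bernp n x"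
proof (induction n arbitrary: x)
  case (Suc n)
  define c where "c = bernp (Suc n) 1 - (- 1) ^ Suc n * bernp (Suc n) 0"
  have "((\<lambda>x. bernp (Suc n) (1 - x) - (- 1) ^ Suc n * bernp (Suc n) x) has_real_derivative 0) (at x)" for x
    by (rule derivative_eq_intros refl)+ (simp add: Suc.IH)
  then have c: "bernp (Suc n) (1 - x) - (- 1) ^ Suc n * bernp (Suc n) x = c" for x
    unfolding c_def using DERIV_isconst_all [of "\<lambda>x. bernp (Suc n) (1 - x) - (- 1) ^ Suc n * bernp (Suc n) x" x 0]
    by simp
  have "((\<lambda>x. - bernp (Suc (Suc n)) (1 - x) - (- 1) ^ Suc n * bernp (Suc (Suc n)) x - c * x) has_real_derivative 0) (at x)" for x
    by (rule derivative_eq_intros refl)+ (use c [of x] in \<open>simp add: algebra_simps\<close>)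
  from DERIV_isconst_all [OF allI [OF this], of 1 0]
  have "- bernp (Suc (Suc n)) 0 - (- 1) ^ Suc n * bernp (Suc (Suc n)) 1 - c
      = - bernp (Suc (Suc n)) 1 - (- 1) ^ Suc n * bernp (Suc (Suc n)) 0"
    by simp
  then have "c = 0" by (simp add: bernp_at_0 bernp_at_1)
  with c [of x] show ?case by simp
qed simp

lemma bern_odd:
  assumes "odd n" "n > 1"
  shows "bern n = 0"
  using bernp_reflect [of n 0] assms by (simp add: bernp_at_0 bernp_at_1)

lemma bernp_half:
  assumes "odd n"
  shows "bernp n (1 / 2) = 0"
  using bernp_reflect [of n "1/2"] assms by simp

text \<open>In the induction step the signed polynomial \<open>f\<close> vanishes at 0 and
  \<open>1/2\<close>, and the hypothesis makes its second derivative negative between them, so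
  \<open>f\<close> is strictly concave and positive. The points \<open>a\<close> and
  \<open>b\<close> are mean-value points to the left and right of \<open>x\<close>:
  \<open>f x \<le> 0\<close> would force \<open>f' a \<le> 0 \<le> f' b\<close>, against the
  decrease of \<open>f'\<close>.\<close>

lemma bernp_odd_sign:
  assumes "0 < x" "x < 1 / 2"
  shows "(- 1) ^ Suc n * bernp (2 * n + 1) x > 0"
  using assms
proof (induction n arbitrary: x)
  case 0
  then show ?case by (simp add: bernp_Suc_0)
next
  case (Suc n)
  define f where "f = (\<lambda>x. (- 1) ^ Suc (Suc n) * bernp (2 * Suc n + 1) x)"
  define f' where "f' = (\<lambda>x. (- 1) ^ Suc (Suc n) * bernp (2 * n + 2) x)"
  have f: "(f has_real_derivative f' x) (at x)" for x
    unfolding f_def f'_def using has_derivative_bernp [of "2*n+2" x UNIV]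
    by (intro DERIV_cmult) simp
  have f': "(f' has_real_derivative (- 1) ^ Suc (Suc n) * bernp (2 * n + 1) x) (at x)" for x
    unfolding f'_def using has_derivative_bernp [of "2*n+1" x UNIV]
    by (intro DERIV_cmult) simp
  have f0: "f 0 = 0" "f (1/2) = 0"
    by (simp_all add: f_def bernp_at_0 bern_odd bernp_half)
  obtain a where a: "0 < a" "a < x" "f x - f 0 = (x - 0) * f' a"
    using MVT2 [of 0 x f f'] f Suc.prems by auto
  obtain b where b: "x < b" "b < 1 / 2" "f (1/2) - f x = (1/2 - x) * f' b"
    using MVT2 [of x "1/2" f f'] f Suc.prems by auto
  have "f' b < f' a"
  proof (rule DERIV_neg_imp_decreasing [of a b f'])
    show "a < b" using a b by simp
  next
    fix y assume "a \<le> y" "y \<le> b"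
    then have "(- 1) ^ Suc n * bernp (2 * n + 1) y > 0"
      using a b by (intro Suc.IH) auto
    then show "\<exists>z. (f' has_real_derivative z) (at y) \<and> z < 0"
      using f' [of y] by auto
  qed
  have "f x > 0"
  proof (rule ccontr)
    assume "\<not> f x > 0"
    then have "x * f' a \<le> 0" "(1/2 - x) * f' b \<ge> 0"
      using a(3) b(3) f0 by simp_all
    then have "f' a \<le> 0" "f' b \<ge> 0"
      using Suc.prems by (auto simp: mult_le_0_iff zero_le_mult_iff)
    with \<open>f' b < f' a\<close> show False by simp
  qed
  then show ?case by (simp add: f_def)
qed

text \<open>On \<open>(0, 1/2]\<close> this is the mean value theorem from 0 with the sign of the
  derivative; reflection covers the other half.\<close>

lemma bernp_even_sign:
  assumes "0 < x" "x < 1"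
  shows "(- 1) ^ Suc n * (bernp (2 * n + 2) x - bern (2 * n + 2)) > 0"
proof -
  define f where "f = (\<lambda>x. (- 1) ^ Suc n * (bernp (2 * n + 2) x - bern (2 * n + 2)))"
  have f: "(f has_real_derivative (- 1) ^ Suc n * bernp (2 * n + 1) x) (at x)" for x
    unfolding f_def using has_derivative_bernp [of "2*n+1" x UNIV]
    by (auto intro!: derivative_eq_intros)
  have *: "f x > 0" if x: "0 < x" "x \<le> 1 / 2" for x
  proof -
    obtain z where z: "0 < z" "z < x" "f x - f 0 = (x - 0) * ((- 1) ^ Suc n * bernp (2 * n + 1) z)"
      using MVT2 [OF x(1) f] by blast
    have "f 0 = 0" by (simp add: f_def bernp_at_0)
    with z have "f x = x * ((- 1) ^ Suc n * bernp (2 * n + 1) z)" by simp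
    moreover have "(- 1) ^ Suc n * bernp (2 * n + 1) z > 0"
      using z x by (intro bernp_odd_sign) auto
    ultimately show ?thesis using x by (simp only: mult_pos_pos)
  qed
  show ?thesis
  proof (cases "x \<le> 1 / 2")
    case True
    then show ?thesis using * [of x] assms by (simp add: f_def)
  next
    case False
    then have "f (1 - x) > 0" using assms by (intro *) auto
    then show ?thesis using bernp_reflect [of "2*n+2" x] by (simp add: f_def)
  qed
qed

text \<open>Split \<open>j - 1 = (n - 1) - (n - j)\<close>. The first part sums to
  \<open>(n - 1) * bernp n 1\<close>, the second to the derivative \<open>bernp (n - 1) 1\<close>,
  which is 0 because \<open>n - 1\<close> is odd and exceeds 1. The omitted term
  \<open>j = n\<close> cancels the first part. For \<open>n = 2\<close> the derivative would be
  \<open>1/2\<close>.\<close>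

lemma sum_bern_weighted:
  assumes "even n" "n > 2"
  shows "(\<Sum>j<n. (real j - 1) * bern j / fact (n - j)) = 0"
proof -
  obtain k where k: "n = Suc k" using assms by (cases n) auto
  have "(\<Sum>j\<le>n. (real j - 1) * bern j / fact (n - j)) =
      (\<Sum>j\<le>n. (real n - 1) * (bern j / fact (n - j))) - (\<Sum>j\<le>n. bern j * (real (n - j) / fact (n - j)))"
    unfolding sum_subtractf [symmetric]
    by (intro sum.cong) (auto simp: of_nat_diff field_simps)
  also have "(\<Sum>j\<le>n. (real n - 1) * (bern j / fact (n - j))) = (real n - 1) * bernp n 1"
    by (simp add: bernp_def sum_distrib_left)
  also have "(\<Sum>j\<le>n. bern j * (real (n - j) / fact (n - j))) = bernp k 1"
  proof -
    have *: "real (Suc k - j) / fact (Suc k - j) = 1 / fact (k - j)" if "j \<le> k" for j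
    proof -
      have "Suc k - j = Suc (k - j)" using that by simp
      then show ?thesis by (simp del: of_nat_Suc)
    qed
    have "(\<Sum>j\<le>n. bern j * (real (n - j) / fact (n - j))) = (\<Sum>j\<le>k. bern j * (real (n - j) / fact (n - j)))"
      by (simp add: k)
    also have "\<dots> = bernp k 1"
      unfolding bernp_def k by (intro sum.cong) (simp_all only: * power_one atMost_iff)
    finally show ?thesis .
  qed
  also have "bernp k 1 = 0" using assms k bern_odd [of k] by (simp add: bernp_at_1)
  finally show ?thesis using assms
    by (simp add: bernp_at_1 lessThan_Suc_atMost [symmetric])
qed

section \<open>Euler--Maclaurin summation and the zeta function\<close>

lemma has_vector_derivative_shift_powr:
  assumes "a > 0" "t \<ge> 0"
  shows "((\<lambda>t. of_real (a + t) powr s :: complex) has_vector_derivative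
            s * of_real (a + t) powr (s - 1)) (at t within S)"
proof -
  have "((\<lambda>z. (of_real a + z) powr s) has_field_derivative
      s * (of_real a + of_real t :: complex) powr (s - 1)) (at (of_real t))"
    using assms
    by (auto intro!: derivative_eq_intros has_field_derivative_powr
          simp: complex_nonpos_Reals_iff)
  from has_vector_derivative_real_field [OF this] show ?thesis by simp
qed

lemma norm_of_real_powr:
  assumes "x \<ge> 0"
  shows "norm (of_real x powr s :: complex) = x powr Re s"
  using assms by (simp add: norm_powr_real_powr)

lemma norm_of_nat_powr: "norm (of_nat n powr s :: complex) = real n powr Re s"
  using norm_of_real_powr [of "real n" s] by simp

lemma has_vector_derivative_bernp:
  "((\<lambda>t. of_real (bernp (Suc n) t) :: complex) has_vector_derivative of_real (bernp n t)) (at t within S)"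
  using has_derivative_bernp [of n t S]
  by (intro has_vector_derivative_of_real)
     (simp add: has_real_derivative_iff_has_vector_derivative)

text \<open>The integral over \<open>[k, k + 1]\<close> of the periodic Bernoulli function of order
  \<open>J\<close>, divided by \<open>J!\<close>, against \<open>x powr (- s)\<close>, translated to
  \<open>[0, 1]\<close> so that the polynomial is the same for every \<open>k\<close>.\<close>

definition em_int :: "nat \<Rightarrow> complex \<Rightarrow> nat \<Rightarrow> complex" where
  "em_int J s k = integral {0..1} (\<lambda>t. of_real (bernp J t) * of_real (real k + t) powr (- s))"

lemma continuous_on_shift_powr:
  assumes "a > 0" "S \<subseteq> {0..}"
  shows "continuous_on S (\<lambda>t. of_real (a + t) powr s :: complex)"
  unfolding continuous_on_eq_continuous_within
  using assms by (blast intro: has_vector_derivative_continuous has_vector_derivative_shift_powr)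

lemma continuous_on_em_int:
  assumes "k > 0"
  shows "continuous_on {0..1}
    (\<lambda>t. of_real (bernp J t) * of_real (real k + t) powr s :: complex)"
  using assms
  by (intro continuous_intros continuous_on_bernp continuous_on_shift_powr) auto

lemma em_int_has_integral:
  assumes "k > 0"
  shows "((\<lambda>t. of_real (bernp J t) * of_real (real k + t) powr (- s)) has_integral em_int J s k) {0..1}"
  unfolding em_int_def
  by (intro integrable_integral integrable_continuous_real continuous_on_em_int assms)

text \<open>The end values \<open>bernp (Suc n) 1\<close> and \<open>bern (Suc n)\<close> are kept
  apart because they differ for \<open>n = 0\<close>, where they are \<open>1/2\<close> and
  \<open>- 1/2\<close>.\<close>

lemma em_int_by_parts:
  assumes k: "k > 0"
  shows "em_int n s k = of_real (bernp (Suc n) 1) * of_nat (Suc k) powr (- s)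
     - of_real (bern (Suc n)) * of_nat k powr (- s) + s * em_int (Suc n) (s + 1) k"
proof -
  define F where "F = (\<lambda>t. of_real (bernp (Suc n) t) * of_real (real k + t) powr (- s) :: complex)"
  have F: "(F has_vector_derivative
      (of_real (bernp (Suc n) t) * (- s * of_real (real k + t) powr (- s - 1))
        + of_real (bernp n t) * of_real (real k + t) powr (- s))) (at t within {0..1})"
    if "t \<in> {0..1}" for t
    unfolding F_def using that k
    by (intro has_vector_derivative_mult has_vector_derivative_bernp has_vector_derivative_shift_powr) auto
  have "((\<lambda>t. of_real (bernp (Suc n) t) * (- s * of_real (real k + t) powr (- s - 1))
        + of_real (bernp n t) * of_real (real k + t) powr (- s)) has_integral (F 1 - F 0)) {0..1}"
    by (rule fundamental_theorem_of_calculus) (use F in auto)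
  moreover have "((\<lambda>t. of_real (bernp (Suc n) t) * (- s * of_real (real k + t) powr (- s - 1))
        + of_real (bernp n t) * of_real (real k + t) powr (- s)) has_integral
        (- s * em_int (Suc n) (s + 1) k + em_int n s k)) {0..1}"
    using has_integral_add [OF has_integral_mult_right [OF em_int_has_integral [OF k, of "Suc n" "s + 1"], of "- s"]
        em_int_has_integral [OF k, of n s]]
    by (simp add: mult_ac)
  ultimately have "F 1 - F 0 = - s * em_int (Suc n) (s + 1) k + em_int n s k"
    by (rule has_integral_unique)
  moreover have "F 1 = of_real (bernp (Suc n) 1) * of_nat (Suc k) powr (- s)"
    by (simp add: F_def add.commute)
  moreover have "F 0 = of_real (bern (Suc n)) * of_nat k powr (- s)"
    by (simp add: F_def bernp_at_0)
  ultimately show ?thesis by (simp add: algebra_simps)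
qed

lemma em_int_0:
  assumes k: "k > 0" and "s \<noteq> 1"
  shows "em_int 0 s k = (of_nat k powr (1 - s) - of_nat (Suc k) powr (1 - s)) / (s - 1)"
proof -
  define F where "F = (\<lambda>t. 1 / (1 - s) * of_real (real k + t) powr (1 - s))"
  have "((\<lambda>t. of_real (real k + t) powr (- s)) has_integral (F 1 - F 0)) {0..1}"
  proof (rule fundamental_theorem_of_calculus)
    fix t :: real assume "t \<in> {0..1}"
    then have "(F has_vector_derivative
        1 / (1 - s) * ((1 - s) * of_real (real k + t) powr (1 - s - 1))) (at t within {0..1})"
      unfolding F_def using k
      by (intro has_vector_derivative_mult_right has_vector_derivative_shift_powr) auto
    then show "(F has_vector_derivative of_real (real k + t) powr (- s)) (at t within {0..1})"
      using assms(2) by simp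
  qed simp
  moreover have "((\<lambda>t. of_real (real k + t) powr (- s)) has_integral em_int 0 s k) {0..1}"
    using em_int_has_integral [OF k, of 0 s] by simp
  ultimately have "em_int 0 s k = F 1 - F 0"
    using has_integral_unique by blast
  moreover have "1 / (1 - s) = - (1 / (s - 1))"
    using minus_divide_right [of 1 "s - 1"] by simp
  ultimately show ?thesis by (simp add: F_def diff_divide_distrib add.commute)
qed

definition bern_bound :: "nat \<Rightarrow> real" where
  "bern_bound J = (\<Sum>j\<le>J. \<bar>bern j\<bar>)"

lemma bern_bound_nonneg: "bern_bound J \<ge> 0"
  by (simp add: bern_bound_def sum_nonneg)

lemma abs_bernp_le:
  assumes "t \<in> {0..1}"
  shows "\<bar>bernp J t\<bar> \<le> bern_bound J"
proof -
  have "\<bar>bernp J t\<bar> \<le> (\<Sum>j\<le>J. \<bar>bern j * (t ^ (J - j) / fact (J - j))\<bar>)"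
    unfolding bernp_def by (rule sum_abs)
  also have "\<dots> \<le> (\<Sum>j\<le>J. \<bar>bern j\<bar> * 1)"
  proof (rule sum_mono)
    fix j
    have "t ^ (J - j) \<le> 1" using assms by (auto intro: power_le_one)
    also have "1 \<le> (fact (J - j) :: real)" by (rule fact_ge_1)
    finally have "t ^ (J - j) / fact (J - j) \<le> 1" by simp
    moreover have "t ^ (J - j) / fact (J - j) \<ge> 0" using assms by simp
    ultimately show "\<bar>bern j * (t ^ (J - j) / fact (J - j))\<bar> \<le> \<bar>bern j\<bar> * 1"
      unfolding abs_mult by (intro mult_left_mono) (simp_all only: abs_of_nonneg abs_ge_zero)
  qed
  finally show ?thesis by (simp add: bern_bound_def)
qed

lemma norm_em_int_le:
  assumes "k > 0" "Re s \<ge> 0"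
  shows "norm (em_int J s k) \<le> bern_bound J * real k powr (- Re s)"
proof -
  have "norm (em_int J s k) \<le> bern_bound J * real k powr (- Re s) * (1 - 0)"
    unfolding em_int_def
  proof (rule integral_bound)
    fix t :: real assume t: "t \<in> {0..1}"
    have "norm (of_real (bernp J t) * of_real (real k + t) powr (- s) :: complex)
        = \<bar>bernp J t\<bar> * (real k + t) powr (- Re s)"
      using t norm_of_real_powr [of "real k + t" "- s"] by (simp add: norm_mult)
    also have "\<dots> \<le> bern_bound J * real k powr (- Re s)"
      using t assms by (intro mult_mono abs_bernp_le powr_mono2' bern_bound_nonneg) auto
    finally show "norm (of_real (bernp J t) * of_real (real k + t) powr (- s) :: complex)
        \<le> bern_bound J * real k powr (- Re s)" .
  qed (simp_all only: continuous_on_em_int assms zero_le_one)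
  then show ?thesis by simp
qed

lemma of_real_powr_eq_exp:
  assumes "x > 0"
  shows "of_real x powr s = exp (s * of_real (ln x) :: complex)"
  using assms by (simp add: powr_def Ln_of_real)

lemma holomorphic_em_int:
  assumes "k > 0"
  shows "(\<lambda>s. em_int J s k) holomorphic_on A"
proof -
  have "(\<lambda>s. integral (cbox 0 1) (\<lambda>t. of_real (bernp J t) * of_real (real k + t) powr (- s) :: complex)) holomorphic_on UNIV"
  proof (rule leibniz_rule_holomorphic)
    fix s :: complex and t :: real assume "t \<in> cbox 0 1"
    then have "real k + t > 0" using assms by auto
    then show "((\<lambda>s. of_real (bernp J t) * of_real (real k + t) powr (- s)) has_field_derivative
        (- of_real (bernp J t) * of_real (ln (real k + t)) * exp (- s * of_real (ln (real k + t))))) (at s within UNIV)"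
      by (auto simp: of_real_powr_eq_exp simp del: of_real_add intro!: derivative_eq_intros)
  next
    fix s :: complex
    show "(\<lambda>t. of_real (bernp J t) * of_real (real k + t) powr (- s) :: complex) integrable_on cbox 0 1"
      using continuous_on_em_int [OF assms, of J "- s"] integrable_continuous_real by auto
  next
    have "continuous_on (UNIV \<times> cbox 0 1) (\<lambda>x. bernp J (snd x))" for J
      using continuous_on_compose2 [OF continuous_on_bernp [of UNIV J] continuous_on_snd] 
      by (auto intro: continuous_intros)
    then have "continuous_on (UNIV \<times> cbox 0 1) (\<lambda>x. - of_real (bernp J (snd x)) * of_real (ln (real k + snd x)) *
         exp (- fst x * of_real (ln (real k + snd x)) :: complex))"
      using assms by (intro continuous_intros) (auto simp: add_nonneg_eq_0_iff)
    then show "continuous_on (UNIV \<times> cbox 0 1) (\<lambda>(s, t). - of_real (bernp J t) * of_real (ln (real k + t)) *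
         exp (- s * of_real (ln (real k + t)) :: complex))"
      by (simp add: case_prod_unfold)
  qed auto
  then show ?thesis
    unfolding em_int_def [abs_def] by (auto intro: holomorphic_on_subset)
qed

text \<open>The Euler-Maclaurin expansion of the tail sum of \<open>k powr (- s)\<close> over
  \<open>k \<ge> m\<close>. Taking \<open>bernp j 1\<close> in place of \<open>bern j\<close>
  matters only for \<open>j = 1\<close>: the coefficient \<open>+ 1/2\<close> reflects that the term
  \<open>k = m\<close> belongs to the tail.\<close>

definition em_poly :: "nat \<Rightarrow> complex \<Rightarrow> nat \<Rightarrow> complex" where
  "em_poly J s m = of_nat m powr (1 - s) / (s - 1) +
     (\<Sum>j=1..J. of_real (bernp j 1) * pochhammer s (j - 1) * of_nat m powr (1 - s - of_nat j))"

text \<open>Euler-Maclaurin on a single interval. The base case compares the exact value of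
  \<open>em_int 0\<close> with its integration by parts; each further integration by parts trades
  the integral for one more boundary term and an integral of higher order.\<close>

lemma em_step:
  assumes "k > 0" "s \<noteq> 1" "J \<ge> 1"
  shows "of_nat k powr (- s) =
    em_poly J s k - em_poly J s (Suc k) - pochhammer s J * em_int J (s + of_nat J) k"
  using assms(3)
proof (induction J rule: dec_induct)
  case base
  have *: "A = (X + 1 / 2 * A) - (Y + 1 / 2 * B) - C" if "X - Y = 1 / 2 * B + 1 / 2 * A + C" for A B C X Y :: complex
    using that by (simp add: field_simps)
  have "of_nat k powr (1 - s) / (s - 1) - of_nat (Suc k) powr (1 - s) / (s - 1) =
      1 / 2 * of_nat (Suc k) powr (- s) + 1 / 2 * of_nat k powr (- s) + s * em_int (Suc 0) (s + 1) k"
    using em_int_0 [OF assms(1,2)] em_int_by_parts [OF assms(1), of 0 s]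
    by (simp add: bernp_Suc_0 diff_divide_distrib)
  from * [OF this] show ?case
    by (simp add: em_poly_def bernp_Suc_0 add.commute)
next
  case (step J)
  have 1: "em_int J (s + of_nat J) k = of_real (bernp (Suc J) 1) * of_nat (Suc k) powr (- s - of_nat J)
     - of_real (bernp (Suc J) 1) * of_nat k powr (- s - of_nat J)
     + (s + of_nat J) * em_int (Suc J) (s + of_nat (Suc J)) k"
    using em_int_by_parts [OF assms(1), of J "s + of_nat J"] step(1)
    by (simp add: bernp_at_1 add_ac)
  have 2: "em_poly (Suc J) s m = em_poly J s m +
      of_real (bernp (Suc J) 1) * pochhammer s J * of_nat m powr (- s - of_nat J)" for m
    by (simp add: em_poly_def algebra_simps)
  show ?case
    unfolding step.IH 1 2 pochhammer_Suc by (simp add: algebra_simps)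
qed

text \<open>The Weierstrass theorem with local majorants. The second conclusion is what allows the
  Dirichlet series of \<open>zeta\<close> to be differentiated term by term.\<close>

lemma holomorphic_suminf:
  assumes S: "open S" and hol: "\<And>n. f n holomorphic_on S"
    and bd: "\<And>x. x \<in> S \<Longrightarrow> \<exists>d>0. \<exists>h. summable h \<and> (\<forall>n. \<forall>y\<in>ball x d \<inter> S. norm (f n y) \<le> h n)"
  shows "(\<lambda>z. \<Sum>n. f n z) holomorphic_on S"
    and "z \<in> S \<Longrightarrow> (\<lambda>n. deriv (f n) z) sums deriv (\<lambda>z. \<Sum>n. f n z) z"
proof -
  have "\<exists>g g'. \<forall>x\<in>S. ((\<lambda>n. f n x) sums g x) \<and> ((\<lambda>n. deriv (f n) x) sums g' x)
      \<and> (g has_field_derivative g' x) (at x)"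
  proof (rule series_and_derivative_comparison_complex [OF S])
    show "(f n has_field_derivative deriv (f n) x) (at x)" if "x \<in> S" for n x
      using holomorphic_derivI [OF hol S that] .
  next
    fix x assume x: "x \<in> S"
    then obtain d h where d: "d > 0" "summable h" "\<And>n y. y \<in> ball x d \<inter> S \<Longrightarrow> norm (f n y) \<le> h n"
      using bd by metis
    have h: "h n \<ge> 0" for n
      using order_trans [OF norm_ge_zero d(3) [of x n]] x d(1) by simp
    show "\<exists>d h. 0 < d \<and> summable h \<and> range h \<subseteq> \<real>\<^sub>\<ge>\<^sub>0 \<and>
        (\<forall>\<^sub>F n in sequentially. \<forall>y\<in>ball x d \<inter> S. cmod (f n y) \<le> cmod (h n))"
      using d h by (intro exI [of _ d] exI [of _ "\<lambda>n. of_real (h n)"])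
        (auto simp: summable_complex_of_real)
  qed
  then obtain g g' where g: "\<And>x. x \<in> S \<Longrightarrow> (\<lambda>n. f n x) sums g x"
    "\<And>x. x \<in> S \<Longrightarrow> (\<lambda>n. deriv (f n) x) sums g' x"
    "\<And>x. x \<in> S \<Longrightarrow> (g has_field_derivative g' x) (at x)"
    by blast
  have D: "((\<lambda>z. \<Sum>n. f n z) has_field_derivative g' x) (at x)" if "x \<in> S" for x
    by (rule has_field_derivative_transform_within_open [OF g(3) [OF that] S that]) (rule sums_unique [OF g(1)])
  then show "(\<lambda>z. \<Sum>n. f n z) holomorphic_on S"
    using S holomorphic_on_open by blast
  show "(\<lambda>n. deriv (f n) z) sums deriv (\<lambda>z. \<Sum>n. f n z) z" if "z \<in> S"
    using g(2) [OF that] DERIV_imp_deriv [OF D [OF that]] by simp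
qed

section \<open>The Euler-Maclaurin remainder as a series over unit intervals\<close>

lemma summable_shift_powr:
  assumes "a < - 1"
  shows "summable (\<lambda>i. real (i + m) powr a)"
  using summable_iff_shift [of "\<lambda>n. real n powr a" m] assms
  by (simp add: summable_real_powr_iff del: of_nat_add)

text \<open>The integral from \<open>m\<close> to infinity of the periodic Bernoulli function
  against \<open>x powr (- s)\<close>. The argument \<open>s\<close> is the full exponent, so the
  remainder belonging to the tail of \<open>k powr (- s)\<close> is
  \<open>em_rem J (s + of_nat J) m\<close>.\<close>

definition em_rem :: "nat \<Rightarrow> complex \<Rightarrow> nat \<Rightarrow> complex" where
  "em_rem J s m = (\<Sum>i. em_int J s (i + m))"

lemma summable_norm_em_int:
  assumes "Re s > 1" "m \<ge> 1"
  shows "summable (\<lambda>i. norm (em_int J s (i + m)))"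
proof (rule summable_comparison_test')
  show "summable (\<lambda>i. bern_bound J * real (i + m) powr (- Re s))"
    using assms by (intro summable_mult summable_shift_powr) auto
  show "norm (norm (em_int J s (i + m))) \<le> bern_bound J * real (i + m) powr (- Re s)" if "i \<ge> 0" for i
    using norm_em_int_le [of "i + m" s J] assms by simp
qed

lemma em_rem_sums:
  assumes "Re s > 1" "m \<ge> 1"
  shows "(\<lambda>i. em_int J s (i + m)) sums em_rem J s m"
  unfolding em_rem_def
  by (intro summable_sums summable_norm_cancel [OF summable_norm_em_int] assms)

definition em_const :: "nat \<Rightarrow> real" where
  "em_const J = bern_bound J * (\<Sum>i. real (i + 1) powr - 2)"

lemma em_const_nonneg: "em_const J \<ge> 0"
  unfolding em_const_def
  by (intro mult_nonneg_nonneg bern_bound_nonneg suminf_nonneg summable_shift_powr) auto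

text \<open>Two units of the exponent are spent on convergence, through
  \<open>(i + m) powr - 2 \<le> (i + 1) powr - 2\<close>; the remaining
  \<open>2 - Re s \<le> 0\<close> is estimated at \<open>i = 0\<close>. The constant thereby depends
  on neither \<open>s\<close> nor \<open>m\<close>.\<close>

lemma norm_em_rem_le:
  assumes "Re s \<ge> 2" "m \<ge> 1"
  shows "norm (em_rem J s m) \<le> em_const J * real m powr (2 - Re s)"
proof -
  have "norm (em_rem J s m) \<le> (\<Sum>i. bern_bound J * real m powr (2 - Re s) * real (i + 1) powr - 2)"
    unfolding em_rem_def
  proof (rule norm_suminf_le)
    fix i
    have "norm (em_int J s (i + m)) \<le> bern_bound J * real (i + m) powr (- Re s)"
      using norm_em_int_le [of "i + m" s J] assms by simp
    also have "real (i + m) powr (- Re s) = real (i + m) powr (2 - Re s) * real (i + m) powr - 2"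
      by (simp flip: powr_add)
    also have "\<dots> \<le> real m powr (2 - Re s) * real (i + 1) powr - 2"
      using assms by (intro mult_mono powr_mono2') auto
    finally show "norm (em_int J s (i + m)) \<le> bern_bound J * real m powr (2 - Re s) * real (i + 1) powr - 2"
      using bern_bound_nonneg [of J] by (simp add: mult_left_mono mult.assoc)
  qed (intro summable_mult summable_shift_powr, auto)
  also have "\<dots> = em_const J * real m powr (2 - Re s)"
    using suminf_mult [OF summable_shift_powr [of "- 2" 1], of "bern_bound J * real m powr (2 - Re s)"]
    by (simp add: em_const_def mult_ac)
  finally show ?thesis .
qed

lemma Re_ge_in_ball:
  assumes "y \<in> ball x d"
  shows "Re y \<ge> Re x - d"
  using assms abs_Re_le_cmod [of "x - y"] by (simp add: dist_norm)

lemma open_Re_gt: "open {s. Re s > c}"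
  using open_halfspace_Re_gt [of c] by simp

lemma holomorphic_em_rem:
  assumes "m \<ge> 1"
  shows "(\<lambda>s. em_rem J s m) holomorphic_on {s. Re s > 1}"
  unfolding em_rem_def
proof (rule holomorphic_suminf(1))
  fix x assume "x \<in> {s. Re s > 1}"
  then have x: "Re x > 1" by simp
  define d where "d = (Re x - 1) / 2"
  have "summable (\<lambda>i. bern_bound J * real (i + m) powr (- (1 + d)))"
    using x by (intro summable_mult summable_shift_powr) (auto simp: d_def)
  moreover have "norm (em_int J y (i + m)) \<le> bern_bound J * real (i + m) powr (- (1 + d))"
    if "y \<in> ball x d \<inter> {s. Re s > 1}" for y i
  proof -
    have y: "Re y \<ge> 1 + d"
      using Re_ge_in_ball [of y x d] that by (simp add: d_def field_simps)
    have "norm (em_int J y (i + m)) \<le> bern_bound J * real (i + m) powr (- Re y)"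
      using norm_em_int_le [of "i + m" y J] assms that by simp
    also have "\<dots> \<le> bern_bound J * real (i + m) powr (- (1 + d))"
      using y assms by (intro mult_left_mono powr_mono bern_bound_nonneg) auto
    finally show ?thesis .
  qed
  ultimately show "\<exists>d>0. \<exists>h. summable h \<and>
      (\<forall>n. \<forall>y\<in>ball x d \<inter> {s. Re s > 1}. norm (em_int J y (n + m)) \<le> h n)"
    using x by (intro exI [of _ d] conjI exI [of _ "\<lambda>i. bern_bound J * real (i + m) powr (- (1 + d))"])
      (auto simp: d_def)
qed (use assms in \<open>auto intro: holomorphic_em_int open_Re_gt\<close>)

lemma em_poly_tendsto_0:
  assumes "Re s > 1"
  shows "(\<lambda>k. em_poly J s (k + m)) \<longlonglongrightarrow> 0"
proof -
  have lim: "filterlim (\<lambda>k. k + m) at_top sequentially"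
    by (rule filterlim_add_const_nat_at_top)
  have *: "(\<lambda>k. of_nat (k + m) powr w :: complex) \<longlonglongrightarrow> 0" if "Re w < 0" for w
    using tendsto_neg_powr_complex_of_nat [OF lim that] .
  have "(\<lambda>k. em_poly J s (k + m)) \<longlonglongrightarrow> 0 / (s - 1) +
      (\<Sum>j=1..J. of_real (bernp j 1) * pochhammer s (j - 1) * 0)"
    unfolding em_poly_def using assms
    by (intro tendsto_add tendsto_sum tendsto_mult tendsto_divide tendsto_const *) auto
  then show ?thesis by simp
qed

lemma sums_em_poly_diff:
  assumes "Re s > 1"
  shows "(\<lambda>i. em_poly J s (i + m) - em_poly J s (Suc (i + m))) sums em_poly J s m"
  using telescope_sums' [OF em_poly_tendsto_0 [OF assms], of J m] by simp

lemma hurwitz_sums: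
  assumes "Re s > 1" "m \<ge> 1" "J \<ge> 1"
  shows "(\<lambda>i. of_nat (i + m) powr (- s)) sums
    (em_poly J s m - pochhammer s J * em_rem J (s + of_nat J) m)"
proof -
  have "of_nat (i + m) powr (- s) = em_poly J s (i + m) - em_poly J s (Suc (i + m))
      - pochhammer s J * em_int J (s + of_nat J) (i + m)" for i
    using assms by (intro em_step) auto
  moreover have "(\<lambda>i. em_poly J s (i + m) - em_poly J s (Suc (i + m))
      - pochhammer s J * em_int J (s + of_nat J) (i + m)) sums
    (em_poly J s m - pochhammer s J * em_rem J (s + of_nat J) m)"
    using assms by (intro sums_diff sums_mult em_rem_sums sums_em_poly_diff) auto
  ultimately show ?thesis by presburger
qed

text \<open>Integration by parts summed over all intervals, with telescoping boundary terms. Applied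
  at \<open>s + of_nat J\<close>, it compares the expansions of orders \<open>J\<close> and
  \<open>J + 1\<close> directly, also where the series of \<open>zeta\<close> diverges.\<close>

lemma em_rem_Suc:
  assumes "Re s > 1" "m \<ge> 1" "J \<ge> 1"
  shows "em_rem J s m = - of_real (bernp (Suc J) 1) * of_nat m powr (- s) + s * em_rem (Suc J) (s + 1) m"
proof -
  have 1: "em_int J s (i + m) = - of_real (bernp (Suc J) 1) *
      (of_nat (i + m) powr (- s) - of_nat (Suc i + m) powr (- s)) + s * em_int (Suc J) (s + 1) (i + m)" for i
    using em_int_by_parts [of "i + m" J s] assms(2,3) by (simp add: bernp_at_1 algebra_simps)
  have "(\<lambda>i. of_nat (i + m) powr (- s) :: complex) \<longlonglongrightarrow> 0"
    using tendsto_neg_powr_complex_of_nat [OF filterlim_add_const_nat_at_top, of "- s" m] assms(1) by simp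
  from telescope_sums' [OF this]
  have "(\<lambda>i. of_nat (i + m) powr (- s) - of_nat (Suc i + m) powr (- s)) sums (of_nat m powr (- s) :: complex)"
    by simp
  then have "(\<lambda>i. em_int J s (i + m)) sums
     (- of_real (bernp (Suc J) 1) * of_nat m powr (- s) + s * em_rem (Suc J) (s + 1) m)"
    unfolding 1 using assms by (intro sums_add sums_mult em_rem_sums) auto
  then show ?thesis
    using em_rem_sums [OF assms(1,2)] sums_unique2 by blast
qed

section \<open>Analytic continuation of the zeta function\<close>

definition zeta_em :: "nat \<Rightarrow> complex \<Rightarrow> complex" where
  "zeta_em J s = em_poly J s 1 - pochhammer s J * em_rem J (s + of_nat J) 1"

lemma zeta_em_Suc:
  assumes "Re s + real J > 1" "J \<ge> 1"
  shows "zeta_em (Suc J) s = zeta_em J s"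
proof -
  have 1: "em_rem J (s + of_nat J) 1 =
      - of_real (bernp (Suc J) 1) + (s + of_nat J) * em_rem (Suc J) (s + of_nat (Suc J)) 1"
    using em_rem_Suc [of "s + of_nat J" 1 J] assms by (simp add: add_ac)
  have 2: "em_poly (Suc J) s 1 = em_poly J s 1 + of_real (bernp (Suc J) 1) * pochhammer s J"
    by (simp add: em_poly_def)
  show ?thesis
    unfolding zeta_em_def 1 2 pochhammer_Suc by (simp add: algebra_simps)
qed

lemma zeta_em_eq:
  assumes "Re s + real J > 1" "J \<ge> 1" "Re s + real K > 1" "K \<ge> 1"
  shows "zeta_em J s = zeta_em K s"
proof -
  have *: "zeta_em K s = zeta_em J s" if "J \<le> K" "Re s + real J > 1" "J \<ge> 1" for J K
    using that(1)
  proof (induction K rule: dec_induct)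
    case (step n)
    then show ?case using that zeta_em_Suc [of s n] by simp
  qed simp
  show ?thesis
    using * [of J K] * [of K J] assms by (cases "J \<le> K") auto
qed

lemma holomorphic_zeta_em:
  assumes "J \<ge> 1"
  shows "zeta_em J holomorphic_on {s. Re s > 1 - real J} - {1}"
proof -
  have "((\<lambda>s. em_rem J s 1) \<circ> (\<lambda>s. s + of_nat J)) holomorphic_on {s. Re s > 1 - real J} - {1}"
    by (rule holomorphic_on_compose_gen [OF _ holomorphic_em_rem]) (auto intro!: holomorphic_intros)
  then have "(\<lambda>s. em_rem J (s + of_nat J) 1) holomorphic_on {s. Re s > 1 - real J} - {1}"
    by (simp add: o_def)
  moreover have "(\<lambda>s. em_poly J s 1) holomorphic_on {s. Re s > 1 - real J} - {1}"
    unfolding em_poly_def by (auto intro!: holomorphic_intros simp: pochhammer_prod)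
  moreover have "(\<lambda>s. pochhammer s J) holomorphic_on {s. Re s > 1 - real J} - {1}"
    by (auto intro!: holomorphic_intros simp: pochhammer_prod)
  ultimately show ?thesis
    unfolding zeta_em_def [abs_def] by (intro holomorphic_intros) auto
qed

lemma zeta_em_series:
  assumes "Re s > 1" "J \<ge> 1"
  shows "(\<lambda>i. of_nat (Suc i) powr (- s)) sums zeta_em J s"
  using hurwitz_sums [of s 1 J] assms by (simp add: zeta_em_def)

lemma zeta_infsum:
  assumes "Re s > 1" "(\<lambda>i. of_nat (Suc i) powr (- s)) sums L"
  shows "(\<Sum>\<^sub>\<infinity>n\<in>{1..}. 1 / of_nat (n::nat) powr s) = L"
proof -
  have "summable (\<lambda>i. real (i + 1) powr (- Re s))"
    using assms by (intro summable_shift_powr) auto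
  then have "summable (\<lambda>i. norm (of_nat (Suc i) powr (- s) :: complex))"
    by (simp add: norm_of_nat_powr del: of_nat_Suc)
  then have "((\<lambda>i. of_nat (Suc i) powr (- s)) has_sum L) UNIV"
    using assms by (intro norm_summable_imp_has_sum)
  moreover have "bij_betw Suc UNIV {1..}"
    by (rule bij_betwI [of _ _ _ "\<lambda>n. n - 1"]) auto
  ultimately have "((\<lambda>n. of_nat n powr (- s)) has_sum L) {1..}"
    by (subst (asm) has_sum_reindex_bij_betw)
  then show ?thesis
    by (simp add: powr_minus_divide infsumI)
qed

text \<open>The description by \<open>THE\<close> asks for existence and uniqueness. Existence glues
  the functions \<open>zeta_em J\<close>, which agree on their common half-planes; uniqueness is the
  identity theorem on the punctured plane, with the value at 1 prescribed.\<close>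

lemma zeta_continuation:
  shows holomorphic_zeta: "zeta holomorphic_on - {1}"
    and zeta_eq: "J \<ge> 1 \<Longrightarrow> Re s > 1 - real J \<Longrightarrow> s \<noteq> 1 \<Longrightarrow> zeta s = zeta_em J s"
proof -
  \<comment> \<open>Any order with \<open>1 - real (N s) < Re s\<close> would serve; the half-plane
    of \<open>zeta_em (N s)\<close> then contains a neighbourhood of \<open>s\<close>.\<close>
  define N where "N = (\<lambda>s. nat \<lceil>\<bar>Re s\<bar>\<rceil> + 2)"
  define Z where "Z = (\<lambda>s. if s = 1 then 0 else zeta_em (N s) s)"
  have N: "real (N s) > 1 - Re s" "N s \<ge> 1" for s
    unfolding N_def by linarith+
  have Z_eq: "Z s = zeta_em J s" if "J \<ge> 1" "Re s > 1 - real J" "s \<noteq> 1" for s J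
    using that zeta_em_eq [of s "N s" J] N [of s] by (simp add: Z_def)
  have Z_hol: "Z holomorphic_on - {1}"
  proof (subst holomorphic_on_open)
    show "\<forall>s\<in>- {1}. \<exists>D. (Z has_field_derivative D) (at s)"
    proof
      fix s :: complex assume s: "s \<in> - {1}"
      let ?S = "{w. Re w > 1 - real (N s)} - {1}"
      have op: "open ?S" by (intro open_Diff open_Re_gt) auto
      have mem: "s \<in> ?S" using s N [of s] by auto
      have eq: "zeta_em (N s) x = Z x" if "x \<in> ?S" for x
        using Z_eq [of "N s" x] N(2) [of s] that by simp
      have "(zeta_em (N s) has_field_derivative deriv (zeta_em (N s)) s) (at s)"
        using holomorphic_derivI [OF holomorphic_zeta_em op mem] N by blast
      then have "(Z has_field_derivative deriv (zeta_em (N s)) s) (at s)"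
        by (rule has_field_derivative_transform_within_open [OF _ op mem])
           (rule eq)
      then show "\<exists>D. (Z has_field_derivative D) (at s)" by blast
    qed
  qed auto
  have Z_series: "Z s = (\<Sum>\<^sub>\<infinity>n\<in>{1..}. 1 / of_nat (n::nat) powr s)" if "Re s > 1" for s
  proof -
    have "s \<noteq> 1" using that by auto
    then show ?thesis
      using that zeta_infsum [OF that zeta_em_series [OF that, of 1]] Z_eq [of 1 s] by simp
  qed
  have "zeta = Z"
    unfolding zeta_def
  proof (rule the_equality)
    show "Z holomorphic_on - {1} \<and> Z 1 = 0 \<and>
       (\<forall>s. 1 < Re s \<longrightarrow> Z s = (\<Sum>\<^sub>\<infinity>n\<in>{1..}. 1 / of_nat (n::nat) powr s))"
      using Z_hol Z_series by (auto simp: Z_def)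
  next
    fix f :: "complex \<Rightarrow> complex"
    assume f: "f holomorphic_on - {1} \<and> f 1 = 0 \<and>
       (\<forall>s. 1 < Re s \<longrightarrow> f s = (\<Sum>\<^sub>\<infinity>n\<in>{1..}. 1 / of_nat (n::nat) powr s))"
    have "f w - Z w = 0" if "w \<noteq> 1" for w
    proof (rule analytic_continuation [of "\<lambda>w. f w - Z w" "- {1}" "{s. Re s > 1}" 2])
      show "(\<lambda>w. f w - Z w) holomorphic_on - {1}"
        using f Z_hol by (intro holomorphic_intros) auto
      show "connected (- {1 :: complex})"
        by (rule connected_punctured_universe) simp
      show "2 islimpt {s. Re s > 1}"
        by (rule interior_limit_point) (simp add: interior_open [OF open_Re_gt])
      show "f z - Z z = 0" if "z \<in> {s. Re s > 1}" for z
        using f Z_series that by auto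
    qed (use that in auto)
    then show "f = Z"
      using f by (intro ext) (auto simp: Z_def)
  qed
  then show "zeta holomorphic_on - {1}"
    and "J \<ge> 1 \<Longrightarrow> Re s > 1 - real J \<Longrightarrow> s \<noteq> 1 \<Longrightarrow> zeta s = zeta_em J s"
    using Z_eq [of J s] Z_hol by simp_all
qed

lemma zeta_sums:
  assumes "Re s > 1"
  shows "(\<lambda>i. of_nat (Suc i) powr (- s)) sums zeta s"
proof -
  have "s \<noteq> 1" using assms by auto
  then show ?thesis
    using zeta_em_series [OF assms, of 1] zeta_eq [of 1 s] assms by simp
qed

section \<open>The zeta function at the nonpositive integers\<close>

lemma pochhammer_neg_nat:
  assumes "k \<le> n"
  shows "pochhammer (- of_nat n :: 'a :: field_char_0) k = (- 1) ^ k * (fact n / fact (n - k))"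
  using assms
proof (induction k)
  case (Suc k)
  have "fact (n - k) = (of_nat n - of_nat k) * (fact (n - Suc k) :: 'a)"
    using Suc.prems fact_diff_Suc [of k "n - 1"]
    by (simp add: of_nat_diff fact_reduce [of "n - k"])
  moreover have "of_nat n - of_nat k \<noteq> (0 :: 'a)"
    using Suc.prems by simp
  ultimately show ?case
    using Suc by (simp add: pochhammer_Suc divide_simps) (simp add: algebra_simps)
qed simp

lemma em_poly_at_1:
  "em_poly J s 1 = 1 / (s - 1) + (\<Sum>j=1..J. of_real (bernp j 1) * pochhammer s (j - 1))"
  by (simp add: em_poly_def)

text \<open>For \<open>j = 1\<close> the two values are \<open>1/2\<close> and \<open>- 1/2\<close>;
  for even \<open>j\<close> the sign comes from the power; for odd \<open>j > 1\<close> both sides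
  vanish.\<close>

lemma bernp_1_minus_one_power:
  assumes "j \<ge> 1"
  shows "bernp j 1 * (- 1) ^ (j - 1) = - bern j"
proof (cases "j = 1")
  case True
  then show ?thesis by (simp add: bernp_Suc_0)
next
  case False
  then have "bernp j 1 = bern j" using assms by (intro bernp_at_1) auto
  then show ?thesis using assms bern_odd [of j] False by (cases "even j") auto
qed

text \<open>At \<open>s = - n\<close> the factor \<open>pochhammer s J\<close> vanishes for
  \<open>J > n\<close>, so the remainder disappears and Euler-Maclaurin is exact. The fraction
  \<open>1 / (s - 1)\<close> supplies the term \<open>j = 0\<close> that completes the sum to
  \<open>bernp (Suc n) 1\<close>.\<close>

lemma zeta_neg_nat: "zeta (- of_nat n) = - fact n * of_real (bernp (Suc n) 1)"
proof -
  have "- of_nat n \<noteq> (1 :: complex)"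
    by (metis of_nat_0_le_iff neg_le_0_iff_le not_one_le_zero of_nat_eq_iff of_real_1 of_real_eq_iff
        of_real_minus of_real_of_nat_eq)
  then have "zeta (- of_nat n) = zeta_em (n + 2) (- of_nat n)"
    by (intro zeta_eq) auto
  also have "\<dots> = 1 / (- of_nat n - 1) +
      (\<Sum>j=1..n+2. of_real (bernp j 1) * pochhammer (- of_nat n) (j - 1))"
    unfolding zeta_em_def em_poly_at_1 by (simp add: pochhammer_of_nat_eq_0_lemma)
  also have "(\<Sum>j=1..n+2. of_real (bernp j 1) * pochhammer (- of_nat n) (j - 1))
      = (\<Sum>j=1..Suc n. of_real (bernp j 1) * pochhammer (- of_nat n :: complex) (j - 1))"
    by (simp add: pochhammer_of_nat_eq_0_lemma)
  also have "\<dots> = (\<Sum>j=1..Suc n. - fact n * of_real (bern j * (1 / fact (Suc n - j))))"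
  proof (rule sum.cong)
    fix j assume j: "j \<in> {1..Suc n}"
    then have "pochhammer (- of_nat n :: complex) (j - 1) = (- 1) ^ (j - 1) * (fact n / fact (Suc n - j))"
      using pochhammer_neg_nat [of "j - 1" n, where 'a = complex] by (auto simp: Suc_diff_le)
    then have "of_real (bernp j 1) * pochhammer (- of_nat n :: complex) (j - 1) =
        of_real (bernp j 1 * (- 1) ^ (j - 1)) * (fact n / fact (Suc n - j))"
      by simp
    also have "bernp j 1 * (- 1) ^ (j - 1) = - bern j"
      using j by (intro bernp_1_minus_one_power) auto
    finally show "of_real (bernp j 1) * pochhammer (- of_nat n :: complex) (j - 1) =
        - fact n * of_real (bern j * (1 / fact (Suc n - j)))"
      by simp
  qed simp
  also have "1 / (- of_nat n - 1 :: complex) = - fact n * of_real (bern 0 * (1 / fact (Suc n)) :: real)"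
  proof -
    have "1 / (- of_nat n - 1) = (- (1 / of_nat (Suc n)) :: complex)"
      using minus_divide_right [of 1 "of_nat (Suc n) :: complex"] by (simp add: add.commute)
    then show ?thesis by (simp del: of_nat_Suc)
  qed
  also have "- fact n * of_real (bern 0 * (1 / fact (Suc n)) :: real) +
      (\<Sum>j=1..Suc n. - fact n * of_real (bern j * (1 / fact (Suc n - j)))) =
      (\<Sum>j\<le>Suc n. - fact n * complex_of_real (bern j * (1 / fact (Suc n - j))))"
    by (simp add: atMost_atLeast0 sum.atLeast_Suc_atMost del: sum.cl_ivl_Suc fact_Suc)
  also have "\<dots> = - fact n * of_real (bernp (Suc n) 1)"
    by (simp only: bernp_def power_one of_real_sum sum_distrib_left)
  finally show ?thesis .
qed

lemma zeta_0: "zeta 0 = - 1 / 2"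
  using zeta_neg_nat [of 0] by (simp add: bernp_Suc_0)

lemma zeta_neg_odd:
  assumes "i \<ge> 1"
  shows "zeta (1 - 2 * of_nat i) = - fact (2 * i - 1) * of_real (bern (2 * i))"
proof -
  have "zeta (- of_nat (2 * i - 1)) = - fact (2 * i - 1) * of_real (bernp (Suc (2 * i - 1)) 1)"
    by (rule zeta_neg_nat)
  moreover have "Suc (2 * i - 1) = 2 * i" using assms by simp
  ultimately show ?thesis
    using assms by (simp add: bernp_at_1 of_nat_diff)
qed

lemma zeta_neg_even:
  assumes "n \<ge> 1"
  shows "zeta (- 2 * of_nat n) = 0"
  using zeta_neg_nat [of "2 * n"] assms by (simp add: bernp_at_1 bern_odd)

text \<open>Formally \<open>em_frac J s\<close> is $\int_0^1 b_J(t) t^{-s-J}\,dt$ with \<open>b_J = bernp J\<close>, the missing first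
  interval of \<open>em_rem J (s + J) 1\<close>; so \<open>\<zeta>(s) = - (s)_J (em_frac J s + em_rem J (s + J) 1)\<close>.\<close>

definition em_frac :: "nat \<Rightarrow> complex \<Rightarrow> complex" where
  "em_frac J s = (\<Sum>j\<le>J. of_real (bern j) / (fact (J - j) * (1 - of_nat j - s)))"

text \<open>The counterpart on \<open>[0, 1]\<close> of integration by parts. Term by term it is the
  splitting \<open>s + J = (J + 1 - j) - (1 - j - s)\<close>: the first part cancels into the lower
  factorial, the second cancels the denominator and sums to \<open>bernp (Suc J) 1\<close>.\<close>

lemma em_frac_Suc:
  assumes "\<And>j. j \<le> Suc J \<Longrightarrow> 1 - of_nat j - s \<noteq> 0"
  shows "(s + of_nat J) * em_frac (Suc J) s = em_frac J s - of_real (bernp (Suc J) 1)"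
proof -
  have "(s + of_nat J) * em_frac (Suc J) s =
      (\<Sum>j\<le>Suc J. of_real (bern j) * of_nat (Suc J - j) / (fact (Suc J - j) * (1 - of_nat j - s))
        - of_real (bern j) / fact (Suc J - j))"
    unfolding em_frac_def sum_distrib_left
  proof (rule sum.cong)
    fix j assume "j \<in> {..Suc J}"
    then have j: "j \<le> Suc J" by simp
    have eq: "s + of_nat J = of_nat (Suc J - j) - (1 - of_nat j - s)"
      using j by (simp add: of_nat_diff)
    show "(s + of_nat J) * (of_real (bern j) / (fact (Suc J - j) * (1 - of_nat j - s))) =
        of_real (bern j) * of_nat (Suc J - j) / (fact (Suc J - j) * (1 - of_nat j - s))
        - of_real (bern j) / fact (Suc J - j)"
      unfolding eq using assms [OF j] by (simp add: divide_simps del: fact_Suc) (simp add: algebra_simps)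
  qed simp
  also have "\<dots> = (\<Sum>j\<le>Suc J. of_real (bern j) * of_nat (Suc J - j) / (fact (Suc J - j) * (1 - of_nat j - s)))
      - of_real (bernp (Suc J) 1)"
    unfolding bernp_def sum_subtractf of_real_sum by simp
  also have "(\<Sum>j\<le>Suc J. of_real (bern j) * of_nat (Suc J - j) / (fact (Suc J - j) * (1 - of_nat j - s)))
      = em_frac J s"
  proof -
    have "of_real (bern j) * of_nat (Suc J - j) / (fact (Suc J - j) * (1 - of_nat j - s))
        = of_real (bern j) / (fact (J - j) * (1 - of_nat j - s))" if "j \<le> J" for j
    proof -
      have *: "x * n / (n * f * y) = x / (f * y)" if "n \<noteq> 0" for x n f y :: complex
        using that by simp
      have "fact (Suc J - j) = of_nat (Suc (J - j)) * (fact (J - j) :: complex)"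
        using that by (simp add: Suc_diff_le)
      then show ?thesis
        using that * [of "of_nat (Suc (J - j))"] by (simp only: Suc_diff_le) (simp del: of_nat_Suc)
    qed
    then show ?thesis by (simp add: em_frac_def)
  qed
  finally show ?thesis .
qed

lemma em_poly_1_eq_em_frac:
  assumes "\<And>j. j \<le> J \<Longrightarrow> 1 - of_nat j - s \<noteq> 0"
  shows "em_poly J s 1 = - pochhammer s J * em_frac J s"
  using assms
proof (induction J)
  case 0
  have "1 / (1 - s) = - (1 / (s - 1))"
    using minus_divide_right [of 1 "s - 1"] by simp
  then show ?case unfolding em_poly_at_1 by (simp add: em_frac_def)
next
  case (Suc J)
  have "em_poly (Suc J) s 1 = em_poly J s 1 + of_real (bernp (Suc J) 1) * pochhammer s J"
    unfolding em_poly_at_1 by simp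
  also have "em_poly J s 1 = - pochhammer s J * em_frac J s"
    using Suc by auto
  also have "em_frac J s = (s + of_nat J) * em_frac (Suc J) s + of_real (bernp (Suc J) 1)"
    using em_frac_Suc [of J s] Suc.prems by simp
  finally show ?case by (simp add: pochhammer_Suc algebra_simps)
qed

text \<open>The integral of \<open>x powr (- 2)\<close> from 1 to infinity. It lets a multiple of
  \<open>em_rem 0\<close> turn the Bernoulli polynomial into its difference from the value at
  0.\<close>

lemma em_rem_0_2: "em_rem 0 2 1 = 1"
proof -
  have 1: "em_int 0 2 (i + 1) = of_nat (i + 1) powr (- 1) - of_nat (Suc i + 1) powr (- 1)" for i
    using em_int_0 [of "i + 1" 2] by simp
  have "(\<lambda>i. of_nat (i + 1) powr (- 1) :: complex) \<longlonglongrightarrow> 0"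
    using tendsto_neg_powr_complex_of_nat [OF filterlim_add_const_nat_at_top, of "- 1" 1] by simp
  from telescope_sums' [OF this]
  have "(\<lambda>i. em_int 0 2 (i + 1)) sums 1"
    unfolding 1 by simp
  then show ?thesis unfolding em_rem_def by (rule sums_unique [symmetric])
qed

text \<open>By \<open>em_rem_0_2\<close> the bracket is the integral from 1 to infinity of the
  periodic \<open>b_J - b_J(0)\<close> against \<open>x powr (- 2)\<close>, for
  \<open>J = 2 n + 2\<close>; the integrand has the sign given by \<open>bernp_even_sign\<close> and
  vanishes at the integers. A weak inequality suffices here, as strictness comes from the first
  interval in \<open>em_frac_sign\<close>.\<close>

lemma em_rem_sign:
  "(- 1) ^ Suc n * (Re (em_rem (2 * n + 2) 2 1) - bern (2 * n + 2)) \<ge> 0"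
proof -
  define b where "b = bern (2 * n + 2)"
  have pos: "(- 1) ^ Suc n * (Re (em_int (2 * n + 2) 2 k) - b * Re (em_int 0 2 k)) \<ge> 0"
    if k: "k > 0" for k
  proof -
    have I: "((\<lambda>t. Re (of_real (bernp J t) * of_real (real k + t) powr (- 2))) has_integral Re (em_int J 2 k)) {0..1}" for J
      using has_integral_linear [OF em_int_has_integral [OF k, of J 2] bounded_linear_Re] by (simp add: o_def)
    have "((\<lambda>t. (- 1) ^ Suc n * (Re (of_real (bernp (2 * n + 2) t) * of_real (real k + t) powr (- 2))
        - b * Re (of_real (bernp 0 t) * of_real (real k + t) powr (- 2)))) has_integral
       (- 1) ^ Suc n * (Re (em_int (2 * n + 2) 2 k) - b * Re (em_int 0 2 k))) {0..1}"
      by (intro has_integral_mult_right has_integral_diff I)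
    then show ?thesis
    proof (rule has_integral_nonneg)
      fix t :: real assume t: "t \<in> {0..1}"
      define p where "p = (real k + t) powr (- 2)"
      have "real k + t > 0" using t k by auto
      then have p: "complex_of_real (real k + t) powr (- 2) = of_real p"
        unfolding p_def using powr_of_real [of "real k + t" "- 2"] by simp
      have "(- 1) ^ Suc n * (bernp (2 * n + 2) t - b) \<ge> 0"
      proof (cases "t = 0 \<or> t = 1")
        case True
        then show ?thesis by (auto simp: b_def bernp_at_0 bernp_at_1)
      next
        case False
        then show ?thesis using bernp_even_sign [of t n] t by (simp add: b_def)
      qed
      then have "(- 1) ^ Suc n * (bernp (2 * n + 2) t - b) * p \<ge> 0"
        by (rule mult_nonneg_nonneg) (simp add: p_def)
      then show "0 \<le> (- 1) ^ Suc n * (Re (of_real (bernp (2 * n + 2) t) * of_real (real k + t) powr (- 2))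
        - b * Re (of_real (bernp 0 t) * of_real (real k + t) powr (- 2)))"
        unfolding p by (simp add: algebra_simps)
    qed
  qed
  have "(\<lambda>i. Re (em_int J 2 (i + 1))) sums Re (em_rem J 2 1)" for J
    using em_rem_sums [of 2 1 J] by (intro sums_Re) simp
  then have "(\<lambda>i. (- 1) ^ Suc n * (Re (em_int (2 * n + 2) 2 (i + 1)) - b * Re (em_int 0 2 (i + 1)))) sums
      ((- 1) ^ Suc n * (Re (em_rem (2 * n + 2) 2 1) - b * Re (em_rem 0 2 1)))"
    by (intro sums_mult sums_diff)
  from sums_le [OF _ sums_zero this] have "(- 1) ^ Suc n * (Re (em_rem (2 * n + 2) 2 1) - b * Re (em_rem 0 2 1)) \<ge> 0"
    using pos by simp
  then show ?thesis unfolding em_rem_0_2 b_def by simp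
qed

text \<open>Here \<open>b_J(t) - b_J(0) = t^2 * q t\<close>, since the linear coefficient
  \<open>bern (2 n + 1)\<close> is 0 for \<open>n \<ge> 1\<close>. The regularised integral of
  \<open>t powr (- 2)\<close> over \<open>[0, 1]\<close> is \<open>- 1\<close>, so adding
  \<open>bern (2 n + 2)\<close> to \<open>em_frac\<close> leaves the integral of \<open>q\<close>.
  That integral is \<open>Q 1\<close> for the antiderivative \<open>Q\<close>, and the mean value
  theorem gives it the sign of \<open>q\<close> inside the interval.\<close>

lemma em_frac_sign:
  assumes "n \<ge> 1"
  shows "(- 1) ^ Suc n * (Re (em_frac (2 * n + 2) (- 2 * of_nat n)) + bern (2 * n + 2)) > 0"
proof -
  define q where "q = (\<lambda>t. \<Sum>j\<le>2*n. bern j * (t ^ (2 * n - j) / fact (2 * n + 2 - j)))"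
  define Q where "Q = (\<lambda>t. \<Sum>j\<le>2*n. bern j * (t ^ (2 * n + 1 - j) / (fact (2 * n + 2 - j) * real (2 * n + 1 - j))))"
  have odd: "bern (Suc (2 * n)) = 0" using assms by (intro bern_odd) auto
  have q: "bernp (2 * n + 2) t = t ^ 2 * q t + bern (2 * n + 2)" for t
  proof -
    have "bernp (2 * n + 2) t = (\<Sum>j\<le>2*n. bern j * (t ^ (2 * n + 2 - j) / fact (2 * n + 2 - j))) + bern (2 * n + 2)"
      by (simp add: bernp_def odd del: fact_Suc)
    also have "(\<Sum>j\<le>2*n. bern j * (t ^ (2 * n + 2 - j) / fact (2 * n + 2 - j))) = t ^ 2 * q t"
      unfolding q_def sum_distrib_left
    proof (rule sum.cong)
      fix j assume "j \<in> {..2*n}"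
      then have "2 * n + 2 - j = 2 + (2 * n - j)" by simp
      then have "t ^ (2 * n + 2 - j) = t ^ 2 * t ^ (2 * n - j)" by (simp only: power_add)
      then show "bern j * (t ^ (2 * n + 2 - j) / fact (2 * n + 2 - j)) =
          t ^ 2 * (bern j * (t ^ (2 * n - j) / fact (2 * n + 2 - j)))" by simp
    qed simp
    finally show ?thesis .
  qed
  have Q': "(Q has_real_derivative q t) (at t)" for t
    unfolding Q_def q_def
  proof (rule DERIV_sum)
    fix j assume "j \<in> {..2*n}"
    then have j: "2 * n + 1 - j = Suc (2 * n - j)" by auto
    have "((\<lambda>t. bern j * (t ^ Suc (2 * n - j) / (fact (2 * n + 2 - j) * real (Suc (2 * n - j))))) has_real_derivative
        bern j * (real (Suc (2 * n - j)) * t ^ (Suc (2 * n - j) - Suc 0) / (fact (2 * n + 2 - j) * real (Suc (2 * n - j))))) (at t)"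
      by (intro DERIV_cmult DERIV_cdivide DERIV_pow)
    then show "((\<lambda>t. bern j * (t ^ (2 * n + 1 - j) / (fact (2 * n + 2 - j) * real (2 * n + 1 - j)))) has_real_derivative
        bern j * (t ^ (2 * n - j) / fact (2 * n + 2 - j))) (at t)"
      unfolding j by (simp del: of_nat_Suc fact_Suc)
  qed
  have Q0: "Q 0 = 0"
    unfolding Q_def by (rule sum.neutral) auto
  obtain z where z: "0 < z" "z < 1" "Q 1 - Q 0 = (1 - 0) * q z"
    using MVT2 [of 0 1 Q q] Q' by auto
  have "(- 1) ^ Suc n * (z ^ 2 * q z) > 0"
    using bernp_even_sign [OF z(1,2), of n] q [of z] by simp
  then have "z ^ 2 * ((- 1) ^ Suc n * q z) > 0"
    by (simp only: mult.left_commute)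
  then have "(- 1) ^ Suc n * q z > 0"
    using z(1) by (simp only: zero_less_mult_iff) auto
  moreover have "em_frac (2 * n + 2) (- 2 * of_nat n) = of_real (Q 1 - bern (2 * n + 2))"
  proof -
    have "em_frac (2 * n + 2) (- 2 * of_nat n) =
        (\<Sum>j\<le>2*n. of_real (bern j) / (fact (2 * n + 2 - j) * (1 - of_nat j + 2 * of_nat n)))
        - of_real (bern (2 * n + 2))"
      by (simp add: em_frac_def odd del: fact_Suc)
    also have "(\<Sum>j\<le>2*n. of_real (bern j) / (fact (2 * n + 2 - j) * (1 - of_nat j + 2 * of_nat n :: complex)))
        = of_real (Q 1)"
      unfolding Q_def of_real_sum
      by (intro sum.cong) (auto simp: of_nat_diff algebra_simps simp del: fact_Suc)
    finally show ?thesis by simp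
  qed
  ultimately show ?thesis using z(3) Q0 by simp
qed

text \<open>With \<open>J = 2 n + 2\<close>, the derivative is $-(2n)! \int_0^\infty (b_J(\{x\}) - b_J(0))\, x^{-2}\,dx$, whose
  integrand has a constant sign. The term \<open>j = 2 n + 1\<close> of \<open>em_frac\<close>, singular at \<open>- 2 n\<close>, has
  coefficient 0.\<close>

lemma deriv_zeta_neg_even:
  assumes "n \<ge> 1"
  shows "deriv zeta (- 2 * of_nat n) \<noteq> 0"
proof -
  define z0 :: complex where "z0 = - 2 * of_nat n"
  define J where "J = 2 * n + 2"
  define L where "L = em_frac J z0 + em_rem J 2 1"
  have Re_z0: "Re z0 = - 2 * real n" by (simp add: z0_def)
  have "(- 1) ^ Suc n * Re L > 0"
    using em_frac_sign [OF assms] em_rem_sign [of n]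
    by (simp add: L_def J_def z0_def algebra_simps)
  then have "L \<noteq> 0" by auto
  have z0_ne: "z0 \<noteq> 1" using Re_z0 by auto
  have "(zeta has_field_derivative deriv zeta z0) (at z0)"
    using holomorphic_derivI [OF holomorphic_zeta, of z0] z0_ne by auto
  then have 1: "((\<lambda>s. (zeta s - zeta z0) / (s - z0)) \<longlongrightarrow> deriv zeta z0) (at z0)"
    by (simp add: has_field_derivative_iff)
  have ev: "\<forall>\<^sub>F s in at z0. s \<in> ball z0 1 - {z0}"
    by (rule eventually_at_in_open) auto
  have "\<forall>\<^sub>F s in at z0. (zeta s - zeta z0) / (s - z0) =
      - pochhammer s (2 * n) * (s + of_nat (2 * n + 1)) * (em_frac J s + em_rem J (s + of_nat J) 1)"
    using ev
  proof eventually_elim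
    case (elim s)
    \<comment> \<open>The poles of \<open>em_frac\<close> can only be points \<open>1 - j\<close>,
      and the only integer within distance 1 of \<open>z0\<close> is \<open>z0\<close> itself, which
      the punctured ball omits.\<close>
    have "1 - of_nat j - s \<noteq> 0" for j :: nat
    proof
      assume "1 - of_nat j - s = 0"
      then have s: "s = of_real (1 - real j)" by simp
      then have "z0 - s = of_real (real j - 1 - 2 * real n)" by (simp add: z0_def)
      then have "\<bar>real j - 1 - 2 * real n\<bar> < 1"
        using elim by (simp only: dist_norm mem_ball norm_of_real Diff_iff)
      then have "j = 2 * n + 1" by linarith
      then show False using elim s by (simp add: z0_def)
    qed
    then have "em_poly J s 1 = - pochhammer s J * em_frac J s"
      by (intro em_poly_1_eq_em_frac)
    moreover have "Re s > - 2 * real n - 1"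
    proof -
      have "cmod (z0 - s) < 1" using elim by (simp add: dist_norm)
      then show ?thesis using abs_Re_le_cmod [of "z0 - s"] Re_z0 by simp
    qed
    moreover have "s \<noteq> 1"
    proof
      assume "s = 1"
      with \<open>1 - of_nat 0 - s \<noteq> 0\<close> show False by simp
    qed
    ultimately have "zeta s = - pochhammer s J * (em_frac J s + em_rem J (s + of_nat J) 1)"
      using zeta_eq [of J s] by (simp add: J_def zeta_em_def algebra_simps)
    \<comment> \<open>The factor \<open>s + 2 n\<close> of the Pochhammer symbol is
      \<open>s - z0\<close>; cancelling it turns the difference quotient into an expression with an
      evident limit.\<close>
    moreover have "pochhammer s J = (s - z0) * (pochhammer s (2 * n) * (s + of_nat (2 * n + 1)))"
      by (simp add: J_def pochhammer_Suc z0_def algebra_simps)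
    moreover have "zeta z0 = 0"
      unfolding z0_def by (rule zeta_neg_even [OF assms])
    ultimately show ?case using elim by simp
  qed
  with 1 have 2: "((\<lambda>s. - pochhammer s (2 * n) * (s + of_nat (2 * n + 1)) *
      (em_frac J s + em_rem J (s + of_nat J) 1)) \<longlongrightarrow> deriv zeta z0) (at z0)"
    using tendsto_cong by fast
  have "isCont (\<lambda>s. em_rem J s 1) 2"
    using holomorphic_em_rem [of 1 J] open_Re_gt [of 1]
    by (auto simp: continuous_on_eq_continuous_at dest: holomorphic_on_imp_continuous_on)
  then have "((\<lambda>s. em_rem J (s + of_nat J) 1) \<longlongrightarrow> em_rem J 2 1) (at z0)"
    by (rule isCont_tendsto_compose) (auto intro!: tendsto_eq_intros simp: z0_def J_def)
  moreover have "(em_frac J \<longlongrightarrow> em_frac J z0) (at z0)"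
    unfolding em_frac_def [abs_def]
  proof (rule tendsto_sum)
    fix j
    show "((\<lambda>s. of_real (bern j) / (fact (J - j) * (1 - of_nat j - s))) \<longlongrightarrow>
        of_real (bern j) / (fact (J - j) * (1 - of_nat j - z0))) (at z0)"
    proof (cases "j = 2 * n + 1")
      case True
      then have "bern j = 0" using assms by (intro bern_odd) auto
      then show ?thesis by simp
    next
      case False
      have "1 - of_nat j - z0 = of_int (1 - int j + 2 * int n)" by (simp add: z0_def)
      also have "\<dots> \<noteq> 0" using False by (simp only: of_int_eq_0_iff)
      finally show ?thesis by (intro tendsto_intros) auto
    qed
  qed
  moreover have "((\<lambda>s. pochhammer s (2 * n)) \<longlongrightarrow> pochhammer z0 (2 * n)) (at z0)"
    unfolding pochhammer_prod by (intro tendsto_intros)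
  ultimately have "((\<lambda>s. - pochhammer s (2 * n) * (s + of_nat (2 * n + 1)) *
      (em_frac J s + em_rem J (s + of_nat J) 1)) \<longlongrightarrow>
      - pochhammer z0 (2 * n) * (z0 + of_nat (2 * n + 1)) * L) (at z0)"
    unfolding L_def by (intro tendsto_intros)
  with 2 have "deriv zeta z0 = - pochhammer z0 (2 * n) * (z0 + of_nat (2 * n + 1)) * L"
    by (intro tendsto_unique [OF _ 2]) auto
  moreover have "pochhammer z0 (2 * n) = fact (2 * n)"
    using pochhammer_neg_nat [of "2 * n" "2 * n", where 'a = complex] by (simp add: z0_def)
  moreover have "z0 + of_nat (2 * n + 1) = 1"
    by (simp add: z0_def)
  ultimately show ?thesis
    using \<open>L \<noteq> 0\<close> unfolding z0_def by simp
qed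

text \<open>Write \<open>f s = (s - z0) * g s\<close> with \<open>g z0 \<noteq> 0\<close>; then the
  difference is \<open>deriv g s / g s\<close>.\<close>

lemma log_deriv_simple_zero:
  assumes S: "open S" "z0 \<in> S" and f: "f holomorphic_on S" "f z0 = 0" "deriv f z0 \<noteq> 0"
  shows "\<exists>l. ((\<lambda>s. deriv f s / f s - 1 / (s - z0)) \<longlongrightarrow> l) (at z0)"
proof -
  define g where "g = (\<lambda>z. if z = z0 then deriv f z0 else f z / (z - z0))"
  have g: "g holomorphic_on S"
    by (rule pole_theorem_open_0 [OF f(1) S(1), of z0]) (auto simp: g_def f)
  have fg: "f z = (z - z0) * g z" for z
    by (simp add: g_def f)
  have df: "deriv f s = g s + (s - z0) * deriv g s" if "s \<in> S" for s
  proof -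
    have "(f has_field_derivative (1 * g s + deriv g s * (s - z0))) (at s)"
      unfolding fg [abs_def]
      using holomorphic_derivI [OF g S(1) that] by (auto intro!: derivative_eq_intros)
    then show ?thesis by (simp add: DERIV_imp_deriv mult.commute)
  qed
  have cont: "isCont g z0" "isCont (deriv g) z0"
    using g holomorphic_deriv [OF g S(1)] S
    by (auto simp: continuous_on_eq_continuous_at dest!: holomorphic_on_imp_continuous_on)
  have g0: "g z0 \<noteq> 0" by (simp add: g_def f)
  have "((\<lambda>s. deriv g s / g s) \<longlongrightarrow> deriv g z0 / g z0) (at z0)"
    using cont g0 by (intro tendsto_divide) (auto simp: isCont_def)
  moreover have "\<forall>\<^sub>F s in at z0. deriv g s / g s = deriv f s / f s - 1 / (s - z0)"
  proof -
    have "\<forall>\<^sub>F s in at z0. g s \<noteq> 0"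
      using cont(1) g0 by (auto simp: isCont_def intro: tendsto_imp_eventually_ne)
    moreover have "\<forall>\<^sub>F s in at z0. s \<in> S - {z0}"
      using S by (intro eventually_at_in_open) auto
    ultimately show ?thesis
    proof eventually_elim
      case (elim s)
      have *: "c / b = (b + a * c) / (a * b) - 1 / a" if "a \<noteq> 0" "b \<noteq> 0" for a b c :: complex
        using that by (simp add: field_simps)
      from elim have "s \<in> S" "s - z0 \<noteq> 0" by auto
      then show ?case
        using * [of "s - z0" "g s" "deriv g s"] elim df [of s] fg [of s] by simp
    qed
  qed
  ultimately show ?thesis using tendsto_cong by fast
qed

section \<open>Slices of meromorphic functions of two variables\<close>

lemma holomorphic2_on_subset: "holomorphic2_on f U \<Longrightarrow> V \<subseteq> U \<Longrightarrow> holomorphic2_on f V"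
  by (auto simp: holomorphic2_on_def)

lemma holomorphic2_on_imp_continuous_on:
  assumes "holomorphic2_on f U"
  shows "continuous_on U f"
proof (rule continuous_at_imp_continuous_on, rule ballI)
  fix p assume "p \<in> U"
  then obtain a b where "(f has_derivative (\<lambda>(h1, h2). a * h1 + b * h2)) (at p)"
    using assms by (auto simp: holomorphic2_on_def)
  then show "isCont f p" by (rule has_derivative_continuous)
qed

lemma holomorphic2_line:
  assumes "holomorphic2_on f U" and "\<And>t. t \<in> T \<Longrightarrow> (a1 + t * b1, a2 + t * b2) \<in> U"
  shows "(\<lambda>t. f (a1 + t * b1, a2 + t * b2)) holomorphic_on T"
  unfolding holomorphic_on_def
proof
  fix t assume "t \<in> T"
  then obtain a b where ab: "(f has_derivative (\<lambda>(h1, h2). a * h1 + b * h2)) (at (a1 + t * b1, a2 + t * b2))"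
    using assms unfolding holomorphic2_on_def by blast
  have "((\<lambda>t. (a1 + t * b1, a2 + t * b2)) has_derivative (\<lambda>h. (h * b1, h * b2))) (at t within T)"
    by (auto intro!: derivative_eq_intros)
  from has_derivative_compose [OF this ab]
  have "((\<lambda>t. f (a1 + t * b1, a2 + t * b2)) has_derivative (\<lambda>h. (a * b1 + b * b2) * h)) (at t within T)"
    by (simp add: algebra_simps)
  then show "(\<lambda>t. f (a1 + t * b1, a2 + t * b2)) field_differentiable at t within T"
    unfolding field_differentiable_def has_field_derivative_def by blast
qed

lemma holomorphic2_slice1:
  assumes "holomorphic2_on f (A \<times> B)" "w \<in> B"
  shows "(\<lambda>z. f (z, w)) holomorphic_on A"
  using holomorphic2_line [OF assms(1), of A 0 1 w 0] assms(2) by simp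

lemma holomorphic2_slice2:
  assumes "holomorphic2_on f (A \<times> B)" "z \<in> A"
  shows "(\<lambda>w. f (z, w)) holomorphic_on B"
  using holomorphic2_line [OF assms(1), of B z 0 0 1] assms(2) by simp

text \<open>Restrict \<open>f\<close> to the complex line through \<open>p\<close> and
  \<open>q\<close>. The parameters that land in the convex set form a convex, hence connected, open
  set, and those landing in \<open>V\<close> form a neighbourhood of 0, so the identity theorem in
  one variable applies.\<close>

lemma holomorphic2_vanish_convex:
  assumes f: "holomorphic2_on f B" and B: "open B" "convex B"
    and V: "open V" "V \<subseteq> B" "p \<in> V" "\<And>q. q \<in> V \<Longrightarrow> f q = 0" and q: "q \<in> B"
  shows "f q = 0"
proof -
  obtain p1 p2 q1 q2 where pq: "p = (p1, p2)" "q = (q1, q2)" by (metis surj_pair)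
  define l where "l = (\<lambda>t. (p1 + t * (q1 - p1), p2 + t * (q2 - p2)))"
  have l_cont: "continuous_on UNIV l"
    unfolding l_def by (intro continuous_intros)
  have l01: "l 0 = p" "l 1 = q" by (simp_all add: l_def pq)
  have "f (l 1) = 0"
  proof (rule analytic_continuation [of "\<lambda>t. f (l t)" "l -` B" "l -` V" 0])
    show "(\<lambda>t. f (l t)) holomorphic_on l -` B"
      unfolding l_def by (rule holomorphic2_line [OF f]) (simp add: l_def)
    show "open (l -` B)"
      using l_cont B(1) continuous_on_open_vimage [of UNIV l] by auto
    have V': "open (l -` V)"
      using l_cont V(1) continuous_on_open_vimage [of UNIV l] by auto
    have "convex (l -` B)"
    proof (rule convexI)
      fix x y :: complex and u v :: real
      assume xy: "x \<in> l -` B" "y \<in> l -` B" and uv: "0 \<le> u" "0 \<le> v" "u + v = 1"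
      have u: "u = 1 - v" using uv by simp
      have "l (u *\<^sub>R x + v *\<^sub>R y) = u *\<^sub>R l x + v *\<^sub>R l y"
        unfolding l_def u by (simp add: scaleR_conv_of_real algebra_simps)
      also have "\<dots> \<in> B" using convexD [OF B(2)] xy uv by auto
      finally show "u *\<^sub>R x + v *\<^sub>R y \<in> l -` B" by simp
    qed
    then show "connected (l -` B)" by (rule convex_connected)
    show "0 islimpt l -` V"
      using V(3) V' l01 by (intro interior_limit_point) (auto simp: interior_open)
  qed (use V q l01 in auto)
  then show ?thesis by (simp add: l01)
qed

text \<open>The interior \<open>S\<close> of the zero set is open and, by the convex case on balls,
  also closed relative to \<open>U\<close>; connectedness finishes.\<close>

lemma holomorphic2_vanish_connected:
  assumes f: "holomorphic2_on f U" and U: "open U" "connected U"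
    and V: "open V" "V \<subseteq> U" "p \<in> V" "\<And>q. q \<in> V \<Longrightarrow> f q = 0" and q: "q \<in> U"
  shows "f q = 0"
proof -
  define S where "S = interior {q \<in> U. f q = 0}"
  have "open (U - S)"
    unfolding open_contains_ball
  proof
    fix x assume x: "x \<in> U - S"
    then obtain e where e: "e > 0" "ball x e \<subseteq> U"
      using U(1) openE by blast
    have "ball x e \<inter> S = {}"
    proof (rule ccontr)
      assume "ball x e \<inter> S \<noteq> {}"
      then obtain y where y: "y \<in> ball x e \<inter> S" by blast
      have "f z = 0" if "z \<in> ball x e" for z
      proof (rule holomorphic2_vanish_convex [of f "ball x e" "ball x e \<inter> S" y])
        show "holomorphic2_on f (ball x e)" using f e by (blast intro: holomorphic2_on_subset)
        show "open (ball x e \<inter> S)" by (auto simp: S_def)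
        show "f q = 0" if "q \<in> ball x e \<inter> S" for q
          using that interior_subset [of "{q \<in> U. f q = 0}"] by (auto simp: S_def)
      qed (use y that in auto)
      then have "ball x e \<subseteq> S"
        unfolding S_def using e by (intro interior_maximal) auto
      with x e show False using centre_in_ball [of x e] by blast
    qed
    then show "\<exists>e>0. ball x e \<subseteq> U - S" using e by blast
  qed
  moreover have "open S" by (simp add: S_def)
  moreover have "S \<subseteq> U" unfolding S_def using interior_subset by blast
  moreover have "V \<subseteq> S"
    unfolding S_def
  proof (rule interior_maximal [OF _ V(1)])
    show "V \<subseteq> {q \<in> U. f q = 0}" using V(2,4) by auto
  qed
  then have "p \<in> S" using V(3) by auto
  moreover have "S \<inter> U = {} \<or> (U - S) \<inter> U = {}"
    using calculation by (intro connectedD [OF U(2)]) auto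
  ultimately have "U - S = {}"
    by auto
  then show ?thesis
    using q interior_subset [of "{q \<in> U. f q = 0}"] by (auto simp: S_def)
qed

section \<open>Taylor coefficients that depend on a parameter\<close>

lemma continuous_on_contour_integral_circlepath:
  assumes "continuous_on (path_image (circlepath a \<rho>) \<times> S) (\<lambda>(u, w). K u w)"
  shows "continuous_on S (\<lambda>w. contour_integral (circlepath a \<rho>) (\<lambda>u. K u w))"
proof -
  have "continuous_on (S \<times> cbox 0 1) (\<lambda>(w, t). K (circlepath a \<rho> t) w * (2 * pi * \<i> * \<rho> * exp (2 * of_real pi * \<i> * of_real t)))"
  proof -
    have "continuous_on (S \<times> cbox 0 1) (\<lambda>x. (circlepath a \<rho> (snd x), fst x))"
      unfolding circlepath by (intro continuous_intros)
    then have "continuous_on (S \<times> cbox 0 1) (\<lambda>x. case (circlepath a \<rho> (snd x), fst x) of (u, w) \<Rightarrow> K u w)"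
      by (rule continuous_on_compose2 [OF assms]) (auto simp: path_image_def)
    then show ?thesis
      unfolding case_prod_unfold by (intro continuous_intros) auto
  qed
  from integral_continuous_on_param [OF this]
  show ?thesis
    by (simp add: contour_integral_integral vector_derivative_circlepath)
qed

text \<open>Exchanging the two contour integrals shows that \<phi> inherits Cauchy's formula on the
  circle around \<open>b\<close> from each \<open>K u\<close>. A continuous function represented in
  this way is holomorphic inside the circle.\<close>

lemma holomorphic_contour_integral_circlepath:
  assumes \<sigma>: "\<sigma> > 0"
    and cont: "continuous_on (path_image (circlepath a \<rho>) \<times> cball b \<sigma>) (\<lambda>(u, w). K u w)"
    and hol: "\<And>u. u \<in> path_image (circlepath a \<rho>) \<Longrightarrow> K u holomorphic_on ball b \<sigma>"
  shows "(\<lambda>w. contour_integral (circlepath a \<rho>) (\<lambda>u. K u w)) holomorphic_on ball b \<sigma>"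
proof -
  define \<phi> where "\<phi> = (\<lambda>w. contour_integral (circlepath a \<rho>) (\<lambda>u. K u w))"
  have \<phi>_cont: "continuous_on (cball b \<sigma>) \<phi>"
    unfolding \<phi>_def by (rule continuous_on_contour_integral_circlepath [OF cont])
  have sub: "path_image (circlepath b \<sigma>) \<subseteq> cball b \<sigma>"
    using \<sigma> by auto
  have K1: "continuous_on (path_image (circlepath a \<rho>)) (\<lambda>u. K u w)" if "w \<in> cball b \<sigma>" for w
  proof -
    have "continuous_on (path_image (circlepath a \<rho>)) (\<lambda>u. case (u, w) of (u, w) \<Rightarrow> K u w)"
      by (rule continuous_on_compose2 [OF cont]) (use that in \<open>auto intro!: continuous_intros\<close>)
    then show ?thesis by simp
  qed
  have K2: "continuous_on (cball b \<sigma>) (K u)" if "u \<in> path_image (circlepath a \<rho>)" for u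
  proof -
    have "continuous_on (cball b \<sigma>) (\<lambda>w. case (u, w) of (u, w) \<Rightarrow> K u w)"
      by (rule continuous_on_compose2 [OF cont]) (use that in \<open>auto intro!: continuous_intros\<close>)
    then show ?thesis by simp
  qed
  \<comment> \<open>The exponent 1 gives the integral the shape expected by
    \<open>Cauchy_next_derivative_circlepath\<close>.\<close>
  have int: "((\<lambda>v. \<phi> v / (v - w) ^ 1) has_contour_integral 2 * of_real pi * \<i> * \<phi> w) (circlepath b \<sigma>)"
    if w: "w \<in> ball b \<sigma>" for w
  proof -
    have ne: "v - w \<noteq> 0" if "v \<in> path_image (circlepath b \<sigma>)" for v
      using that w \<sigma> by (auto simp: dist_norm)
    have "(\<lambda>v. \<phi> v / (v - w)) contour_integrable_on circlepath b \<sigma>"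
      using ne by (intro contour_integrable_continuous_circlepath continuous_intros
          continuous_on_subset [OF \<phi>_cont sub]) auto
    moreover have "contour_integral (circlepath b \<sigma>) (\<lambda>v. \<phi> v / (v - w)) = 2 * of_real pi * \<i> * \<phi> w"
    proof -
      have "contour_integral (circlepath b \<sigma>) (\<lambda>v. \<phi> v / (v - w)) =
          contour_integral (circlepath b \<sigma>) (\<lambda>v. contour_integral (circlepath a \<rho>) (\<lambda>u. K u v / (v - w)))"
      proof (rule contour_integral_cong [OF refl])
        fix v assume "v \<in> path_image (circlepath b \<sigma>)"
        then have "v \<in> cball b \<sigma>" using sub by blast
        then show "\<phi> v / (v - w) = contour_integral (circlepath a \<rho>) (\<lambda>u. K u v / (v - w))"
          unfolding \<phi>_def
          by (intro contour_integral_div [symmetric] contour_integrable_continuous_circlepath K1)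
      qed
      also have "\<dots> = contour_integral (circlepath a \<rho>) (\<lambda>u. contour_integral (circlepath b \<sigma>) (\<lambda>v. K u v / (v - w)))"
      proof (rule contour_integral_swap)
        have "continuous_on (path_image (circlepath b \<sigma>) \<times> path_image (circlepath a \<rho>)) (\<lambda>x. (snd x, fst x))"
          by (intro continuous_intros)
        then have "continuous_on (path_image (circlepath b \<sigma>) \<times> path_image (circlepath a \<rho>))
            (\<lambda>x. case (snd x, fst x) of (u, w) \<Rightarrow> K u w)"
          by (rule continuous_on_compose2 [OF cont]) (use sub in auto)
        then show "continuous_on (path_image (circlepath b \<sigma>) \<times> path_image (circlepath a \<rho>))
            (\<lambda>(v, u). K u v / (v - w))"
          unfolding case_prod_unfold using ne by (auto intro!: continuous_intros)
      qed (auto simp: vector_derivative_circlepath intro!: continuous_intros)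
      also have "\<dots> = contour_integral (circlepath a \<rho>) (\<lambda>u. 2 * of_real pi * \<i> * K u w)"
      proof (rule contour_integral_cong [OF refl])
        fix u assume u: "u \<in> path_image (circlepath a \<rho>)"
        show "contour_integral (circlepath b \<sigma>) (\<lambda>v. K u v / (v - w)) = 2 * of_real pi * \<i> * K u w"
          using w Cauchy_integral_circlepath [OF K2 [OF u] hol [OF u], of w]
          by (intro contour_integral_unique) (simp add: dist_norm norm_minus_commute)
      qed
      also have "\<dots> = 2 * of_real pi * \<i> * \<phi> w"
        unfolding \<phi>_def using w
        by (intro contour_integral_lmul contour_integrable_continuous_circlepath K1) auto
      finally show ?thesis .
    qed
    ultimately show ?thesis
      using has_contour_integral_integral by fastforce
  qed
  have "(\<lambda>w. 2 * of_real pi * \<i> * \<phi> w) holomorphic_on ball b \<sigma>"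
    unfolding holomorphic_on_open [OF open_ball]
    using Cauchy_next_derivative_circlepath(2) [OF continuous_on_subset [OF \<phi>_cont sub] int]
    by blast
  from holomorphic_on_mult [OF holomorphic_on_const [of "1 / (2 * of_real pi * \<i>)"] this]
  show ?thesis by (simp add: \<phi>_def)
qed

text \<open>Cauchy's formula expresses the coefficient as an integral over one circle that serves
  all \<open>w\<close>. The radius \<open>s < r\<close> keeps the closed discs inside the
  domain.\<close>

lemma holomorphic_slice_coeff:
  assumes h: "holomorphic2_on h (ball a r \<times> ball b r)" and r: "0 < s" "s < r"
  shows "(\<lambda>w. (deriv ^^ n) (\<lambda>z. h (z, w)) a) holomorphic_on ball b s"
proof -
  have sub: "path_image (circlepath a s) \<subseteq> ball a r" "cball a s \<subseteq> ball a r" "cball b s \<subseteq> ball b r"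
    using r by auto
  have ne: "u - a \<noteq> 0" if "u \<in> path_image (circlepath a s)" for u
    using that r by auto
  have hc: "continuous_on (ball a r \<times> ball b r) h"
    using h by (rule holomorphic2_on_imp_continuous_on)
  have "(\<lambda>w. contour_integral (circlepath a s) (\<lambda>u. h (u, w) / (u - a) ^ Suc n)) holomorphic_on ball b s"
  proof (rule holomorphic_contour_integral_circlepath [OF r(1)])
    have "continuous_on (path_image (circlepath a s) \<times> cball b s) (\<lambda>x. h (fst x, snd x))"
      using sub by (auto intro: continuous_on_subset [OF hc])
    then show "continuous_on (path_image (circlepath a s) \<times> cball b s) (\<lambda>(u, w). h (u, w) / (u - a) ^ Suc n)"
      unfolding case_prod_unfold using ne by (intro continuous_intros) auto
    fix u assume u: "u \<in> path_image (circlepath a s)"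
    have "(\<lambda>w. h (u, w)) holomorphic_on ball b r"
      using holomorphic2_slice2 [OF h, of u] sub u by blast
    then have "(\<lambda>w. h (u, w)) holomorphic_on ball b s"
      by (rule holomorphic_on_subset) (use r in auto)
    then show "(\<lambda>w. h (u, w) / (u - a) ^ Suc n) holomorphic_on ball b s"
      using ne [OF u] by (intro holomorphic_intros) auto
  qed
  then have 1: "(\<lambda>w. fact n / (2 * of_real pi * \<i>) *
      contour_integral (circlepath a s) (\<lambda>u. h (u, w) / (u - a) ^ Suc n)) holomorphic_on ball b s"
    by (intro holomorphic_intros)
  show ?thesis
  proof (rule holomorphic_transform [OF 1])
    fix w assume w: "w \<in> ball b s"
    have hw: "(\<lambda>z. h (z, w)) holomorphic_on ball a r"
      using holomorphic2_slice1 [OF h, of w] w r by auto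
    have "((\<lambda>u. h (u, w) / (u - a) ^ Suc n) has_contour_integral
        2 * pi * \<i> / fact n * (deriv ^^ n) (\<lambda>z. h (z, w)) a) (circlepath a s)"
      using sub r holomorphic_on_subset [OF hw, of "cball a s"] holomorphic_on_subset [OF hw, of "ball a s"]
      by (intro Cauchy_has_contour_integral_higher_derivative_circlepath holomorphic_on_imp_continuous_on) auto
    from contour_integral_unique [OF this]
    show "fact n / (2 * of_real pi * \<i>) * contour_integral (circlepath a s) (\<lambda>u. h (u, w) / (u - a) ^ Suc n) =
        (deriv ^^ n) (\<lambda>z. h (z, w)) a"
      by simp
  qed
qed

lemma tendsto_divide_power_deriv:
  assumes f: "f holomorphic_on ball a r" and r: "r > 0"
    and z: "\<And>i. i < n \<Longrightarrow> (deriv ^^ i) f a = 0"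
  shows "((\<lambda>z. f z / (z - a) ^ n) \<longlongrightarrow> (deriv ^^ n) f a / fact n) (at a)"
proof -
  define c where "c = (\<lambda>k. (deriv ^^ k) f a / fact k)"
  have "((\<lambda>x. f (a + x) / x ^ n) \<longlongrightarrow> c (0 + n)) (at 0)"
  proof (rule powser_limit_0_strong [OF r])
    fix x :: complex assume x: "x \<noteq> 0" "norm x < r"
    have "(\<lambda>k. c k * x ^ k) sums f (a + x)"
      using holomorphic_power_series [OF f, of "a + x"] x by (simp add: c_def dist_norm)
    then have "(\<lambda>k. c (k + n) * x ^ (k + n)) sums (f (a + x) - (\<Sum>k<n. c k * x ^ k))"
      by (rule sums_split_initial_segment)
    also have "(\<Sum>k<n. c k * x ^ k) = 0"
      using z by (intro sum.neutral) (auto simp: c_def)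
    finally have "(\<lambda>k. c (k + n) * x ^ (k + n) / x ^ n) sums (f (a + x) / x ^ n)"
      using sums_divide by fastforce
    then show "(\<lambda>k. c (k + n) * x ^ k) sums (f (a + x) / x ^ n)"
      using x by (simp add: power_add)
  qed
  then show ?thesis
    using LIM_offset_zero_iff [of a "\<lambda>z. f z / (z - a) ^ n" "c n"] by (simp add: c_def)
qed

lemma holomorphic_eventually_nonzero:
  assumes "f holomorphic_on S" "open S" "connected S" "b \<in> S" "w \<in> S" "f w \<noteq> 0"
  shows "\<forall>\<^sub>F z in at b. f z \<noteq> 0"
proof (rule ccontr)
  assume "\<not> (\<forall>\<^sub>F z in at b. f z \<noteq> 0)"
  then have 1: "\<exists>\<^sub>F z in at b. f z = 0"
    by (simp add: frequently_def)
  have 2: "\<forall>\<^sub>F z in at b. z \<in> S"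
    using assms by (intro eventually_at_in_open') auto
  have "\<exists>\<^sub>F z in at b. z \<in> {z \<in> S. f z = 0}"
    by (rule frequently_elim1 [OF frequently_eventually_frequently [OF 1 2]]) auto
  then have lim: "b islimpt {z \<in> S. f z = 0}"
    by (simp add: islimpt_conv_frequently_at)
  have "f w = 0"
    by (rule analytic_continuation [OF assms(1,2,3) _ assms(4) lim _ assms(5)]) auto
  with assms show False by simp
qed

text \<open>Here \<open>n\<close> is the least order for which the Taylor coefficient in
  \<open>z - a\<close> is not identically zero in \<open>w\<close>. It is the exact order of
  vanishing at \<open>a\<close> for all \<open>w\<close> near but different from \<open>b\<close>;
  at \<open>b\<close> itself the order may be larger, and \<open>H\<close> may vanish there.\<close>

lemma slice_order:
  assumes h: "holomorphic2_on h (ball a r \<times> ball b r)" and r: "0 < r"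
    and nz: "q \<in> ball a r \<times> ball b r" "h q \<noteq> 0"
  obtains n H where "H analytic_on {b}" "\<forall>\<^sub>F w in at b. H w \<noteq> 0"
    "\<forall>\<^sub>F w in at b. ((\<lambda>z. h (z, w) / (z - a) ^ n) \<longlongrightarrow> H w) (at a)"
proof -
  define s where "s = r / 2"
  have s: "0 < s" "s < r" using r by (auto simp: s_def)
  define c where "c = (\<lambda>n w. (deriv ^^ n) (\<lambda>z. h (z, w)) a)"
  have slice: "(\<lambda>z. h (z, w)) holomorphic_on ball a r" if "w \<in> ball b s" for w
    using holomorphic2_slice1 [OF h, of w] that s by auto
  \<comment> \<open>If all coefficients vanished, \<open>h\<close> would be zero on a smaller bidisc
    and hence, by the identity theorem, at \<open>q\<close>.\<close>
  have ex: "\<exists>n. \<exists>w\<in>ball b s. c n w \<noteq> 0"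
  proof (rule ccontr)
    assume *: "\<not> ?thesis"
    have 0: "h (z, w) = 0" if "z \<in> ball a r" "w \<in> ball b s" for z w
      using * that unfolding c_def
      by (intro holomorphic_fun_eq_0_on_ball [OF slice [OF that(2)] that(1)]) blast
    have "h q = 0"
    proof (rule holomorphic2_vanish_convex [OF h, of "ball a r \<times> ball b s" "(a, b)"])
      show "open (ball a r \<times> ball b s)" "open (ball a r \<times> ball b r)" by (intro open_Times open_ball)+
      show "convex (ball a r \<times> ball b r)" by (intro convex_Times convex_ball)
      show "h p = 0" if "p \<in> ball a r \<times> ball b s" for p
        using that 0 by (cases p) auto
    qed (use s r nz(1) in auto)
    with nz show False by simp
  qed
  define n where "n = (LEAST n. \<exists>w\<in>ball b s. c n w \<noteq> 0)"
  have "\<exists>w\<in>ball b s. c n w \<noteq> 0"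
    unfolding n_def by (rule LeastI_ex [OF ex])
  then obtain w0 where w0: "w0 \<in> ball b s" "c n w0 \<noteq> 0" by blast
  have less: "c i w = 0" if "i < n" "w \<in> ball b s" for i w
    using not_less_Least [OF that(1) [unfolded n_def]] that(2) by blast
  have hol: "c n holomorphic_on ball b s"
    unfolding c_def using h s by (rule holomorphic_slice_coeff)
  then have hol': "(\<lambda>w. c n w / fact n) holomorphic_on ball b s"
    by (intro holomorphic_intros) auto
  show ?thesis
  proof (rule that [of "\<lambda>w. c n w / fact n" n])
    show "(\<lambda>w. c n w / fact n) analytic_on {b}"
      using hol' s(1) analytic_at_ball by blast
    show "\<forall>\<^sub>F w in at b. c n w / fact n \<noteq> 0"
      using holomorphic_eventually_nonzero [OF hol _ _ _ w0] s(1) by simp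
    have "\<forall>\<^sub>F w in at b. w \<in> ball b s"
      using s(1) by (intro eventually_at_in_open') auto
    then show "\<forall>\<^sub>F w in at b. ((\<lambda>z. h (z, w) / (z - a) ^ n) \<longlongrightarrow> c n w / fact n) (at a)"
    proof eventually_elim
      case (elim w)
      show ?case
        unfolding c_def
        by (rule tendsto_divide_power_deriv [OF slice [OF elim] r]) (rule less [OF _ elim, unfolded c_def])
    qed
  qed
qed

text \<open>With orders \<open>m\<close> of the numerator and \<open>n\<close> of the denominator
  along \<open>z = a\<close>, the quotient behaves like \<open>(z - a)^(m-n) * G w / H w\<close>. So
  \<open>m \<ge> n\<close> gives a finite limit that is a quotient of analytic functions of
  \<open>w\<close>, and \<open>m < n\<close> an infinite one. A numerator that vanishes near the
  point has no order and is treated apart.\<close>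

lemma meromorphic2_slice_limit:
  assumes "meromorphic2 f"
  shows "(\<exists>A B. A analytic_on {b} \<and> B analytic_on {b} \<and>
            (\<forall>\<^sub>F w in at b. ((\<lambda>z. f (z, w)) \<longlongrightarrow> A w / B w) (at a))) \<or>
         (\<forall>\<^sub>F w in at b. filterlim (\<lambda>z. f (z, w)) at_infinity (at a))"
proof -
  obtain U g h where U: "open U" "connected U" "(a, b) \<in> U"
    and gh: "holomorphic2_on g U" "holomorphic2_on h U"
    and nz: "\<exists>q\<in>U. h q \<noteq> 0" and eq: "\<And>q. q \<in> U \<Longrightarrow> h q \<noteq> 0 \<Longrightarrow> f q = g q / h q"
    using assms unfolding meromorphic2_def by metis
  obtain A' B' where AB: "open A'" "open B'" "(a, b) \<in> A' \<times> B'" "A' \<times> B' \<subseteq> U"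
    using U open_prod_elim by blast
  then obtain r1 r2 where r12: "r1 > 0" "ball a r1 \<subseteq> A'" "r2 > 0" "ball b r2 \<subseteq> B'"
    by (metis mem_Sigma_iff openE)
  define r where "r = min r1 r2"
  define D where "D = ball a r \<times> ball b r"
  have r: "r > 0" using r12 by (simp add: r_def)
  have "ball a r \<subseteq> ball a r1" "ball b r \<subseteq> ball b r2" by (auto simp: r_def)
  then have DU: "D \<subseteq> U" using r12 AB(4) unfolding D_def by blast
  have gD: "holomorphic2_on g (ball a r \<times> ball b r)" and hD: "holomorphic2_on h (ball a r \<times> ball b r)"
    using gh DU by (auto simp: D_def intro: holomorphic2_on_subset)
  \<comment> \<open>The denominator is only known to be nonzero somewhere in \<open>U\<close>; the
    identity theorem carries this into the small bidisc.\<close>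
  have "\<exists>q\<in>D. h q \<noteq> 0"
  proof (rule ccontr)
    assume "\<not> ?thesis"
    then have "h q = 0" if "q \<in> U" for q
      using holomorphic2_vanish_connected [OF gh(2) U(1,2), of D "(a, b)" q] that DU r
      by (auto simp: D_def open_Times)
    with nz show False by blast
  qed
  then obtain qh where "qh \<in> ball a r \<times> ball b r" "h qh \<noteq> 0" by (auto simp: D_def)
  from slice_order [OF hD r this] obtain n H where H: "H analytic_on {b}"
    "\<forall>\<^sub>F w in at b. H w \<noteq> 0" "\<forall>\<^sub>F w in at b. ((\<lambda>z. h (z, w) / (z - a) ^ n) \<longlongrightarrow> H w) (at a)"
    by blast
  have near: "\<forall>\<^sub>F w in at b. w \<in> ball b r"
    using r by (intro eventually_at_in_open') auto
  have feq: "\<forall>\<^sub>F z in at a. f (z, w) = g (z, w) / h (z, w) \<and> z \<in> ball a r - {a}"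
    if "w \<in> ball b r" "H w \<noteq> 0" "((\<lambda>z. h (z, w) / (z - a) ^ n) \<longlongrightarrow> H w) (at a)" for w
  proof -
    have "\<forall>\<^sub>F z in at a. h (z, w) / (z - a) ^ n \<noteq> 0"
      using that tendsto_imp_eventually_ne by blast
    moreover have "\<forall>\<^sub>F z in at a. z \<in> ball a r - {a}"
      using r by (intro eventually_at_in_open) auto
    ultimately show ?thesis
    proof eventually_elim
      case (elim z)
      then have "(z, w) \<in> D" using that by (auto simp: D_def)
      then show ?case using eq [of "(z, w)"] elim DU by auto
    qed
  qed
  show ?thesis
  proof (cases "\<exists>q\<in>D. g q \<noteq> 0")
    case False
    have "\<forall>\<^sub>F w in at b. ((\<lambda>z. f (z, w)) \<longlongrightarrow> 0 / 1) (at a)"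
      using near H(2,3)
    proof eventually_elim
      case (elim w)
      have "\<forall>\<^sub>F z in at a. f (z, w) = 0"
        using feq [OF elim]
      proof eventually_elim
        case (elim z)
        then have "(z, w) \<in> D" using \<open>w \<in> ball b r\<close> by (auto simp: D_def)
        then show ?case using False elim by auto
      qed
      then show ?case by (simp add: tendsto_eventually)
    qed
    then show ?thesis
      by (intro disjI1 exI [of _ "\<lambda>_. 0"] exI [of _ "\<lambda>_. 1"]) auto
  next
    case True
    then obtain qg where "qg \<in> ball a r \<times> ball b r" "g qg \<noteq> 0" by (auto simp: D_def)
    from slice_order [OF gD r this] obtain m G where G: "G analytic_on {b}"
      "\<forall>\<^sub>F w in at b. G w \<noteq> 0" "\<forall>\<^sub>F w in at b. ((\<lambda>z. g (z, w) / (z - a) ^ m) \<longlongrightarrow> G w) (at a)"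
      by blast
    show ?thesis
    proof (cases "m \<ge> n")
      case True
      \<comment> \<open>The power \<open>0 ^ (m - n)\<close> is 1 for equal orders and 0 otherwise,
        which covers both finite cases by one formula.\<close>
      have "\<forall>\<^sub>F w in at b. ((\<lambda>z. f (z, w)) \<longlongrightarrow> (G w * 0 ^ (m - n)) / H w) (at a)"
        using near H(2,3) G(3)
      proof eventually_elim
        case (elim w)
        have "((\<lambda>z. (g (z, w) / (z - a) ^ m * (z - a) ^ (m - n)) / (h (z, w) / (z - a) ^ n)) \<longlongrightarrow>
            (G w * (a - a) ^ (m - n)) / H w) (at a)"
          by (intro tendsto_intros elim)
        moreover have "\<forall>\<^sub>F z in at a. (g (z, w) / (z - a) ^ m * (z - a) ^ (m - n)) / (h (z, w) / (z - a) ^ n) = f (z, w)"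
          using feq [OF elim(1-3)]
        proof eventually_elim
          case (elim z)
          then have "z - a \<noteq> 0" by auto
          moreover have "(z - a) ^ m = (z - a) ^ (m - n) * (z - a) ^ n"
            using True by (simp flip: power_add)
          ultimately show ?case using elim by (simp add: divide_simps)
        qed
        ultimately show ?case using tendsto_cong by fastforce
      qed
      moreover have "(\<lambda>w. G w * 0 ^ (m - n)) analytic_on {b}"
        using G(1) by (intro analytic_intros)
      ultimately show ?thesis using H(1) by blast
    next
      case False
      have "\<forall>\<^sub>F w in at b. filterlim (\<lambda>z. f (z, w)) at_infinity (at a)"
        using near H(2,3) G(2,3)
      proof eventually_elim
        case (elim w)
        have 1: "((\<lambda>z. (g (z, w) / (z - a) ^ m) / (h (z, w) / (z - a) ^ n)) \<longlongrightarrow> G w / H w) (at a)"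
          by (intro tendsto_intros elim)
        have "((\<lambda>z. (z - a) ^ (n - m)) \<longlongrightarrow> 0) (at a)"
          using False by (auto intro!: tendsto_eq_intros)
        moreover have "\<forall>\<^sub>F z in at a. (z - a) ^ (n - m) \<noteq> 0"
          by (rule eventually_mono [OF eventually_at_in_open [of UNIV a]]) auto
        ultimately have 2: "filterlim (\<lambda>z. (z - a) ^ (n - m)) (at 0) (at a)"
          by (simp add: filterlim_at)
        have 3: "filterlim (\<lambda>z. ((g (z, w) / (z - a) ^ m) / (h (z, w) / (z - a) ^ n)) / (z - a) ^ (n - m))
            at_infinity (at a)"
          by (rule filterlim_divide_at_infinity [OF 1 2]) (use elim in auto)
        have "\<forall>\<^sub>F z in at a. ((g (z, w) / (z - a) ^ m) / (h (z, w) / (z - a) ^ n)) / (z - a) ^ (n - m) = f (z, w)"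
          using feq [OF elim(1-3)]
        proof eventually_elim
          case (elim z)
          then have "z - a \<noteq> 0" by auto
          moreover have "(z - a) ^ n = (z - a) ^ (n - m) * (z - a) ^ m"
            using False by (simp flip: power_add)
          ultimately show ?case using elim by (simp add: divide_simps)
        qed
        with 3 show ?case using filterlim_cong by fast
      qed
      then show ?thesis by blast
    qed
  qed
qed

lemma eventually_at_imp_open_nbhd:
  fixes b :: complex
  assumes "\<forall>\<^sub>F w in at b. X w"
  obtains V where "open V" "b \<in> V" "\<And>c. c \<in> V \<Longrightarrow> \<forall>\<^sub>F w in at c. X w"
proof -
  obtain V where V: "open V" "b \<in> V" "\<And>w. w \<in> V \<Longrightarrow> w \<noteq> b \<Longrightarrow> X w"
    using assms by (auto simp: eventually_at_topological)
  have "\<forall>\<^sub>F w in at c. X w" if "c \<in> V" for c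
  proof (cases "c = b")
    case False
    have "\<forall>\<^sub>F w in at c. w \<in> V - {b}"
      using V(1) that False by (intro eventually_at_in_open') auto
    then show ?thesis using V(3) by (auto elim: eventually_mono)
  qed (use assms in auto)
  with V show ?thesis using that by blast
qed

text \<open>The set of \<open>b\<close> near which the slices have a finite limit and the set of those near which they
  have an infinite one are open, disjoint and cover the plane.\<close>

lemma meromorphic2_slice_limit_global:
  assumes f: "meromorphic2 f" and b0: "\<forall>\<^sub>F w in at b0. \<exists>L. ((\<lambda>z. f (z, w)) \<longlongrightarrow> L) (at a)"
  defines "G \<equiv> \<lambda>w. Lim (at a) (\<lambda>z. f (z, w))"
  shows "\<forall>\<^sub>F w in at b. ((\<lambda>z. f (z, w)) \<longlongrightarrow> G w) (at a)" and "G meromorphic_on UNIV"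
proof -
  define P where "P = (\<lambda>b. \<forall>\<^sub>F w in at b. \<exists>L. ((\<lambda>z. f (z, w)) \<longlongrightarrow> L) (at a))"
  define Q where "Q = (\<lambda>b. \<forall>\<^sub>F w in at b. filterlim (\<lambda>z. f (z, w)) at_infinity (at a))"
  have "open {b. P b}"
    unfolding P_def by (subst open_subopen) (auto elim!: eventually_at_imp_open_nbhd)
  moreover have "open {b. Q b}"
    unfolding Q_def by (subst open_subopen) (auto elim!: eventually_at_imp_open_nbhd)
  moreover have PQ: "P b \<or> Q b" for b
    using meromorphic2_slice_limit [OF f, of b a] unfolding P_def Q_def
    by (auto elim: eventually_mono)
  moreover have "\<not> (P b \<and> Q b)" for b
  proof
    assume "P b \<and> Q b"
    then have "\<forall>\<^sub>F w in at b. \<exists>L. ((\<lambda>z. f (z, w)) \<longlongrightarrow> L) (at a)"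
      "\<forall>\<^sub>F w in at b. filterlim (\<lambda>z. f (z, w)) at_infinity (at a)"
      by (simp_all add: P_def Q_def)
    then have "\<forall>\<^sub>F w in at b. False"
    proof eventually_elim
      case (elim w)
      then show ?case using not_tendsto_and_filterlim_at_infinity [OF at_neq_bot] by blast
    qed
    then show False by simp
  qed
  ultimately have "{b. P b} = {} \<or> {b. Q b} = {}"
    using connectedD [OF connected_UNIV, of "{b. P b}" "{b. Q b}"] by blast
  moreover have "P b0" using b0 by (simp add: P_def)
  ultimately have nQ: "\<not> Q b" for b by blast
  then have P: "P b" for b using PQ by blast
  have lim: "\<forall>\<^sub>F w in at b. ((\<lambda>z. f (z, w)) \<longlongrightarrow> G w) (at a)" for b
    using P [of b] unfolding P_def
  proof eventually_elim
    case (elim w)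
    then show ?case unfolding G_def by (metis at_neq_bot tendsto_Lim)
  qed
  then show "\<forall>\<^sub>F w in at b. ((\<lambda>z. f (z, w)) \<longlongrightarrow> G w) (at a)" .
  show "G meromorphic_on UNIV"
  proof (subst meromorphic_on_meromorphic_at, intro ballI)
    fix b
    obtain A B where AB: "A analytic_on {b}" "B analytic_on {b}"
      "\<forall>\<^sub>F w in at b. ((\<lambda>z. f (z, w)) \<longlongrightarrow> A w / B w) (at a)"
      using meromorphic2_slice_limit [OF f, of b a] nQ [of b] unfolding Q_def by blast
    have "\<forall>\<^sub>F w in at b. A w / B w = G w"
      using AB(3) lim [of b] by eventually_elim (rule tendsto_unique [OF at_neq_bot])
    moreover have "(\<lambda>w. A w / B w) meromorphic_on {b}"
      using AB by (intro meromorphic_on_divide analytic_on_imp_meromorphic_on)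
    ultimately show "G meromorphic_on {b}"
      by (subst (asm) meromorphic_on_cong) auto
  qed
qed

section \<open>The logarithmic derivative of the zeta function\<close>

lemma bij_betw_Suc_atLeast: "bij_betw Suc UNIV {1..}"
  by (rule bij_betwI [of _ _ _ "\<lambda>n. n - 1"]) auto

lemma has_sum_atLeast_1_iff: "(f has_sum S) {1..} \<longleftrightarrow> ((\<lambda>i. f (Suc i)) has_sum S) UNIV"
  using has_sum_reindex_bij_betw [OF bij_betw_Suc_atLeast, of f S] by simp

text \<open>The crude bound \<open>\<Lambda>(n) \<le> n\<close> costs one power of \<open>n\<close>.
  This is harmless, since identities between meromorphic functions are tested only far to the
  right.\<close>

lemma norm_mangoldt_term_le:
  assumes "n > 0"
  shows "norm (mangoldt n * z :: complex) \<le> real n * norm z"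
proof -
  have "mangoldt n \<le> ln (real n)" using assms by (rule mangoldt_le)
  also have "\<dots> \<le> real n" using ln_le_minus_one [of "real n"] assms by simp
  finally show ?thesis by (simp add: norm_mult mult_right_mono)
qed

definition mangoldt_series :: "complex \<Rightarrow> complex" where
  "mangoldt_series w = (\<Sum>i. mangoldt (Suc i) * of_nat (Suc i) powr (- w))"

lemma summable_mangoldt_series:
  assumes "Re w > 2"
  shows "summable (\<lambda>i. norm (mangoldt (Suc i) * of_nat (Suc i) powr (- w) :: complex))"
proof (rule summable_comparison_test')
  show "summable (\<lambda>i. real (i + 1) powr (1 - Re w))"
    using assms by (intro summable_shift_powr) auto
  fix i :: nat assume "i \<ge> 0"
  have "norm (mangoldt (Suc i) * of_nat (Suc i) powr (- w) :: complex) \<le> real (Suc i) * real (Suc i) powr (- Re w)"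
    using norm_mangoldt_term_le [of "Suc i" "of_nat (Suc i) powr (- w)"] by (simp add: norm_of_nat_powr del: of_nat_Suc)
  also have "\<dots> = real (i + 1) powr (1 - Re w)"
    by (simp add: powr_diff powr_minus divide_inverse add.commute)
  finally show "norm (norm (mangoldt (Suc i) * of_nat (Suc i) powr (- w) :: complex)) \<le> real (i + 1) powr (1 - Re w)"
    by simp
qed

lemma mangoldt_series_sums:
  assumes "Re w > 2"
  shows "(\<lambda>i. mangoldt (Suc i) * of_nat (Suc i) powr (- w)) sums mangoldt_series w"
  unfolding mangoldt_series_def
  by (intro summable_sums summable_norm_cancel [OF summable_mangoldt_series] assms)

lemma mangoldt_series_has_sum:
  assumes "Re w > 2"
  shows "((\<lambda>n. mangoldt n * of_nat n powr (- w)) has_sum mangoldt_series w) {1..}"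
  unfolding has_sum_atLeast_1_iff
  by (intro norm_summable_imp_has_sum summable_mangoldt_series mangoldt_series_sums assms)

lemma summable_norm_zeta:
  assumes "Re w > 1"
  shows "summable (\<lambda>i. norm (of_nat (Suc i) powr (- w) :: complex))"
  using summable_shift_powr [of "- Re w" 1] assms
  by (simp only: norm_of_nat_powr uminus_complex.sel Suc_eq_plus1)

lemma zeta_has_sum:
  assumes "Re w > 1"
  shows "((\<lambda>n. of_nat n powr (- w)) has_sum zeta w) {1..}"
  unfolding has_sum_atLeast_1_iff
  by (intro norm_summable_imp_has_sum summable_norm_zeta zeta_sums assms)

lemma of_nat_powr_eq_exp:
  assumes "n > 0"
  shows "of_nat n powr s = exp (s * of_real (ln (real n)) :: complex)"
  using of_real_powr_eq_exp [of "real n" s] assms by simp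

lemma of_nat_mult_powr:
  assumes "m > 0" "n > 0"
  shows "(of_nat m * of_nat n :: complex) powr s = of_nat m powr s * of_nat n powr s"
  using assms of_nat_powr_eq_exp [of "m * n" s]
  by (simp add: of_nat_powr_eq_exp ln_mult ring_distribs exp_add)

lemma deriv_zeta_sums:
  assumes "Re w > 1"
  shows "(\<lambda>i. - of_real (ln (real (Suc i))) * of_nat (Suc i) powr (- w)) sums deriv zeta w"
proof -
  let ?f = "\<lambda>i w. of_nat (Suc i) powr (- w) :: complex"
  let ?S = "{w. Re w > 1}"
  have D: "(?f i has_field_derivative (- of_real (ln (real (Suc i))) * ?f i w)) (at w)" for i w
    unfolding of_nat_powr_eq_exp [OF zero_less_Suc]
    by (auto intro!: derivative_eq_intros simp del: of_nat_Suc)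
  have hol: "?f i holomorphic_on ?S" for i
    using D open_Re_gt [of 1] by (subst holomorphic_on_open) blast+
  have bd: "\<exists>d>0. \<exists>h. summable h \<and> (\<forall>n. \<forall>y\<in>ball x d \<inter> ?S. norm (?f n y) \<le> h n)" if "x \<in> ?S" for x
  proof -
    define d where "d = (Re x - 1) / 2"
    have d: "d > 0" using that by (simp add: d_def)
    have "norm (?f n y) \<le> real (n + 1) powr (- (1 + d))" if "y \<in> ball x d \<inter> ?S" for n y
    proof -
      have "Re y \<ge> 1 + d"
        using Re_ge_in_ball [of y x d] that by (simp add: d_def field_simps)
      then have "real (Suc n) powr (- Re y) \<le> real (Suc n) powr (- (1 + d))"
        by (intro powr_mono) auto
      then show ?thesis by (simp add: norm_of_nat_powr del: of_nat_Suc)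
    qed
    moreover have "summable (\<lambda>n. real (n + 1) powr (- (1 + d)))"
      using d by (intro summable_shift_powr) auto
    ultimately show ?thesis using d by blast
  qed
  have w: "w \<in> ?S" using assms by simp
  have hz: "zeta holomorphic_on ?S"
    by (rule holomorphic_on_subset [OF holomorphic_zeta]) auto
  have "deriv zeta w = deriv (\<lambda>z. \<Sum>i. ?f i z) w"
    by (rule complex_derivative_transform_within_open [OF hz _ open_Re_gt w])
       (use holomorphic_suminf(1) [OF open_Re_gt hol bd] sums_unique [OF zeta_sums] in auto)
  moreover have "(\<lambda>i. deriv (?f i) w) sums deriv (\<lambda>z. \<Sum>i. ?f i z) w"
    by (rule holomorphic_suminf(2) [OF open_Re_gt hol bd w])
  ultimately show ?thesis
    by (simp only: DERIV_imp_deriv [OF D])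
qed

text \<open>Dirichlet convolution: absolute convergence allows the double sum to be grouped by the
  product of its indices, where summing \<Lambda> over the divisors of \<open>l\<close> gives
  \<open>ln l\<close>.\<close>

lemma mangoldt_series_times_zeta:
  assumes "Re w > 2"
  shows "mangoldt_series w * zeta w = - deriv zeta w"
proof -
  define F where "F = (\<lambda>(m, n). mangoldt m * of_nat m powr (- w) * of_nat n powr (- w) :: complex)"
  define F' where "F' = (\<lambda>(l, d). mangoldt d * of_nat l powr (- w) :: complex)"
  have w1: "Re w > 1" using assms by simp
  have inner: "((\<lambda>n. F (m, n)) has_sum mangoldt m * of_nat m powr (- w) * zeta w) {1..}" for m
    unfolding F_def using has_sum_cmult_right [OF zeta_has_sum [OF w1]] by simp
  have outer: "((\<lambda>m. mangoldt m * of_nat m powr (- w) * zeta w) has_sum mangoldt_series w * zeta w) {1..}"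
    by (intro has_sum_cmult_left mangoldt_series_has_sum assms)
  have summ: "F summable_on {1..} \<times> {1..}"
  proof (rule abs_summable_summable)
    have 1: "(\<lambda>n. norm (of_nat n powr (- w) :: complex)) summable_on {1..}"
      using zeta_has_sum [OF w1] by (subst summable_on_iff_abs_summable_on_complex [symmetric]) (auto simp: summable_on_def)
    have 2: "(\<lambda>m. norm (mangoldt m * of_nat m powr (- w) :: complex)) summable_on {1..}"
      using mangoldt_series_has_sum [OF assms]
      by (subst summable_on_iff_abs_summable_on_complex [symmetric]) (auto simp: summable_on_def)
    show "(\<lambda>x. norm (F x)) summable_on {1..} \<times> {1..}"
    proof (rule summable_on_SigmaI)
      fix m :: nat
      have "((\<lambda>n. norm (mangoldt m * of_nat m powr (- w) :: complex) * norm (of_nat n powr (- w) :: complex)) has_sum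
          norm (mangoldt m * of_nat m powr (- w) :: complex) * infsum (\<lambda>n. norm (of_nat n powr (- w) :: complex)) {1..}) {1..}"
        using 1 by (intro has_sum_cmult_right has_sum_infsum)
      then show "((\<lambda>n. norm (F (m, n))) has_sum
          norm (mangoldt m * of_nat m powr (- w) :: complex) * infsum (\<lambda>n. norm (of_nat n powr (- w) :: complex)) {1..}) {1..}"
        by (simp add: F_def norm_mult)
      show "(\<lambda>m. norm (mangoldt m * of_nat m powr (- w) :: complex) * infsum (\<lambda>n. norm (of_nat n powr (- w) :: complex)) {1..}) summable_on {1..}"
        using 2 by (rule summable_on_cmult_left)
    qed simp
  qed
  have "(F has_sum mangoldt_series w * zeta w) ({1..} \<times> {1..})"
    by (rule has_sum_SigmaI [OF inner outer summ])
  \<comment> \<open>A pair \<open>(m, n)\<close> becomes the product \<open>l = m n\<close> together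
    with its divisor \<open>m\<close>.\<close>
  also have "?this \<longleftrightarrow> (F' has_sum mangoldt_series w * zeta w) (Sigma {1..} (\<lambda>l. {d. d dvd l}))"
  proof (rule has_sum_reindex_bij_witness [of _ "\<lambda>(l, d). (d, l div d)" "\<lambda>(m, n). (m * n, m)"])
    fix a :: "nat \<times> nat" assume "a \<in> {1..} \<times> {1..}"
    then show "F' (case a of (m, n) \<Rightarrow> (m * n, m)) = F a"
      by (auto simp: F_def F'_def of_nat_mult_powr mult.assoc)
  qed (auto simp: Suc_le_eq intro: dvd_div_eq_0_iff)
  finally have "(F' has_sum mangoldt_series w * zeta w) (Sigma {1..} (\<lambda>l. {d. d dvd l}))" .
  then have "((\<lambda>l. of_real (ln (real l)) * of_nat l powr (- w)) has_sum mangoldt_series w * zeta w) {1..}"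
  proof (rule has_sum_SigmaD)
    fix l :: nat assume l: "l \<in> {1..}"
    then have "finite {d. d dvd l}" by (intro finite_divisors_nat) auto
    moreover have "of_real (ln (real l)) * of_nat l powr (- w) = (\<Sum>d | d dvd l. F' (l, d))"
      using l mangoldt_sum [of l, where 'a = complex] by (simp add: F'_def sum_distrib_right [symmetric])
    ultimately show "((\<lambda>d. F' (l, d)) has_sum of_real (ln (real l)) * of_nat l powr (- w)) {d. d dvd l}"
      by (rule has_sum_finiteI)
  qed
  then have "(\<lambda>i. of_real (ln (real (Suc i))) * of_nat (Suc i) powr (- w)) sums (mangoldt_series w * zeta w)"
    unfolding has_sum_atLeast_1_iff by (rule has_sum_imp_sums)
  from sums_minus [OF this] have "- (mangoldt_series w * zeta w) = deriv zeta w"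
    using deriv_zeta_sums [OF w1] by (simp add: sums_unique2)
  then show ?thesis by (metis minus_minus)
qed

text \<open>The terms after the first have total modulus at most \<open>pi^2 / 6 - 1\<close>, which
  is below 1.\<close>

lemma zeta_nonzero:
  assumes "Re w \<ge> 2"
  shows "zeta w \<noteq> 0"
proof -
  have "(\<lambda>i. of_nat (Suc (i + 1)) powr (- w)) sums (zeta w - (\<Sum>i<1. of_nat (Suc i) powr (- w)))"
    using assms by (intro sums_split_initial_segment zeta_sums) auto
  then have 1: "(\<lambda>i. of_nat (Suc (i + 1)) powr (- w)) sums (zeta w - 1)"
    by simp
  have "(\<lambda>n. 1 / (real ((n + 1) + 1))\<^sup>2) sums (pi\<^sup>2 / 6 - (\<Sum>n<1. 1 / (real (n + 1))\<^sup>2))"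
    using inverse_squares_sums by (intro sums_split_initial_segment) simp
  then have 2: "(\<lambda>n. 1 / (real (Suc (n + 1)))\<^sup>2) sums (pi\<^sup>2 / 6 - 1)"
    by simp
  have "norm (zeta w - 1) \<le> pi\<^sup>2 / 6 - 1"
    unfolding sums_unique [OF 1] sums_unique [OF 2]
  proof (rule norm_suminf_le)
    fix n :: nat
    have "real (Suc (n + 1)) powr (- Re w) \<le> real (Suc (n + 1)) powr (- 2)"
      using assms by (intro powr_mono) auto
    also have "\<dots> = 1 / (real (Suc (n + 1)))\<^sup>2"
      by (simp add: powr_minus_divide del: of_nat_Suc)
    finally show "norm (of_nat (Suc (n + 1)) powr (- w) :: complex) \<le> 1 / (real (Suc (n + 1)))\<^sup>2"
      by (simp add: norm_of_nat_powr del: of_nat_Suc)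
  qed (use 2 in \<open>rule sums_summable\<close>)
  also have "pi\<^sup>2 \<le> 3.2\<^sup>2"
    using pi_approx by (intro power_mono) auto
  then have "pi\<^sup>2 / 6 - 1 < 1" by (simp add: power2_eq_square)
  finally show ?thesis by auto
qed

definition neg_log_deriv :: "complex \<Rightarrow> complex" where
  "neg_log_deriv w = - deriv zeta w / zeta w"

lemma mangoldt_series_eq:
  assumes "Re w > 2"
  shows "mangoldt_series w = neg_log_deriv w"
  using mangoldt_series_times_zeta [OF assms] zeta_nonzero [of w] assms
  by (simp add: neg_log_deriv_def field_simps)

text \<open>At 1 the expansion of order 1 shows \<open>zeta\<close> as \<open>1 / (s - 1)\<close>
  plus a holomorphic function. The point matters because shifted arguments of
  \<open>neg_log_deriv\<close> pass through it.\<close>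

lemma meromorphic_zeta: "zeta meromorphic_on UNIV"
proof (subst meromorphic_on_meromorphic_at, intro ballI)
  fix z :: complex
  show "zeta meromorphic_on {z}"
  proof (cases "z = 1")
    case False
    have "zeta analytic_on - {1}"
      by (rule iffD2 [OF analytic_on_open holomorphic_zeta]) (rule open_Compl, rule closed_singleton)
    then show ?thesis
      by (rule analytic_on_imp_meromorphic_on [OF analytic_on_subset]) (simp add: False)
  next
    case True
    let ?S = "{s. Re s > 0}"
    have "((\<lambda>s. em_rem 1 s 1) \<circ> (\<lambda>s. s + 1)) holomorphic_on ?S"
      by (rule holomorphic_on_compose_gen [OF _ holomorphic_em_rem]) (auto intro!: holomorphic_intros)
    then have "(\<lambda>s. 1 / 2 - s * em_rem 1 (s + 1) 1) holomorphic_on ?S"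
      by (auto simp: o_def intro!: holomorphic_intros)
    then have an: "(\<lambda>s. 1 / 2 - s * em_rem 1 (s + 1) 1) analytic_on {z}"
      by (rule analytic_on_subset [OF iffD2 [OF analytic_on_open [OF open_Re_gt]]]) (simp add: True)
    have 1: "(\<lambda>s. 1 / (s - 1) + (1 / 2 - s * em_rem 1 (s + 1) 1)) meromorphic_on {z}"
      by (intro meromorphic_on_add meromorphic_on_divide meromorphic_on_diff [OF meromorphic_on_id]
          meromorphic_on_const analytic_on_imp_meromorphic_on [OF an])
    have "\<forall>\<^sub>F s in at z. s \<in> ?S - {z}"
      using True by (intro eventually_at_in_open open_Re_gt) auto
    then have "\<forall>\<^sub>F s in at z. 1 / (s - 1) + (1 / 2 - s * em_rem 1 (s + 1) 1) = zeta s"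
    proof eventually_elim
      case (elim s)
      have "zeta s = zeta_em 1 s"
        using elim True by (intro zeta_eq) auto
      then show ?case
        unfolding zeta_em_def em_poly_at_1 by (simp add: bernp_Suc_0)
    qed
    then have "(\<lambda>s. 1 / (s - 1) + (1 / 2 - s * em_rem 1 (s + 1) 1)) meromorphic_on {z} \<longleftrightarrow> zeta meromorphic_on {z}"
      by (intro meromorphic_on_cong) simp_all
    with 1 show ?thesis by (rule iffD1 [rotated])
  qed
qed

lemma meromorphic_neg_log_deriv: "neg_log_deriv meromorphic_on A"
proof -
  have "neg_log_deriv meromorphic_on UNIV"
    unfolding neg_log_deriv_def [abs_def]
    by (intro meromorphic_on_divide meromorphic_on_uminus meromorphic_on_deriv meromorphic_zeta)
  then show ?thesis by (rule meromorphic_on_subset) simp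
qed

lemma neg_log_deriv_at_neg_even:
  assumes "n \<ge> 1"
  shows "\<exists>l. ((\<lambda>s. neg_log_deriv s + 1 / (s + 2 * of_nat n)) \<longlongrightarrow> l) (at (- 2 * of_nat n))"
proof -
  have "- 2 * of_nat n \<noteq> (1 :: complex)"
  proof
    assume "- 2 * of_nat n = (1 :: complex)"
    then have "Re (- 2 * of_nat n) = Re 1" by (simp only:)
    then show False by simp
  qed
  then obtain l where "((\<lambda>s. deriv zeta s / zeta s - 1 / (s - (- 2 * of_nat n))) \<longlongrightarrow> l) (at (- 2 * of_nat n))"
    using log_deriv_simple_zero [OF _ _ holomorphic_zeta zeta_neg_even [OF assms] deriv_zeta_neg_even [OF assms]]
    by auto
  from tendsto_minus [OF this] show ?thesis
    by (auto simp: neg_log_deriv_def algebra_simps)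
qed

lemma isCont_neg_log_deriv:
  assumes "w \<noteq> 1" "zeta w \<noteq> 0"
  shows "isCont neg_log_deriv w"
proof -
  have op: "open (- {1 :: complex})" by auto
  have "isCont zeta w" "isCont (deriv zeta) w"
    using assms(1) op holomorphic_zeta holomorphic_deriv [OF holomorphic_zeta op]
    by (auto simp: continuous_on_eq_continuous_at dest!: holomorphic_on_imp_continuous_on)
  then show ?thesis
    unfolding neg_log_deriv_def [abs_def] using assms(2) by (intro continuous_intros) auto
qed

section \<open>The line \<open>s1 = - 1\<close>\<close>

text \<open>Writing \<open>i = (i + m) - m\<close> turns the sum of
  \<open>i * (i + m) powr (- s)\<close> into a Hurwitz tail at \<open>s - 1\<close> minus
  \<open>m\<close> times one at \<open>s\<close>. This is the same combination of their
  remainders.\<close>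

definition tail_rem :: "nat \<Rightarrow> complex \<Rightarrow> nat \<Rightarrow> complex" where
  "tail_rem J s m = of_nat m * (pochhammer s J * em_rem J (s + of_nat J) m)
     - pochhammer (s - 1) J * em_rem J (s - 1 + of_nat J) m"

lemma pochhammer_diff_Suc:
  "pochhammer (s - 1) (Suc k) - pochhammer s (Suc k) = - of_nat (Suc k) * pochhammer (s :: complex) k"
  using pochhammer_rec [of "s - 1" k] by (simp add: pochhammer_Suc algebra_simps)

lemma of_nat_times_powr:
  assumes "m > 0"
  shows "of_nat m * of_nat m powr s = (of_nat m powr (s + 1) :: complex)"
  using assms by (simp add: powr_add mult.commute)

text \<open>The powers of \<open>m\<close> match, so only coefficients are compared: the leading
  ones give \<open>1 / (s - 2) - 1 / (s - 1)\<close>, and the others give the factor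
  \<open>j - 1\<close> through \<open>pochhammer_diff_Suc\<close>.\<close>

lemma em_poly_shift_diff:
  assumes m: "m \<ge> 1" and s: "s \<noteq> 1" "s \<noteq> 2" and J: "J \<ge> 1"
  shows "em_poly J (s - 1) m - of_nat m * em_poly J s m =
     of_nat m powr (2 - s) / ((s - 1) * (s - 2))
     - (\<Sum>j=2..J. of_nat (j - 1) * of_real (bern j) * pochhammer s (j - 2) * of_nat m powr (2 - s - of_nat j))"
proof -
  have "em_poly J (s - 1) m - of_nat m * em_poly J s m =
      of_nat m powr (2 - s) * (1 / (s - 2) - 1 / (s - 1)) +
      (\<Sum>j=1..J. of_real (bernp j 1) * (pochhammer (s - 1) (j - 1) - pochhammer s (j - 1))
         * of_nat m powr (2 - s - of_nat j))"
  proof -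
    have 1: "of_nat m * em_poly J s m = of_nat m powr (2 - s) / (s - 1) +
      (\<Sum>j=1..J. of_real (bernp j 1) * pochhammer s (j - 1) * of_nat m powr (2 - s - of_nat j))"
    proof -
      have "of_nat m * of_nat m powr (1 - s - of_nat j) = (of_nat m powr (2 - s - of_nat j) :: complex)" for j
        using of_nat_times_powr [of m "1 - s - of_nat j"] m by (simp add: algebra_simps)
      then have *: "of_nat m * (c * of_nat m powr (1 - s - of_nat j)) = c * (of_nat m powr (2 - s - of_nat j) :: complex)" for j c
        by (metis mult.left_commute)
      show ?thesis
        using of_nat_times_powr [of m "1 - s"] m
        by (simp add: em_poly_def distrib_left sum_distrib_left *)
    qed
    have 2: "em_poly J (s - 1) m = of_nat m powr (2 - s) / (s - 2) +
      (\<Sum>j=1..J. of_real (bernp j 1) * pochhammer (s - 1) (j - 1) * of_nat m powr (2 - s - of_nat j))"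
      by (simp add: em_poly_def algebra_simps)
    have 3: "(\<Sum>j=1..J. of_real (bernp j 1) * (pochhammer (s - 1) (j - 1) - pochhammer s (j - 1)) * of_nat m powr (2 - s - of_nat j)) =
      (\<Sum>j=1..J. of_real (bernp j 1) * pochhammer (s - 1) (j - 1) * of_nat m powr (2 - s - of_nat j)) -
      (\<Sum>j=1..J. of_real (bernp j 1) * pochhammer s (j - 1) * of_nat m powr (2 - s - of_nat j))"
      by (simp only: sum_subtractf [symmetric] right_diff_distrib left_diff_distrib)
    show ?thesis unfolding 1 2 3 by (simp add: right_diff_distrib)
  qed
  also have "1 / (s - 2) - 1 / (s - 1) = 1 / ((s - 1) * (s - 2))"
    using s by (simp add: divide_simps)
  also have "(\<Sum>j=1..J. of_real (bernp j 1) * (pochhammer (s - 1) (j - 1) - pochhammer s (j - 1))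
         * of_nat m powr (2 - s - of_nat j)) =
       (\<Sum>j=2..J. - (of_nat (j - 1) * of_real (bern j) * pochhammer s (j - 2) * of_nat m powr (2 - s - of_nat j)))"
  proof -
    \<comment> \<open>For \<open>j = 1\<close> both Pochhammer symbols are empty products, so the
      term drops out.\<close>
    have "{1..J} = insert 1 {2..J}" using J by auto
    then have "(\<Sum>j=1..J. of_real (bernp j 1) * (pochhammer (s - 1) (j - 1) - pochhammer s (j - 1))
         * of_nat m powr (2 - s - of_nat j)) =
       (\<Sum>j=2..J. of_real (bernp j 1) * (pochhammer (s - 1) (j - 1) - pochhammer s (j - 1))
         * of_nat m powr (2 - s - of_nat j))"
      by simp
    also have "\<dots> = (\<Sum>j=2..J. - (of_nat (j - 1) * of_real (bern j) * pochhammer s (j - 2) * of_nat m powr (2 - s - of_nat j)))"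
    proof (rule sum.cong)
      fix j assume j: "j \<in> {2..J}"
      then have "j - 1 = Suc (j - 2)" by auto
      then have "pochhammer (s - 1) (j - 1) - pochhammer s (j - 1) = - of_nat (j - 1) * pochhammer s (j - 2)"
        using pochhammer_diff_Suc [of s "j - 2"] by simp
      then show "of_real (bernp j 1) * (pochhammer (s - 1) (j - 1) - pochhammer s (j - 1)) * of_nat m powr (2 - s - of_nat j) =
          - (of_nat (j - 1) * of_real (bern j) * pochhammer s (j - 2) * of_nat m powr (2 - s - of_nat j))"
        using j by (simp add: bernp_at_1)
    qed simp
    finally show ?thesis .
  qed
  finally show ?thesis by (simp add: sum_negf)
qed

lemma tail_sums:
  assumes s: "Re s > 2" and m: "m \<ge> 1" and J: "J \<ge> 1"
  shows "(\<lambda>i. of_nat i * of_nat (i + m) powr (- s)) sums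
     (of_nat m powr (2 - s) / ((s - 1) * (s - 2))
     - (\<Sum>j=2..J. of_nat (j - 1) * of_real (bern j) * pochhammer s (j - 2) * of_nat m powr (2 - s - of_nat j))
     + tail_rem J s m)"
proof -
  have ne: "s \<noteq> 1" "s \<noteq> 2" using s by auto
  have "of_nat i * of_nat (i + m) powr (- s) =
      of_nat (i + m) powr (- (s - 1)) - of_nat m * (of_nat (i + m) powr (- s) :: complex)" for i
    using of_nat_times_powr [of "i + m" "- s"] m by (simp add: algebra_simps)
  moreover have "(\<lambda>i. of_nat (i + m) powr (- (s - 1)) - of_nat m * (of_nat (i + m) powr (- s) :: complex)) sums
      ((em_poly J (s - 1) m - pochhammer (s - 1) J * em_rem J (s - 1 + of_nat J) m)
       - of_nat m * (em_poly J s m - pochhammer s J * em_rem J (s + of_nat J) m))"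
    using assms by (intro sums_diff sums_mult hurwitz_sums) auto
  moreover have "(em_poly J (s - 1) m - pochhammer (s - 1) J * em_rem J (s - 1 + of_nat J) m)
       - of_nat m * (em_poly J s m - pochhammer s J * em_rem J (s + of_nat J) m) =
      (em_poly J (s - 1) m - of_nat m * em_poly J s m) + tail_rem J s m"
    by (simp add: tail_rem_def algebra_simps)
  ultimately show ?thesis
    using em_poly_shift_diff [OF m ne J] by simp
qed

definition rem_series :: "nat \<Rightarrow> complex \<Rightarrow> complex" where
  "rem_series J s = (\<Sum>i. mangoldt (Suc i) * tail_rem J s (Suc i))"

text \<open>This fixes the abscissa \<open>6 - J\<close>. The exponents \<open>s + J\<close> and
  \<open>s - 1 + J\<close> have real parts at least 6 and 5, so the remainders are of order
  \<open>m powr - 4\<close> and \<open>m powr - 3\<close>; the first is multiplied by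
  \<open>m\<close>, and \<open>\<Lambda>(m) \<le> m\<close> leaves the summable
  \<open>m powr - 2\<close>.\<close>

lemma norm_tail_rem_le:
  assumes "Re s \<ge> 6 - real J" "m \<ge> 1"
  shows "norm (mangoldt m * tail_rem J s m) \<le>
    (norm (pochhammer s J) + norm (pochhammer (s - 1) J)) * em_const J * real m powr - 2"
proof -
  have e1: "norm (em_rem J (s + of_nat J) m) \<le> em_const J * real m powr - 4"
  proof -
    have "norm (em_rem J (s + of_nat J) m) \<le> em_const J * real m powr (2 - Re (s + of_nat J))"
      using assms by (intro norm_em_rem_le) auto
    also have "\<dots> \<le> em_const J * real m powr - 4"
      using assms by (intro mult_left_mono powr_mono em_const_nonneg) auto
    finally show ?thesis .
  qed
  have e2: "norm (em_rem J (s - 1 + of_nat J) m) \<le> em_const J * real m powr - 3"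
  proof -
    have "norm (em_rem J (s - 1 + of_nat J) m) \<le> em_const J * real m powr (2 - Re (s - 1 + of_nat J))"
      using assms by (intro norm_em_rem_le) auto
    also have "\<dots> \<le> em_const J * real m powr - 3"
      using assms by (intro mult_left_mono powr_mono em_const_nonneg) auto
    finally show ?thesis .
  qed
  have p: "real m * real m powr - 4 = real m powr - 3" "real m * real m powr - 3 = real m powr - 2"
    using assms by (simp_all add: powr_mult_base)
  have "norm (tail_rem J s m) \<le> real m * (norm (pochhammer s J) * (em_const J * real m powr - 4))
      + norm (pochhammer (s - 1) J) * (em_const J * real m powr - 3)"
    unfolding tail_rem_def
    by (rule order_trans [OF norm_triangle_ineq4])
       (auto simp: norm_mult intro!: add_mono mult_left_mono e1 e2)
  also have "\<dots> = (norm (pochhammer s J) + norm (pochhammer (s - 1) J)) * em_const J * real m powr - 3"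
    unfolding p(1) [symmetric] by (simp add: algebra_simps)
  finally have "norm (tail_rem J s m) \<le> (norm (pochhammer s J) + norm (pochhammer (s - 1) J)) * em_const J * real m powr - 3" .
  then have "real m * norm (tail_rem J s m) \<le>
      real m * ((norm (pochhammer s J) + norm (pochhammer (s - 1) J)) * em_const J * real m powr - 3)"
    by (rule mult_left_mono) simp
  also have "\<dots> = (norm (pochhammer s J) + norm (pochhammer (s - 1) J)) * em_const J * real m powr - 2"
    unfolding p(2) [symmetric] by (simp add: mult_ac)
  finally show ?thesis
    using norm_mangoldt_term_le [of m "tail_rem J s m"] assms by linarith
qed

lemma rem_series_sums:
  assumes "Re s \<ge> 6 - real J"
  shows "(\<lambda>i. mangoldt (Suc i) * tail_rem J s (Suc i)) sums rem_series J s"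
  unfolding rem_series_def
proof (rule summable_sums, rule summable_norm_cancel, rule summable_comparison_test')
  show "summable (\<lambda>i. (norm (pochhammer s J) + norm (pochhammer (s - 1) J)) * em_const J * real (i + 1) powr - 2)"
    by (intro summable_mult summable_shift_powr) auto
  show "norm (norm (mangoldt (Suc i) * tail_rem J s (Suc i))) \<le>
      (norm (pochhammer s J) + norm (pochhammer (s - 1) J)) * em_const J * real (i + 1) powr - 2" for i
    using norm_tail_rem_le [OF assms, of "Suc i"] by simp
qed

lemma holomorphic_tail_rem:
  assumes "m \<ge> 1"
  shows "(\<lambda>s. tail_rem J s m) holomorphic_on {s. Re s > 6 - real J}"
proof -
  have "((\<lambda>s. em_rem J s m) \<circ> (\<lambda>s. s + of_nat J)) holomorphic_on {s. Re s > 6 - real J}"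
    by (rule holomorphic_on_compose_gen [OF _ holomorphic_em_rem [OF assms]]) (auto intro!: holomorphic_intros)
  moreover have "((\<lambda>s. em_rem J s m) \<circ> (\<lambda>s. s - 1 + of_nat J)) holomorphic_on {s. Re s > 6 - real J}"
    by (rule holomorphic_on_compose_gen [OF _ holomorphic_em_rem [OF assms]]) (auto intro!: holomorphic_intros)
  ultimately show ?thesis
    unfolding tail_rem_def pochhammer_prod o_def by (intro holomorphic_intros) auto
qed

lemma holomorphic_rem_series: "rem_series J holomorphic_on {s. Re s > 6 - real J}"
  unfolding rem_series_def [abs_def]
proof (rule holomorphic_suminf(1))
  show "open {s. Re s > 6 - real J}" by (rule open_Re_gt)
  show "(\<lambda>s. mangoldt (Suc i) * tail_rem J s (Suc i)) holomorphic_on {s. Re s > 6 - real J}" for i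
    by (intro holomorphic_intros holomorphic_tail_rem) simp
  fix x assume "x \<in> {s. Re s > 6 - real J}"
  define p where "p = (\<lambda>s. norm (pochhammer s J) + norm (pochhammer (s - 1) J :: complex))"
  have "continuous_on (cball x 1) p"
    unfolding p_def pochhammer_prod by (intro continuous_intros)
  then have "compact (p ` cball x 1)" by (intro compact_continuous_image compact_cball)
  then have "bounded (p ` cball x 1)" by (rule compact_imp_bounded)
  then obtain B where B: "\<And>y. y \<in> cball x 1 \<Longrightarrow> norm (p y) \<le> B"
    unfolding bounded_iff by blast
  have "norm (mangoldt (Suc i) * tail_rem J y (Suc i)) \<le> B * em_const J * real (i + 1) powr - 2"
    if "y \<in> ball x 1 \<inter> {s. Re s > 6 - real J}" for y i
  proof -
    have "norm (mangoldt (Suc i) * tail_rem J y (Suc i)) \<le> p y * em_const J * real (Suc i) powr - 2"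
      unfolding p_def using that by (intro norm_tail_rem_le) auto
    also have "p y \<le> B" using B [of y] that by auto
    then have "p y * em_const J * real (Suc i) powr - 2 \<le> B * em_const J * real (Suc i) powr - 2"
      by (intro mult_right_mono em_const_nonneg) auto
    finally show ?thesis by simp
  qed
  moreover have "summable (\<lambda>i. B * em_const J * real (i + 1) powr - 2)"
    by (intro summable_mult summable_shift_powr) auto
  ultimately show "\<exists>d>0. \<exists>h. summable h \<and> (\<forall>n. \<forall>y\<in>ball x d \<inter> {s. Re s > 6 - real J}.
      norm (mangoldt (Suc n) * tail_rem J y (Suc n)) \<le> h n)"
    using zero_less_one by blast
qed

definition continuation :: "nat \<Rightarrow> complex \<Rightarrow> complex" where
  "continuation J s = neg_log_deriv (s - 2) / ((s - 1) * (s - 2))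
     - (\<Sum>j=2..J. of_nat (j - 1) * of_real (bern j) * pochhammer s (j - 2) * neg_log_deriv (s - 2 + of_nat j))
     + rem_series J s"

lemma meromorphic_continuation: "continuation J meromorphic_on {s. Re s > 6 - real J}"
proof -
  have *: "(\<lambda>s. neg_log_deriv (s + c)) meromorphic_on A" for c A
    by (rule meromorphic_on_compose [OF meromorphic_neg_log_deriv [of UNIV]]) (auto intro!: analytic_intros)
  have 1: "rem_series J meromorphic_on {s. Re s > 6 - real J}"
    using holomorphic_rem_series by (intro analytic_on_imp_meromorphic_on) (simp add: analytic_on_open open_Re_gt)
  have 2: "(\<lambda>s. neg_log_deriv (s - 2)) meromorphic_on A" for A
    using * [of "- 2" A] by simp
  have 3: "(\<lambda>s. neg_log_deriv (s - 2 + of_nat j)) meromorphic_on A" for j A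
    using * [of "- 2 + of_nat j" A] by (simp add: algebra_simps)
  show ?thesis
    unfolding continuation_def [abs_def] pochhammer_prod
    by (intro meromorphic_on_add meromorphic_on_diff meromorphic_on_divide meromorphic_on_mult
        meromorphic_on_sum meromorphic_on_prod meromorphic_on_const meromorphic_on_id 1 2 3)
qed

section \<open>The double series for large \<open>Re s2\<close>\<close>

definition Phi2_term :: "complex \<Rightarrow> complex \<Rightarrow> nat \<times> nat \<Rightarrow> complex" where
  "Phi2_term s1 s2 = (\<lambda>(m1, m2). mangoldt m2 / (of_nat m1 powr s1 * of_nat (m1 + m2) powr s2))"

text \<open>The region contains a neighbourhood of \<open>- 1\<close> in \<open>s1\<close>. Seven
  powers of \<open>m1 + m2\<close> are split into four of \<open>m1\<close> and three of
  \<open>m2\<close>; the factors \<open>m1 powr 2\<close> and \<open>\<Lambda>(m2) \<le> m2\<close>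
  then leave exponent \<open>- 2\<close> in each variable.\<close>

lemma norm_Phi2_term_le:
  assumes "Re s1 \<ge> - 2" "Re s2 \<ge> 10" "p \<in> {1..} \<times> {1..}"
  shows "norm (Phi2_term s1 s2 p) \<le> (case p of (m1, m2) \<Rightarrow> real m1 powr - 2 * real m2 powr - 2)"
proof -
  obtain m1 m2 where p: "p = (m1, m2)" "m1 \<ge> 1" "m2 \<ge> 1" using assms(3) by auto
  have "Phi2_term s1 s2 p = mangoldt m2 * (of_nat m1 powr (- s1) * of_nat (m1 + m2) powr (- s2))"
    by (simp add: Phi2_term_def p powr_minus_divide)
  also have "norm \<dots> \<le> real m2 * norm (of_nat m1 powr (- s1) * of_nat (m1 + m2) powr (- s2) :: complex)"
    using p by (intro norm_mangoldt_term_le) auto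
  also have "\<dots> = real m2 * (real m1 powr (- Re s1) * real (m1 + m2) powr (- Re s2))"
    by (simp only: norm_mult norm_of_nat_powr uminus_complex.sel)
  also have "\<dots> \<le> real m2 * (real m1 powr 2 * real (m1 + m2) powr (- 4 + - 3))"
    using assms p by (intro mult_left_mono mult_mono powr_mono) auto
  also have "\<dots> = real m2 * (real m1 powr 2 * (real (m1 + m2) powr - 4 * real (m1 + m2) powr - 3))"
    by (simp only: powr_add)
  also have "\<dots> \<le> real m2 * (real m1 powr 2 * (real m1 powr - 4 * real m2 powr - 3))"
    using p by (intro mult_left_mono mult_mono powr_mono2') auto
  also have "\<dots> = (real m1 powr 2 * real m1 powr - 4) * (real m2 powr 1 * real m2 powr - 3)"
    using p by simp
  also have "\<dots> = real m1 powr - 2 * real m2 powr - 2"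
    by (simp only: powr_add [symmetric]) simp
  finally show ?thesis by (simp add: p)
qed

lemma summable_on_product_bound:
  "(\<lambda>(m1, m2). real m1 powr - 2 * real m2 powr - 2) summable_on {1..} \<times> {1..}"
proof -
  have "((\<lambda>i. real (Suc i) powr - 2) has_sum suminf (\<lambda>i. real (Suc i) powr - 2)) UNIV"
    using summable_shift_powr [of "- 2" 1] by (intro norm_summable_imp_has_sum summable_sums) simp_all
  then have 1: "((\<lambda>m. real m powr - 2) has_sum suminf (\<lambda>i. real (Suc i) powr - 2)) {1..}"
    by (simp only: has_sum_atLeast_1_iff)
  show ?thesis
  proof (rule summable_on_SigmaI)
    fix m :: nat
    show "((\<lambda>y. case (m, y) of (m1, m2) \<Rightarrow> real m1 powr - 2 * real m2 powr - 2) has_sum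
        real m powr - 2 * suminf (\<lambda>i. real (Suc i) powr - 2)) {1..}"
      using has_sum_cmult_right [OF 1] by simp
    show "(\<lambda>m. real m powr - 2 * suminf (\<lambda>i. real (Suc i) powr - 2)) summable_on {1..}"
      using 1 by (intro summable_on_cmult_left) (auto simp: summable_on_def)
  qed auto
qed

lemma summable_Phi2_term:
  assumes "Re s1 \<ge> - 2" "Re s2 \<ge> 10"
  shows "Phi2_term s1 s2 summable_on {1..} \<times> {1..}"
  by (rule abs_summable_summable)
     (rule Infinite_Sum.abs_summable_on_comparison_test' [OF summable_on_product_bound norm_Phi2_term_le [OF assms]])

lemma Phi2_series_eq_infsum:
  assumes "Re s1 \<ge> - 2" "Re s2 \<ge> 10"
  shows "Phi2_series s1 s2 = infsum (Phi2_term s1 s2) ({1..} \<times> {1..})"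
  using infsum_Sigma_banach [OF summable_Phi2_term [OF assms]]
  by (simp add: Phi2_series_def Phi2_term_def)

lemma Phi2_series_tendsto:
  assumes "Re s2 \<ge> 10"
  shows "((\<lambda>s1. Phi2_series s1 s2) \<longlongrightarrow> Phi2_series (- 1) s2) (at (- 1))"
proof -
  let ?B = "ball (- 1) 1 :: complex set"
  have Re: "Re s1 \<ge> - 2" if "s1 \<in> ?B" for s1
    using Re_ge_in_ball [OF that] by simp
  have "uniform_limit ?B (\<lambda>X s1. \<Sum>p\<in>X. Phi2_term s1 s2 p)
      (\<lambda>s1. infsum (\<lambda>p. Phi2_term s1 s2 p) ({1..} \<times> {1..})) (finite_subsets_at_top ({1..} \<times> {1..}))"
    by (rule Weierstrass_m_test_general [OF norm_Phi2_term_le summable_on_product_bound])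
       (use Re assms in auto)
  then have "continuous_on ?B (\<lambda>s1. infsum (\<lambda>p. Phi2_term s1 s2 p) ({1..} \<times> {1..}))"
  proof (rule uniform_limit_theorem [rotated])
    have "\<forall>\<^sub>F X in finite_subsets_at_top ({1..} \<times> {1..}). X \<subseteq> {1..} \<times> {1 :: nat..}"
      by (rule eventually_finite_subsets_at_top_weakI)
    then show "\<forall>\<^sub>F X in finite_subsets_at_top ({1..} \<times> {1..}). continuous_on ?B (\<lambda>s1. \<Sum>p\<in>X. Phi2_term s1 s2 p)"
    proof eventually_elim
      case (elim X)
      show ?case
      proof (rule continuous_on_sum)
        fix p assume "p \<in> X"
        then obtain m1 m2 where p: "p = (m1, m2)" "m1 > 0" "m2 > 0" using elim by force
        have "of_nat (m1 + m2) \<noteq> (0 :: complex)" using p by (simp only: of_nat_eq_0_iff)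
        then show "continuous_on ?B (\<lambda>s1. Phi2_term s1 s2 p)"
          unfolding Phi2_term_def p prod.case of_nat_powr_eq_exp [OF p(2)]
          by (intro continuous_intros) auto
      qed
    qed
  qed simp
  then have "isCont (\<lambda>s1. infsum (\<lambda>p. Phi2_term s1 s2 p) ({1..} \<times> {1..})) (- 1)"
    by (simp add: continuous_on_eq_continuous_at)
  then have "((\<lambda>s1. infsum (\<lambda>p. Phi2_term s1 s2 p) ({1..} \<times> {1..})) \<longlongrightarrow> Phi2_series (- 1) s2) (at (- 1))"
    using assms by (simp add: isCont_def Phi2_series_eq_infsum)
  moreover have "\<forall>\<^sub>F s1 in at (- 1). infsum (\<lambda>p. Phi2_term s1 s2 p) ({1..} \<times> {1..}) = Phi2_series s1 s2"
  proof -
    have "\<forall>\<^sub>F s1 in at (- 1). s1 \<in> ?B"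
      by (intro eventually_at_in_open') auto
    then show ?thesis
      by eventually_elim (use Re assms in \<open>simp add: Phi2_series_eq_infsum\<close>)
  qed
  ultimately show ?thesis using tendsto_cong by fast
qed

text \<open>Absolute convergence permits summation over \<open>m1\<close> first. The tail expansion
  then leaves powers of \<open>m2\<close>, each of which sums against \<Lambda> to a shifted
  \<open>neg_log_deriv\<close>.\<close>

lemma Phi2_series_eq_continuation:
  assumes s: "Re s \<ge> 10" and J: "J \<ge> 1"
  shows "Phi2_series (- 1) s = continuation J s"
proof -
  define q where "q = (\<lambda>m. of_nat m powr (2 - s) / ((s - 1) * (s - 2))
     - (\<Sum>j=2..J. of_nat (j - 1) * of_real (bern j) * pochhammer s (j - 2) * of_nat m powr (2 - s - of_nat j))
     + tail_rem J s m)"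
  have summ: "Phi2_term (- 1) s summable_on {1..} \<times> {1..}"
    using s by (intro summable_Phi2_term) auto
  have inner: "((\<lambda>m1. Phi2_term (- 1) s (m1, m2)) has_sum mangoldt m2 * q m2) {1..}" if m2: "m2 \<ge> 1" for m2
  proof -
    have "(\<lambda>i. of_nat i * of_nat (i + m2) powr (- s)) sums q m2"
      unfolding q_def using s J m2 by (intro tail_sums) auto
    \<comment> \<open>The tail sum starts at \<open>i = 0\<close>, the double series at
      \<open>m1 = 1\<close>; the dropped term is 0.\<close>
    then have "(\<lambda>i. of_nat (i + 1) * of_nat (i + 1 + m2) powr (- s)) sums (q m2 - (\<Sum>i<1. of_nat i * of_nat (i + m2) powr (- s)))"
      by (rule sums_split_initial_segment)
    then have 1: "(\<lambda>i. mangoldt m2 * (of_nat (Suc i) * of_nat (Suc i + m2) powr (- s))) sums (mangoldt m2 * q m2)"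
      by (intro sums_mult) simp
    have eq: "Phi2_term (- 1) s (Suc i, m2) = mangoldt m2 * (of_nat (Suc i) * of_nat (Suc i + m2) powr (- s))" for i
      by (simp add: Phi2_term_def powr_minus divide_inverse del: of_nat_Suc of_nat_add)
    have "(\<lambda>m1. Phi2_term (- 1) s (m1, m2)) summable_on {1..}"
    proof -
      have "(\<lambda>(m2, m1). Phi2_term (- 1) s (m1, m2)) summable_on {1..} \<times> {1..}"
        using summ summable_on_swap by fastforce
      then show ?thesis
        using summable_on_SigmaD1 m2 by fastforce
    qed
    then obtain L where L: "((\<lambda>m1. Phi2_term (- 1) s (m1, m2)) has_sum L) {1..}"
      by (auto simp: summable_on_def)
    then have "(\<lambda>i. Phi2_term (- 1) s (Suc i, m2)) sums L"
      unfolding has_sum_atLeast_1_iff by (rule has_sum_imp_sums)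
    then have "L = mangoldt m2 * q m2" using 1 unfolding eq by (rule sums_unique2)
    with L show ?thesis by simp
  qed
  have "((\<lambda>(m2, m1). Phi2_term (- 1) s (m1, m2)) has_sum Phi2_series (- 1) s) ({1..} \<times> {1..})"
  proof -
    have "(Phi2_term (- 1) s has_sum Phi2_series (- 1) s) ({1..} \<times> {1..})"
      using summ Phi2_series_eq_infsum [of "- 1" s] s by simp
    then show ?thesis by (subst (asm) has_sum_swap)
  qed
  then have "((\<lambda>m2. mangoldt m2 * q m2) has_sum Phi2_series (- 1) s) {1..}"
    by (rule has_sum_SigmaD) (use inner in auto)
  then have A: "(\<lambda>i. mangoldt (Suc i) * q (Suc i)) sums Phi2_series (- 1) s"
    unfolding has_sum_atLeast_1_iff by (rule has_sum_imp_sums)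
  define c where "c = (\<lambda>j. of_nat (j - 1) * of_real (bern j) * pochhammer s (j - 2))"
  have M: "(\<lambda>i. mangoldt (Suc i) * of_nat (Suc i) powr (2 - s - of_nat j)) sums neg_log_deriv (s - 2 + of_nat j)" for j
    using mangoldt_series_sums [of "s - 2 + of_nat j"] mangoldt_series_eq [of "s - 2 + of_nat j"] s
    by (simp add: algebra_simps)
  \<comment> \<open>Writing the leading power with \<open>of_nat 0\<close> lets the fact
    \<open>M\<close> serve it as the case \<open>j = 0\<close>.\<close>
  have "(\<lambda>i. 1 / ((s - 1) * (s - 2)) * (mangoldt (Suc i) * of_nat (Suc i) powr (2 - s - of_nat 0))
       - (\<Sum>j=2..J. c j * (mangoldt (Suc i) * of_nat (Suc i) powr (2 - s - of_nat j)))
       + mangoldt (Suc i) * tail_rem J s (Suc i)) sums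
      (1 / ((s - 1) * (s - 2)) * neg_log_deriv (s - 2 + of_nat 0) - (\<Sum>j=2..J. c j * neg_log_deriv (s - 2 + of_nat j))
       + rem_series J s)"
    using s by (intro sums_add sums_diff sums_mult sums_sum M rem_series_sums) auto
  also have "(\<lambda>i. 1 / ((s - 1) * (s - 2)) * (mangoldt (Suc i) * of_nat (Suc i) powr (2 - s - of_nat 0))
       - (\<Sum>j=2..J. c j * (mangoldt (Suc i) * of_nat (Suc i) powr (2 - s - of_nat j)))
       + mangoldt (Suc i) * tail_rem J s (Suc i)) = (\<lambda>i. mangoldt (Suc i) * q (Suc i))"
    unfolding q_def c_def
    by (simp add: algebra_simps sum_distrib_left del: of_nat_Suc)
  also have "1 / ((s - 1) * (s - 2)) * neg_log_deriv (s - 2 + of_nat 0) - (\<Sum>j=2..J. c j * neg_log_deriv (s - 2 + of_nat j))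
       + rem_series J s = continuation J s"
    by (simp add: continuation_def c_def)
  finally show ?thesis using A sums_unique2 by blast
qed

section \<open>Polar parts and reverse values\<close>

text \<open>At most a simple pole, with residue \<open>c\<close>. Formulated by a limit, the notion
  ignores the value at \<open>u\<close>, and \<open>c = 0\<close> means exactly that a finite limit
  exists.\<close>

definition polar_part :: "(complex \<Rightarrow> complex) \<Rightarrow> complex \<Rightarrow> complex \<Rightarrow> bool" where
  "polar_part f u c \<longleftrightarrow> (\<exists>l. ((\<lambda>s. f s - c / (s - u)) \<longlongrightarrow> l) (at u))"

lemma polar_part_isCont:
  assumes "isCont f u"
  shows "polar_part f u 0"
  using assms by (auto simp: polar_part_def isCont_def)

lemma polar_part_add:
  assumes "polar_part f u c" "polar_part g u d"
  shows "polar_part (\<lambda>s. f s + g s) u (c + d)"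
proof -
  obtain k l where "((\<lambda>s. f s - c / (s - u)) \<longlongrightarrow> k) (at u)" "((\<lambda>s. g s - d / (s - u)) \<longlongrightarrow> l) (at u)"
    using assms by (auto simp: polar_part_def)
  from tendsto_add [OF this] show ?thesis
    unfolding polar_part_def by (auto simp: add_divide_distrib algebra_simps)
qed

lemma polar_part_sum:
  assumes "\<And>j. j \<in> A \<Longrightarrow> polar_part (f j) u (c j)"
  shows "polar_part (\<lambda>s. \<Sum>j\<in>A. f j s) u (\<Sum>j\<in>A. c j)"
  using assms
proof (induction A rule: infinite_finite_induct)
  case (insert j A)
  then show ?case
    using polar_part_add [of "f j" u "c j" "\<lambda>s. \<Sum>j\<in>A. f j s" "\<Sum>j\<in>A. c j"] by simp
qed (auto intro!: polar_part_isCont)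

text \<open>Replacing \<open>T s\<close> by \<open>T u\<close> in the polar term costs
  \<open>c * (T s - T u) / (s - u)\<close>, which converges because \<open>T\<close> is
  differentiable at \<open>u\<close>.\<close>

lemma polar_part_mult:
  assumes T: "T field_differentiable (at u)" and f: "polar_part f u c"
  shows "polar_part (\<lambda>s. T s * f s) u (T u * c)"
proof -
  obtain l where l: "((\<lambda>s. f s - c / (s - u)) \<longlongrightarrow> l) (at u)"
    using f by (auto simp: polar_part_def)
  obtain D where D: "(T has_field_derivative D) (at u)"
    using T by (auto simp: field_differentiable_def)
  have "(T \<longlongrightarrow> T u) (at u)"
    using DERIV_isCont [OF D] by (simp add: isCont_def)
  moreover have "((\<lambda>s. (T s - T u) / (s - u)) \<longlongrightarrow> D) (at u)"
    using D by (simp add: has_field_derivative_iff)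
  ultimately have "((\<lambda>s. T s * (f s - c / (s - u)) + c * ((T s - T u) / (s - u))) \<longlongrightarrow> T u * l + c * D) (at u)"
    using l by (intro tendsto_intros)
  moreover have "T s * (f s - c / (s - u)) + c * ((T s - T u) / (s - u)) = T s * f s - T u * c / (s - u)" for s
    by (simp add: diff_divide_distrib right_diff_distrib mult.commute)
  ultimately show ?thesis unfolding polar_part_def by auto
qed

lemma polar_part_shift:
  assumes "polar_part f (u + a) c"
  shows "polar_part (\<lambda>s. f (s + a)) u c"
proof -
  obtain l where "((\<lambda>s. f s - c / (s - (u + a))) \<longlongrightarrow> l) (at (u + a))"
    using assms by (auto simp: polar_part_def)
  from LIM_offset [OF this, of a] show ?thesis
    unfolding polar_part_def by (auto simp: algebra_simps)
qed

lemma polar_part_cong: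
  assumes "\<forall>\<^sub>F s in at u. f s = g s"
  shows "polar_part f u c \<longleftrightarrow> polar_part g u c"
proof -
  have "\<forall>\<^sub>F s in at u. f s - c / (s - u) = g s - c / (s - u)"
    using assms by (auto elim: eventually_mono)
  then show ?thesis unfolding polar_part_def using tendsto_cong by fast
qed

lemma polar_part_0_iff: "polar_part f u 0 \<longleftrightarrow> (\<exists>l. (f \<longlongrightarrow> l) (at u))"
  by (simp add: polar_part_def)

lemma polar_part_unique:
  assumes "polar_part f u c" "polar_part f u d"
  shows "c = d"
proof -
  obtain k l where "((\<lambda>s. f s - c / (s - u)) \<longlongrightarrow> k) (at u)" "((\<lambda>s. f s - d / (s - u)) \<longlongrightarrow> l) (at u)"
    using assms by (auto simp: polar_part_def)
  from tendsto_diff [OF this]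
  have "((\<lambda>s. (d - c) / (s - u)) \<longlongrightarrow> k - l) (at u)"
    by (simp add: diff_divide_distrib)
  then have "((\<lambda>s. (d - c) / (s - u) * (s - u)) \<longlongrightarrow> (k - l) * (u - u)) (at u)"
    by (intro tendsto_intros)
  moreover have "\<forall>\<^sub>F s in at u. (d - c) / (s - u) * (s - u) = d - c"
    by (rule eventually_mono [OF eventually_at_in_open [of UNIV u]]) auto
  ultimately have "((\<lambda>s. d - c) \<longlongrightarrow> 0) (at u)"
    using tendsto_cong by fastforce
  then show ?thesis by (simp add: tendsto_const_iff)
qed

text \<open>The common value of the residue at \<open>- 2 N\<close> and of
  \<open>- R(-1,-2N)\<close>, in the form to which \<open>sum_bern_weighted\<close> applies with
  \<open>n = 2 N + 2\<close>.\<close>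

definition reverse_residue :: "nat \<Rightarrow> real" where
  "reverse_residue N = fact (2 * N) * (\<Sum>j<2 * N + 2. (real j - 1) * bern j / fact (2 * N + 2 - j))"

lemma reverse_residue_eq:
  "reverse_residue N = (if N \<ge> 1 then 0 else - 1 / 2)"
proof (cases "N \<ge> 1")
  case True
  then show ?thesis using sum_bern_weighted [of "2 * N + 2"] by (simp add: reverse_residue_def del: sum.lessThan_Suc)
next
  case False
  then have "N = 0" by simp
  then show ?thesis by (simp add: reverse_residue_def numeral_2_eq_2)
qed

text \<open>The shape in which both the residue and \<open>R_neg\<close> arise: \<open>j = 0\<close>
  is the leading term, and \<open>j = 1\<close> has weight 0.\<close>

lemma reverse_residue_split:
  "reverse_residue N = - (fact (2 * N) / fact (2 * N + 2)) +
     (\<Sum>j=2..2*N+1. (real j - 1) * bern j * (fact (2 * N) / fact (2 * N + 2 - j)))"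
proof -
  have "{..<2 * N + 2} = insert 0 (insert 1 {2..2*N+1})" by auto
  then have "(\<Sum>j<2 * N + 2. (real j - 1) * bern j / fact (2 * N + 2 - j)) =
      - (1 / fact (2 * N + 2)) + (\<Sum>j=2..2*N+1. (real j - 1) * bern j / fact (2 * N + 2 - j))"
    by (simp del: fact_Suc)
  then have "reverse_residue N = - (fact (2 * N) / fact (2 * N + 2)) +
     (\<Sum>j=2..2*N+1. fact (2 * N) * ((real j - 1) * bern j / fact (2 * N + 2 - j)))"
    unfolding reverse_residue_def
    by (simp only: distrib_left sum_distrib_left mult_minus_right times_divide_eq_right mult_1_right)
  then show ?thesis
    by (simp only: times_divide_eq_right mult.commute mult.left_commute)
qed

text \<open>Substitute \<open>j = 2 N + 2 - k\<close>: the zeta argument becomes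
  \<open>1 - j\<close>, the value there is a multiple of \<open>bern j\<close>, and its factorial
  combines with the binomial coefficient. The factorial quotient in \<open>R_neg\<close> is the term
  \<open>j = 0\<close> with opposite sign.\<close>

lemma R_neg_1_even: "R_neg 1 (2 * N) = - of_real (reverse_residue N)"
proof -
  have "(\<Sum>k | k \<in> {1..2*N} \<and> even k. of_nat (2 * N choose k) * zeta (of_nat k - of_nat 1 - of_nat (2 * N))) =
      (\<Sum>j | j \<in> {2..2*N+1} \<and> even j. - of_real ((real j - 1) * bern j * (fact (2 * N) / fact (2 * N + 2 - j))))"
  proof (rule sum.reindex_bij_witness [of _ "\<lambda>j. 2 * N + 2 - j" "\<lambda>k. 2 * N + 2 - k"])
    fix k assume k: "k \<in> {k. k \<in> {1..2*N} \<and> even k}"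
    then obtain i where i: "2 * N + 2 - k = 2 * i" by (metis dvd_def dvd_diff_nat even_add even_mult_iff even_numeral mem_Collect_eq)
    have i1: "i \<ge> 1" and ki: "k = 2 * N + 2 - 2 * i" "2 * i \<le> 2 * N + 2"
      using i k by auto
    have e: "of_nat k - of_nat 1 - of_nat (2 * N) = (1 - 2 * of_nat i :: complex)"
      using ki by (simp add: of_nat_diff)
    have z: "zeta (of_nat k - of_nat 1 - of_nat (2 * N)) = - fact (2 * i - 1) * of_real (bern (2 * i))"
      unfolding e by (rule zeta_neg_odd [OF i1])
    have ch: "real (2 * N choose k) = fact (2 * N) / (fact k * fact (2 * i - 2))"
    proof -
      have "2 * N - k = 2 * i - 2" using k ki by auto
      then show ?thesis using k binomial_fact [of k "2 * N", where 'a = real] by simp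
    qed
    have f: "fact (2 * i - 1) = real (2 * i - 1) * fact (2 * i - 2)"
      using i1 fact_reduce [of "2 * i - 1", where 'a = real] by (simp add: numeral_2_eq_2)
    have "real (2 * N choose k) * (- fact (2 * i - 1) * bern (2 * i)) =
        - ((real (2 * i) - 1) * bern (2 * i) * (fact (2 * N) / fact k))"
      unfolding ch f using i1 by (simp add: of_nat_diff)
    then have "of_real (real (2 * N choose k) * (- fact (2 * i - 1) * bern (2 * i))) =
        (of_real (- ((real (2 * i) - 1) * bern (2 * i) * (fact (2 * N) / fact k))) :: complex)"
      by (simp only:)
    then show "- of_real ((real (2 * N + 2 - k) - 1) * bern (2 * N + 2 - k) *
          (fact (2 * N) / fact (2 * N + 2 - (2 * N + 2 - k)))) =
        of_nat (2 * N choose k) * zeta (of_nat k - of_nat 1 - of_nat (2 * N))"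
      unfolding z i using ki by simp
  qed auto
  \<comment> \<open>Odd \<open>j\<close> may be added because \<open>bern j = 0\<close> for
    them.\<close>
  also have "\<dots> = (\<Sum>j=2..2*N+1. - of_real ((real j - 1) * bern j * (fact (2 * N) / fact (2 * N + 2 - j))))"
    by (rule sum.mono_neutral_left) (auto simp: bern_odd)
  also have "\<dots> = - of_real (\<Sum>j=2..2*N+1. (real j - 1) * bern j * (fact (2 * N) / fact (2 * N + 2 - j)))"
    by (simp add: sum_negf)
  finally have S: "(\<Sum>k | k \<in> {1..2*N} \<and> even k. of_nat (2 * N choose k) * zeta (of_nat k - of_nat 1 - of_nat (2 * N))) =
      - of_real (\<Sum>j=2..2*N+1. (real j - 1) * bern j * (fact (2 * N) / fact (2 * N + 2 - j)))" .
  have "1 + 2 * N + 1 = 2 * N + 2" "(- 1) ^ (2 * N) = (1 :: complex)" by simp_all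
  then show ?thesis
    unfolding R_neg_def S reverse_residue_split
    by (simp only: fact_1 mult_1_left of_real_add of_real_minus of_real_divide of_real_fact
        minus_add_distrib minus_minus)
qed

text \<open>For even \<open>j\<close> the point is an even integer: negative ones are simple zeros
  of \<open>zeta\<close>, at 0 the value is \<open>- 1/2\<close>, and from 2 on there is no
  zero.\<close>

lemma neg_log_deriv_polar_part:
  assumes "even j" "j \<ge> 2 \<or> j = 0"
  shows "polar_part neg_log_deriv (- 2 * of_nat N - 2 + of_nat j) (if j < 2 * N + 2 then - 1 else 0)"
proof (cases "j < 2 * N + 2")
  case True
  define n where "n = N + 1 - j div 2"
  have j: "j = 2 * (j div 2)" using assms(1) by simp
  have n: "n \<ge> 1" "n + j div 2 = N + 1" using True by (auto simp: n_def)
  have e1: "of_nat n + of_nat (j div 2) = (of_nat N + 1 :: complex)"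
    using n(2) by (metis of_nat_1 of_nat_add)
  have e2: "of_nat j = (2 * of_nat (j div 2) :: complex)"
    by (subst j) simp
  have "- 2 * of_nat N - 2 + of_nat j = (2 * of_nat (j div 2) - 2 * (of_nat N + 1) :: complex)"
    by (subst e2) simp
  also have "\<dots> = - 2 * of_nat n"
    unfolding e1 [symmetric] by (simp add: distrib_left)
  finally have eq: "- 2 * of_nat N - 2 + of_nat j = (- 2 * of_nat n :: complex)" .
  show ?thesis
    using neg_log_deriv_at_neg_even [OF n(1)] True unfolding eq polar_part_def by simp
next
  case False
  define n where "n = j - (2 * N + 2)"
  have eq: "- 2 * of_nat N - 2 + of_nat j = (of_nat n :: complex)"
    using False by (simp add: n_def of_nat_diff)
  have "even n" using assms(1) False by (simp add: n_def)
  then have "n = 0 \<or> n \<ge> 2" by (cases n; cases "n - 1") auto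
  then have "zeta (of_nat n) \<noteq> 0"
    using zeta_nonzero [of "of_nat n"] by (auto simp: zeta_0)
  moreover have "(of_nat n :: complex) \<noteq> 1"
    using \<open>even n\<close> by (metis odd_one of_nat_1 of_nat_eq_iff)
  ultimately have "polar_part neg_log_deriv (of_nat n) 0"
    by (intro polar_part_isCont isCont_neg_log_deriv)
  then show ?thesis
    unfolding eq using False by (simp only: if_False)
qed

text \<open>The bound on \<open>J\<close> puts \<open>- 2 N\<close> inside the half-plane
  \<open>Re s > 6 - J\<close>, where \<open>rem_series J\<close> is holomorphic. Each
  \<open>neg_log_deriv\<close> at a trivial zero has residue \<open>- 1\<close>, so the subtracted
  sum contributes with a plus sign and the leading term with a minus sign.\<close>

lemma continuation_polar_part:
  assumes "J \<ge> 2 * N + 7"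
  shows "polar_part (continuation J) (- 2 * of_nat N) (of_real (reverse_residue N))"
proof -
  define u :: complex where "u = - 2 * of_nat N"
  define c where "c = (\<lambda>j s. of_nat (j - 1) * of_real (bern j) * pochhammer s (j - 2) :: complex)"
  have Re_u: "Re u = - 2 * real N" by (simp add: u_def)
  have u12: "u - 1 \<noteq> 0" "u - 2 \<noteq> 0"
    using Re_u by (auto simp: complex_eq_iff)
  have P: "polar_part (\<lambda>s. neg_log_deriv (s - 2 + of_nat j)) u (if j < 2 * N + 2 then - 1 else 0)"
    if "even j" "j \<ge> 2 \<or> j = 0" for j
    using polar_part_shift [of neg_log_deriv u "- 2 + of_nat j"] neg_log_deriv_polar_part [OF that, of N]
    by (simp add: u_def algebra_simps)
  have "polar_part (\<lambda>s. 1 / ((s - 1) * (s - 2)) * neg_log_deriv (s - 2 + of_nat 0)) u (1 / ((u - 1) * (u - 2)) * (- 1))"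
    using P [of 0] u12 by (intro polar_part_mult) (auto intro!: derivative_intros)
  then have 1: "polar_part (\<lambda>s. neg_log_deriv (s - 2) / ((s - 1) * (s - 2))) u (- of_real (fact (2 * N) / fact (2 * N + 2)))"
  proof -
    have "(u - 1) * (u - 2) = of_real ((2 * real N + 1) * (2 * real N + 2))"
      by (simp add: u_def algebra_simps)
    moreover have "fact (2 * N) / fact (2 * N + 2) = (1 / ((2 * real N + 1) * (2 * real N + 2)))"
      by (simp add: divide_simps) (simp add: algebra_simps)
    ultimately have "1 / ((u - 1) * (u - 2)) * (- 1) = - of_real (fact (2 * N) / fact (2 * N + 2))"
      by simp
    then show ?thesis
      using \<open>polar_part (\<lambda>s. 1 / ((s - 1) * (s - 2)) * neg_log_deriv (s - 2 + of_nat 0)) u (1 / ((u - 1) * (u - 2)) * (- 1))\<close>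
      by (simp only: of_nat_0 add_0_right times_divide_eq_left mult_1)
  qed
  have 2: "polar_part (\<lambda>s. - c j s * neg_log_deriv (s - 2 + of_nat j)) u
      (if j < 2 * N + 2 then c j u else 0)" if j: "j \<in> {2..J}" for j
  proof (cases "even j")
    case True
    have "polar_part (\<lambda>s. - c j s * neg_log_deriv (s - 2 + of_nat j)) u (- c j u * (if j < 2 * N + 2 then - 1 else 0))"
    proof (rule polar_part_mult)
      have "(\<lambda>s. pochhammer s (j - 2)) holomorphic_on UNIV"
        unfolding pochhammer_prod by (intro holomorphic_intros)
      then have "(\<lambda>s. - c j s) holomorphic_on UNIV"
        unfolding c_def by (intro holomorphic_intros)
      then show "(\<lambda>s. - c j s) field_differentiable at u"
        by (rule holomorphic_on_imp_differentiable_at) auto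
    qed (use P [OF True] j in auto)
    then show ?thesis by (simp split: if_splits)
  next
    case False
    \<comment> \<open>At odd \<open>j\<close> the argument of \<open>neg_log_deriv\<close> is an odd
      integer, and for \<open>j = 2 N + 3\<close> it is the pole 1 of \<open>zeta\<close>; the zero
      coefficient removes the term identically.\<close>
    then have "bern j = 0" using j by (intro bern_odd) auto
    then show ?thesis by (auto simp: c_def intro: polar_part_isCont)
  qed
  have "polar_part (\<lambda>s. \<Sum>j=2..J. - c j s * neg_log_deriv (s - 2 + of_nat j)) u
      (\<Sum>j=2..J. if j < 2 * N + 2 then c j u else 0)"
    by (rule polar_part_sum [OF 2])
  also have "(\<Sum>j=2..J. if j < 2 * N + 2 then c j u else 0) = (\<Sum>j=2..2*N+1. c j u)"
    using assms by (intro sum.mono_neutral_cong_right) auto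
  also have "\<dots> = of_real (\<Sum>j=2..2*N+1. (real j - 1) * bern j * (fact (2 * N) / fact (2 * N + 2 - j)))"
    unfolding of_real_sum
  proof (rule sum.cong)
    fix j assume j: "j \<in> {2..2*N+1}"
    show "c j u = of_real ((real j - 1) * bern j * (fact (2 * N) / fact (2 * N + 2 - j)))"
    proof (cases "even j")
      case True
      have "j - 2 \<le> 2 * N" "2 * N - (j - 2) = 2 * N + 2 - j" using j by auto
      then have "pochhammer u (j - 2) = fact (2 * N) / fact (2 * N + 2 - j)"
        using pochhammer_neg_nat [of "j - 2" "2 * N", where 'a = complex] True by (simp add: u_def)
      then show ?thesis using j by (simp add: c_def of_nat_diff)
    next
      case False
      then have "bern j = 0" using j by (intro bern_odd) auto
      then show ?thesis by (simp add: c_def)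
    qed
  qed simp
  finally have 3: "polar_part (\<lambda>s. \<Sum>j=2..J. - c j s * neg_log_deriv (s - 2 + of_nat j)) u
      (of_real (\<Sum>j=2..2*N+1. (real j - 1) * bern j * (fact (2 * N) / fact (2 * N + 2 - j))))" .
  have "u \<in> {s. Re s > 6 - real J}" using assms Re_u by auto
  then have "isCont (rem_series J) u"
    using holomorphic_on_imp_continuous_on [OF holomorphic_rem_series [of J]] open_Re_gt
    by (simp add: continuous_on_eq_continuous_at)
  then have 4: "polar_part (rem_series J) u 0"
    by (rule polar_part_isCont)
  have "continuation J = (\<lambda>s. neg_log_deriv (s - 2) / ((s - 1) * (s - 2)) +
      (\<Sum>j=2..J. - c j s * neg_log_deriv (s - 2 + of_nat j)) + rem_series J s)"
    by (simp add: fun_eq_iff continuation_def c_def sum_negf)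
  with polar_part_add [OF polar_part_add [OF 1 3] 4] show ?thesis
    unfolding reverse_residue_split u_def by simp
qed

text \<open>For \<open>Re s2 > 10\<close> the inner limit is the convergent series on the line.
  Since \<open>G\<close> is meromorphic in the plane, its equality with the continuation there
  spreads over the half-plane, off a sparse set.\<close>

lemma slice_limit_eq_continuation:
  assumes Phi: "is_Phi2 Phi" and J: "J \<ge> 1"
  obtains G where "\<And>b. \<forall>\<^sub>F s2 in at b. ((\<lambda>s1. Phi (s1, s2)) \<longlongrightarrow> G s2) (at (- 1))"
    and "\<And>b. Re b > 6 - real J \<Longrightarrow> \<forall>\<^sub>F s2 in at b. G s2 = continuation J s2"
proof -
  have mero: "meromorphic2 Phi" using Phi by (simp add: is_Phi2_def)
  have lim: "((\<lambda>s1. Phi (s1, s2)) \<longlongrightarrow> Phi2_series (- 1) s2) (at (- 1))" if "Re s2 > 10" for s2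
  proof -
    have "\<forall>\<^sub>F s1 in at (- 1). s1 \<in> ball (- 1 :: complex) 1"
      by (intro eventually_at_in_open') auto
    then have "\<forall>\<^sub>F s1 in at (- 1). Phi2_series s1 s2 = Phi (s1, s2)"
    proof eventually_elim
      case (elim s1)
      then have "Re s1 \<ge> - 2" using Re_ge_in_ball [OF elim] by simp
      then show ?case using Phi that by (simp add: is_Phi2_def)
    qed
    then show ?thesis using Phi2_series_tendsto [of s2] that tendsto_cong by fastforce
  qed
  have far: "\<forall>\<^sub>F s2 in at b. Re s2 > 10" if "Re b > 10" for b
    using eventually_at_in_open' [OF open_Re_gt [of 10], of b] that by simp
  have ev11: "\<forall>\<^sub>F s2 in at 11. \<exists>L. ((\<lambda>s1. Phi (s1, s2)) \<longlongrightarrow> L) (at (- 1))"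
    by (rule eventually_mono [OF far]) (use lim in auto)
  define G where "G = (\<lambda>w. Lim (at (- 1)) (\<lambda>z. Phi (z, w)))"
  have G: "\<forall>\<^sub>F s2 in at b. ((\<lambda>s1. Phi (s1, s2)) \<longlongrightarrow> G s2) (at (- 1))" "G meromorphic_on UNIV" for b
    using meromorphic2_slice_limit_global [OF mero ev11] by (simp_all add: G_def)
  define S where "S = {s. Re s > 6 - real J}"
  have S: "open S" "connected S"
    unfolding S_def using convex_halfspace_Re_gt [of "6 - real J"] open_Re_gt convex_connected by auto
  have "(\<lambda>s. G s - continuation J s) meromorphic_on S"
    using meromorphic_on_subset [OF G(2)] meromorphic_continuation [of J]
    unfolding S_def by (intro meromorphic_on_diff) auto
  from meromorphic_imp_constant_or_avoid [OF this S, of 0]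
  have "\<forall>\<^sub>F s in cosparse S. G s - continuation J s = 0"
  proof
    assume "\<forall>\<^sub>F s in cosparse S. G s - continuation J s \<noteq> 0"
    \<comment> \<open>A point of the half-plane \<open>S\<close> near which the series also
      converges.\<close>
    moreover have "of_nat (11 + J) \<in> S" by (simp add: S_def)
    ultimately have "\<forall>\<^sub>F s in at (of_nat (11 + J)). G s - continuation J s \<noteq> 0"
      using S(1) by (simp add: eventually_cosparse_open_eq del: of_nat_add)
    moreover have "\<forall>\<^sub>F s in at (of_nat (11 + J)). Re s > 10"
      by (rule far) simp
    ultimately have "\<forall>\<^sub>F s in at (of_nat (11 + J) :: complex). False"
    proof eventually_elim
      case (elim s)
      have "G s = Phi2_series (- 1) s"
        unfolding G_def by (rule tendsto_Lim [OF at_neq_bot lim [OF elim(2)]])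
      with elim J show ?case by (simp add: Phi2_series_eq_continuation)
    qed
    then show ?thesis by simp
  qed
  then have "\<forall>\<^sub>F s2 in at b. G s2 = continuation J s2" if "Re b > 6 - real J" for b
    using that S(1) by (simp add: eventually_cosparse_open_eq S_def)
  with G(1) show ?thesis by (rule that)
qed

lemma reverse_value_convergent_iff:
  assumes "is_Phi2 Phi"
  shows "reverse_value_convergent Phi (- 1) (- 2 * of_nat N) \<longleftrightarrow> reverse_residue N = 0"
proof -
  define u :: complex where "u = - 2 * of_nat N"
  have J: "2 * N + 7 \<ge> 1" by simp
  obtain G where G': "\<And>b. \<forall>\<^sub>F s2 in at b. ((\<lambda>s1. Phi (s1, s2)) \<longlongrightarrow> G s2) (at (- 1))"
    "\<And>b. Re b > 6 - real (2 * N + 7) \<Longrightarrow> \<forall>\<^sub>F s2 in at b. G s2 = continuation (2 * N + 7) s2"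
    using slice_limit_eq_continuation [OF assms J] by blast
  have G: "\<forall>\<^sub>F s2 in at u. ((\<lambda>s1. Phi (s1, s2)) \<longlongrightarrow> G s2) (at (- 1))"
    by (rule G'(1))
  have "\<forall>\<^sub>F s2 in at u. G s2 = continuation (2 * N + 7) s2"
    by (rule G'(2)) (simp add: u_def)
  then have pG: "polar_part G u (of_real (reverse_residue N))"
    using continuation_polar_part [of N "2 * N + 7"] polar_part_cong unfolding u_def by fast
  have "reverse_value_convergent Phi (- 1) u \<longleftrightarrow> polar_part G u 0"
  proof
    assume "reverse_value_convergent Phi (- 1) u"
    then obtain L G' where G': "\<forall>\<^sub>F s2 in at u. ((\<lambda>s1. Phi (s1, s2)) \<longlongrightarrow> G' s2) (at (- 1))" "(G' \<longlongrightarrow> L) (at u)"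
      unfolding reverse_value_convergent_def has_reverse_value_def by blast
    have "\<forall>\<^sub>F s2 in at u. G' s2 = G s2"
      using G G'(1) by eventually_elim (rule tendsto_unique [OF at_neq_bot])
    then have "polar_part G' u 0 \<longleftrightarrow> polar_part G u 0" by (rule polar_part_cong)
    with G'(2) show "polar_part G u 0" by (auto simp: polar_part_0_iff)
  next
    assume "polar_part G u 0"
    with G show "reverse_value_convergent Phi (- 1) u"
      unfolding reverse_value_convergent_def has_reverse_value_def polar_part_0_iff by blast
  qed
  also have "\<dots> \<longleftrightarrow> reverse_residue N = 0"
    using pG polar_part_unique [OF pG, of 0] by auto
  finally show ?thesis by (simp add: u_def)
qed

theorem theorem4p1:
  shows "(\<forall>N::nat. R_neg 1 (2 * N) = (if N \<ge> 1 then 0 else 1 / 2)) \<and>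
    (\<forall>Phi. is_Phi2 Phi \<longrightarrow>
       (\<forall>N::nat. N \<ge> 1 \<longrightarrow> reverse_value_convergent Phi (- 1) (- 2 * of_nat N)) \<and>
       \<not> reverse_value_convergent Phi (- 1) 0)"
proof (intro conjI allI impI)
  show "R_neg 1 (2 * N) = (if N \<ge> 1 then 0 else 1 / 2)" for N
    unfolding R_neg_1_even reverse_residue_eq by simp
next
  fix Phi and N :: nat
  assume "is_Phi2 Phi" "N \<ge> 1"
  then show "reverse_value_convergent Phi (- 1) (- 2 * of_nat N)"
    by (simp only: reverse_value_convergent_iff reverse_residue_eq if_True)
next
  fix Phi
  assume "is_Phi2 Phi"
  then show "\<not> reverse_value_convergent Phi (- 1) 0"
    using reverse_value_convergent_iff [of Phi 0] by (simp add: reverse_residue_eq)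
qed

end
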